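(* Every $\mathbb{H}_3$-subgraph-free $C_5$-critical graph is isomorphic to one of the following: $K_3$; the $C_5$-flower $F_n$ for some odd $n\ge 3$; or one of the graphs $E_1$, $E_2$, $E_3$. Equivalently: (1) every $\mathbb{H}_3$-subgraph-free graph of girth at least $6$ admits a homomorphism to $C_5$; (2) the only $\mathbb{H}_3$-subgraph-free $C_5$-critical graphs of girth $5$ are $E_1$, $E_2$ and the flowers $F_n$ with $n\ge 3$ odd; (3) the only $\mathbb{H}_3$-subgraph-free $C_5$-critical graph of girth $4$ is $E_3$.
   Context: All graphs are finite and simple. A graph $G$ is $H$-subgraph-free if it does not contain $H$ as a (not necessarily induced) subgraph. $\mathbb{H}_3$ is the graph consisting of a path $u,v,w,x$ (three edges) together with two further leaves adjacent to $u$ and two further leaves adjacent to $x$ (8 vertices). A graph is $C_5$-colourable if it has a homomorphism to $C_5$; it is $C_5$-critical if it is not $C_5$-colourable but every proper subgraph is. For $n\ge 3$, the $C_5$-flower $F_n$ is obtained from the cycle $C_{3n}$ by adding a new central vertex adjacent to every third vertex of the cycle. Let $v_1v_2v_3v_4v_5v_1$ be a $5$-cycle and add new vertices $u_2,u_3,u_4$ with edges $v_1u_2,u_2u_3,u_3u_4,u_4v_5$. Then $E_1$ is obtained by further adding a new vertex $m$ with edges $v_3m$ and $mu_4$; $E_2$ is obtained by further adding the edge $v_3u_3$; $E_3$ is obtained by further adding the edge $v_2u_4$. *)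

theory Defs
  imports "Graph_Theory.Graph_Theory" "HOL-Library.Extended_Nat"
begin

text \<open>
  A finite simple graph is a \<^typ>\<open>'a pair_pre_digraph\<close> satisfying \<^locale>\<open>pair_graph\<close>: the
  vertex set is finite and the arcs form a finite, irreflexive, symmetric relation, an edge
  being a pair of opposite arcs. The postfix superscript \<open>s\<close> is the symmetric closure
  \<^const>\<open>symcl\<close>.
\<close>

definition graph_hom :: "('a \<Rightarrow> 'b) \<Rightarrow> 'a pair_pre_digraph \<Rightarrow> 'b pair_pre_digraph \<Rightarrow> bool" where
  "graph_hom f G H \<longleftrightarrow>
     (\<forall>u \<in> pverts G. f u \<in> pverts H) \<and> (\<forall>(u, v) \<in> parcs G. (f u, f v) \<in> parcs H)"

abbreviation graph_iso :: "'a pair_pre_digraph \<Rightarrow> 'b pair_pre_digraph \<Rightarrow> bool" (infix "\<cong>\<^sub>g" 50) where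
  "G \<cong>\<^sub>g H \<equiv> digraph_iso (with_proj G) (with_proj H)"

definition contains_subgraph :: "'a pair_pre_digraph \<Rightarrow> 'b pair_pre_digraph \<Rightarrow> bool" where
  "contains_subgraph G H \<longleftrightarrow>
     (\<exists>S :: 'a pair_pre_digraph. subgraph (with_proj S) (with_proj G) \<and> H \<cong>\<^sub>g S)"

abbreviation subgraph_free :: "'b pair_pre_digraph \<Rightarrow> 'a pair_pre_digraph \<Rightarrow> bool" where
  "subgraph_free H G \<equiv> \<not> contains_subgraph G H"

text \<open>
  \<^const>\<open>pre_digraph.cycle\<close> also admits the closed walk that traverses an edge back and forth,
  hence the length bound. Acyclic graphs have girth \<open>\<infinity>\<close>.
\<close>

definition girth :: "'a pair_pre_digraph \<Rightarrow> enat" where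
  "girth G = Inf {enat (length p) | p. pre_digraph.cycle (with_proj G) p \<and> 3 \<le> length p}"

definition cycle_graph :: "nat \<Rightarrow> nat pair_pre_digraph" where
  "cycle_graph n = \<lparr> pverts = {..<n}, parcs = {(i, Suc i mod n) | i. i < n}\<^sup>s \<rparr>"

definition C5_colourable :: "'a pair_pre_digraph \<Rightarrow> bool" where
  "C5_colourable G \<longleftrightarrow> (\<exists>f. graph_hom f G (cycle_graph 5))"

definition C5_critical :: "'a pair_pre_digraph \<Rightarrow> bool" where
  "C5_critical G \<longleftrightarrow> \<not> C5_colourable G \<and>
     (\<forall>S. pair_graph S \<and> subgraph (with_proj S) (with_proj G) \<and> S \<noteq> G \<longrightarrow> C5_colourable S)"

text \<open>The path \<open>u, v, w, x\<close> is \<open>0, 1, 2, 3\<close>; the leaves are \<open>4, 5\<close> at \<open>u\<close> and \<open>6, 7\<close> at \<open>x\<close>.\<close>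

definition H3_graph :: "nat pair_pre_digraph" where
  "H3_graph = \<lparr> pverts = {..<8},
     parcs = {(0, 1), (1, 2), (2, 3), (0, 4), (0, 5), (3, 6), (3, 7)}\<^sup>s \<rparr>"

text \<open>The central vertex is \<open>3 * n\<close>.\<close>

definition flower :: "nat \<Rightarrow> nat pair_pre_digraph" where
  "flower n = \<lparr> pverts = insert (3 * n) (pverts (cycle_graph (3 * n))),
     parcs = parcs (cycle_graph (3 * n)) \<union> {(3 * n, 3 * i) | i. i < n}\<^sup>s \<rparr>"

text \<open>\<open>Ev i\<close>, \<open>Eu i\<close> and \<open>Em\<close> stand for the vertices $v_i$, $u_i$ and $m$.\<close>

datatype evertex = Ev nat | Eu nat | Em

definition E_base :: "evertex pair_pre_digraph" where
  "E_base = \<lparr> pverts = {Ev 1, Ev 2, Ev 3, Ev 4, Ev 5, Eu 2, Eu 3, Eu 4},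
     parcs = {(Ev 1, Ev 2), (Ev 2, Ev 3), (Ev 3, Ev 4), (Ev 4, Ev 5), (Ev 5, Ev 1),
              (Ev 1, Eu 2), (Eu 2, Eu 3), (Eu 3, Eu 4), (Eu 4, Ev 5)}\<^sup>s \<rparr>"

definition E1_graph :: "evertex pair_pre_digraph" where
  "E1_graph = \<lparr> pverts = insert Em (pverts E_base),
     parcs = parcs E_base \<union> {(Ev 3, Em), (Em, Eu 4)}\<^sup>s \<rparr>"

definition E2_graph :: "evertex pair_pre_digraph" where
  "E2_graph = \<lparr> pverts = pverts E_base, parcs = parcs E_base \<union> {(Ev 3, Eu 3)}\<^sup>s \<rparr>"

definition E3_graph :: "evertex pair_pre_digraph" where
  "E3_graph = \<lparr> pverts = pverts E_base, parcs = parcs E_base \<union> {(Ev 2, Eu 4)}\<^sup>s \<rparr>"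

end

theory Submission
  imports Defs
begin

text \<open>
  A critical graph \<open>G\<close> contains no obstruction properly, so it suffices to find a triangle, an odd
  flower or one of \<open>E1\<close>, \<open>E2\<close>, \<open>E3\<close> inside \<open>G\<close>. Criticality is used in two ways: no vertex has its
  neighbourhood inside that of another one, and no nonempty set \<open>D\<close> of vertices is such that all colourings of
  \<open>G - D\<close> extend to \<open>G\<close>. In particular all degrees are at least two, and three vertices of degree two
  never lie consecutively on a path.

  Let \<open>G\<close> have neither a triangle nor a 4-cycle. Then a path of length three between vertices of degree at
  least three forces both ends to have degree three and a common neighbour. If two adjacent vertices have
  degree two, they lie on a path \<open>u, p, q, x\<close> whose ends have a common neighbour \<open>c\<close>, and one can either
  continue this petal around \<open>c\<close> to a flower or finds \<open>E1\<close>. Otherwise an edge between two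
  vertices of degree at least three leads to \<open>E2\<close>, and without such an edge \<open>G\<close> is bipartite.

  If \<open>G\<close> has a 4-cycle but no triangle, each of its vertices has a private neighbour not adjacent to the
  opposite vertex. If both pairs of opposite vertices are joined by a path of length three through
  outside neighbours, these form an \<open>E3\<close>; if some pair is not, following the private neighbours of that
  pair again leads to \<open>E3\<close> or to a graph that is \<open>C5\<close>-colourable.
\<close>

section \<open>Colourings and embeddings\<close>

text \<open>The target \<open>C5\<close> enters only through its walks. Any two colours are joined
  by a walk of length four; by one of length three exactly if they differ; by one of length two
  exactly if they are not adjacent. So a path with three inner vertices of degree two constrains
  nothing, one with two inner vertices makes its ends differ, and one with a single inner vertex
  forbids adjacent colours at its ends. Flowers arise this way: successive feet must use the two
  neighbours of the centre's colour alternately, which is impossible exactly for an odd number of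
  petals. The obstacle is that an \<open>H3\<close> needs disjoint leaves at both ends of its path,
  and shared neighbours spoil this. Without 4-cycles two vertices share at most one neighbour, so
  the exceptional case is rigid. With 4-cycles this control is lost, and private neighbours take its
  place. The claim for girth at least six does not assume criticality; it is reduced to a minimal
  non-colourable subgraph.\<close>

datatype col = C0 | C1 | C2 | C3 | C4

primrec nxt :: "col \<Rightarrow> col" where
  "nxt C0 = C1" | "nxt C1 = C2" | "nxt C2 = C3" | "nxt C3 = C4" | "nxt C4 = C0"

definition adj :: "col \<Rightarrow> col \<Rightarrow> bool" where
  "adj a b \<longleftrightarrow> b = nxt a \<or> a = nxt b"

text \<open>With five named colours instead of residues modulo 5, quantifiers over colours unfold
  into finite case lists, and the facts about walks in \<open>C5\<close> are settled by evaluation.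
  \<open>C5_colourable_iff\<close> translates back to \<open>cycle_graph 5\<close>.\<close>

lemma all_col: "(\<forall>x. P x) \<longleftrightarrow> P C0 \<and> P C1 \<and> P C2 \<and> P C3 \<and> P C4"
  by (metis col.exhaust)

lemma ex_col: "(\<exists>x. P x) \<longleftrightarrow> P C0 \<or> P C1 \<or> P C2 \<or> P C3 \<or> P C4"
  by (metis col.exhaust)

lemma adj_sym: "adj a b \<longleftrightarrow> adj b a"
  by (auto simp: adj_def)

lemma adj_simps [simp]:
  "adj C0 b \<longleftrightarrow> b = C1 \<or> b = C4" "adj C1 b \<longleftrightarrow> b = C0 \<or> b = C2" "adj C2 b \<longleftrightarrow> b = C1 \<or> b = C3"
  "adj C3 b \<longleftrightarrow> b = C2 \<or> b = C4" "adj C4 b \<longleftrightarrow> b = C0 \<or> b = C3"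
  by (cases b; simp add: adj_def)+

lemma ex_adj: "\<exists>b. adj a b"
  by (auto simp: adj_def)

text \<open>From a colour to itself or to distance two one walks with a detour back and forth; to a
  neighbour one takes the long way round.\<close>

lemma walk4: "\<exists>p q r. adj a p \<and> adj p q \<and> adj q r \<and> adj r b"
proof -
  have "\<forall>a b. \<exists>p q r. adj a p \<and> adj p q \<and> adj q r \<and> adj r b"
    unfolding all_col ex_col by simp
  then show ?thesis by blast
qed

lemma walk3: "(\<exists>p q. adj a p \<and> adj p q \<and> adj q b) \<longleftrightarrow> a \<noteq> b"
proof -
  have "\<forall>a b. (\<exists>p q. adj a p \<and> adj p q \<and> adj q b) \<longleftrightarrow> a \<noteq> b"
    unfolding all_col ex_col by simp
  then show ?thesis by blast
qed

lemma walk2: "(\<exists>p. adj a p \<and> adj p b) \<longleftrightarrow> \<not> adj a b"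
proof -
  have "\<forall>a b. (\<exists>p. adj a p \<and> adj p b) \<longleftrightarrow> \<not> adj a b"
    unfolding all_col ex_col by simp
  then show ?thesis by blast
qed

section \<open>Embeddings of the exceptional graphs and of flowers\<close>

definition evertex_map :: "'a \<Rightarrow> 'a \<Rightarrow> 'a \<Rightarrow> 'a \<Rightarrow> 'a \<Rightarrow> 'a \<Rightarrow> 'a \<Rightarrow> 'a \<Rightarrow> 'a \<Rightarrow> evertex \<Rightarrow> 'a" where
  "evertex_map v1 v2 v3 v4 v5 u2 u3 u4 m x = (case x of
     Ev n \<Rightarrow> if n = 1 then v1 else if n = 2 then v2 else if n = 3 then v3 else if n = 4 then v4 else v5
   | Eu n \<Rightarrow> if n = 2 then u2 else if n = 3 then u3 else u4
   | Em \<Rightarrow> m)"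

text \<open>The host is a bare relation, as in the locales below, and only arcs are constrained. For
  graphs without isolated vertices this amounts to \<open>contains_subgraph\<close>, see
  \<open>contains_subgraph_iff\<close>.\<close>

definition embeds :: "'b pair_pre_digraph \<Rightarrow> ('a \<Rightarrow> 'a \<Rightarrow> bool) \<Rightarrow> bool" where
  "embeds H E \<longleftrightarrow> (\<exists>\<phi>. inj_on \<phi> (pverts H) \<and> (\<forall>(a, b) \<in> parcs H. E (\<phi> a) (\<phi> b)))"

lemma symcl_Un: "(A \<union> B)\<^sup>s = A\<^sup>s \<union> B\<^sup>s"
  by (auto simp: symcl_def)

lemma symcl_ball:
  assumes "\<And>x y. E x y \<Longrightarrow> E y x"
  shows "(\<forall>(a, b) \<in> A\<^sup>s. E (\<phi> a) (\<phi> b)) \<longleftrightarrow> (\<forall>(a, b) \<in> A. E (\<phi> a) (\<phi> b))"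
proof -
  have "(\<forall>(a, b) \<in> converse A. E (\<phi> a) (\<phi> b))" if "\<forall>(a, b) \<in> A. E (\<phi> a) (\<phi> b)"
    using assms that by auto
  moreover have "A\<^sup>s = A \<union> converse A" by (auto simp: symcl_def)
  ultimately show ?thesis by (simp add: ball_Un) blast
qed

lemma embeds_E1I:
  assumes "\<And>x y. E x y \<Longrightarrow> E y x" and "distinct [v1, v2, v3, v4, v5, u2, u3, u4, m]"
    and "E v1 v2" "E v2 v3" "E v3 v4" "E v4 v5" "E v5 v1" "E v1 u2" "E u2 u3" "E u3 u4" "E u4 v5"
    and "E v3 m" "E m u4"
  shows "embeds E1_graph E"
  unfolding embeds_def
proof (intro exI conjI)
  let ?f = "evertex_map v1 v2 v3 v4 v5 u2 u3 u4 m"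
  show "inj_on ?f (pverts E1_graph)"
    using assms(2) by (auto simp: E1_graph_def E_base_def inj_on_def evertex_map_def)
  show "\<forall>(a, b) \<in> parcs E1_graph. E (?f a) (?f b)"
    using assms by (simp add: E1_graph_def E_base_def flip: symcl_Un) (simp add: symcl_ball evertex_map_def)
qed

lemma embeds_E2I:
  assumes "\<And>x y. E x y \<Longrightarrow> E y x" and "distinct [v1, v2, v3, v4, v5, u2, u3, u4]"
    and "E v1 v2" "E v2 v3" "E v3 v4" "E v4 v5" "E v5 v1" "E v1 u2" "E u2 u3" "E u3 u4" "E u4 v5"
    and "E v3 u3"
  shows "embeds E2_graph E"
  unfolding embeds_def
proof (intro exI conjI)
  \<comment> \<open>\<open>E2_graph\<close> has no vertex \<open>Em\<close>; the last argument is a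
    filler.\<close>
  let ?f = "evertex_map v1 v2 v3 v4 v5 u2 u3 u4 u2"
  show "inj_on ?f (pverts E2_graph)"
    using assms(2) by (auto simp: E2_graph_def E_base_def inj_on_def evertex_map_def)
  show "\<forall>(a, b) \<in> parcs E2_graph. E (?f a) (?f b)"
    using assms by (simp add: E2_graph_def E_base_def flip: symcl_Un) (simp add: symcl_ball evertex_map_def)
qed

lemma embeds_E3I:
  assumes "\<And>x y. E x y \<Longrightarrow> E y x" and "distinct [v1, v2, v3, v4, v5, u2, u3, u4]"
    and "E v1 v2" "E v2 v3" "E v3 v4" "E v4 v5" "E v5 v1" "E v1 u2" "E u2 u3" "E u3 u4" "E u4 v5"
    and "E v2 u4"
  shows "embeds E3_graph E"
  unfolding embeds_def
proof (intro exI conjI)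
  let ?f = "evertex_map v1 v2 v3 v4 v5 u2 u3 u4 u2"
  show "inj_on ?f (pverts E3_graph)"
    using assms(2) by (auto simp: E3_graph_def E_base_def inj_on_def evertex_map_def)
  show "\<forall>(a, b) \<in> parcs E3_graph. E (?f a) (?f b)"
    using assms by (simp add: E3_graph_def E_base_def flip: symcl_Un) (simp add: symcl_ball evertex_map_def)
qed

lemma embeds_flowerI:
  assumes "\<And>x y. E x y \<Longrightarrow> E y x" and "inj_on f {..<3 * n}" and "\<And>k. k < 3 * n \<Longrightarrow> f k \<noteq> c"
    and "\<And>k. k < 3 * n \<Longrightarrow> E (f k) (f (Suc k mod (3 * n)))" and "\<And>i. i < n \<Longrightarrow> E c (f (3 * i))"
  shows "embeds (flower n) E"
  unfolding embeds_def
proof (intro exI conjI)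
  let ?f = "f(3 * n := c)"
  show "inj_on ?f (pverts (flower n))"
    using assms(2,3) by (auto simp: flower_def cycle_graph_def inj_on_def)
  show "\<forall>(a, b) \<in> parcs (flower n). E (?f a) (?f b)"
  proof -
    have "E (?f (Suc i mod (3 * n))) (?f i)" "E (?f i) (?f (Suc i mod (3 * n)))" if "i < 3 * n" for i
    proof -
      have "Suc i mod (3 * n) < 3 * n" by (rule mod_less_divisor) (use that in auto)
      then show "E (?f i) (?f (Suc i mod (3 * n)))" using assms(4)[OF that] that by (simp add: less_imp_neq)
      then show "E (?f (Suc i mod (3 * n))) (?f i)" by (rule assms(1))
    qed
    then have "\<forall>(a, b) \<in> {(i, Suc i mod (3 * n)) |i. i < 3 * n}. E (?f a) (?f b)" by blast
    moreover have "\<forall>(a, b) \<in> {(3 * n, 3 * i) |i. i < n}. E (?f a) (?f b)"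
      using assms(5) by auto
    ultimately have "\<forall>(a, b) \<in> {(i, Suc i mod (3 * n)) |i. i < 3 * n} \<union> {(3 * n, 3 * i) |i. i < n}. E (?f a) (?f b)"
      unfolding ball_Un by blast
    then show ?thesis using symcl_ball[of E _ ?f, OF assms(1)]
      by (simp add: flower_def cycle_graph_def flip: symcl_Un)
  qed
qed

text \<open>Of criticality only vertex deletion is kept: every proper set of vertices induces a
  colourable graph. Edge criticality enters separately, when \<open>critical_embeds_iso\<close>
  identifies the graph with an obstruction found inside it.\<close>

locale triangle_free_critical =
  fixes V :: "'a set" and E :: "'a \<Rightarrow> 'a \<Rightarrow> bool"
  assumes fin: "finite V"
    and sym: "E x y \<Longrightarrow> E y x" and irr: "\<not> E x x" and inV: "E x y \<Longrightarrow> x \<in> V"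
    and noncol: "\<not> (\<forall>x y. E x y \<longrightarrow> adj (f x) (f y))"
    and vcrit: "W \<subset> V \<Longrightarrow> \<exists>f. \<forall>x\<in>W. \<forall>y\<in>W. E x y \<longrightarrow> adj (f x) (f y)"
    and tri: "E a b \<Longrightarrow> E b c \<Longrightarrow> E c a \<Longrightarrow> False"
    and H3: "E u v \<Longrightarrow> E v w \<Longrightarrow> E w x \<Longrightarrow> E u a \<Longrightarrow> E u b \<Longrightarrow> E x c \<Longrightarrow> E x d \<Longrightarrow>
      distinct [u, v, w, x, a, b, c, d] \<Longrightarrow> False"
begin

definition n2 :: "'a \<Rightarrow> 'a \<Rightarrow> 'a \<Rightarrow> bool" where
  "n2 x a b \<longleftrightarrow> a \<noteq> b \<and> (\<forall>y. E x y \<longleftrightarrow> y = a \<or> y = b)"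

definition n3 :: "'a \<Rightarrow> 'a \<Rightarrow> 'a \<Rightarrow> 'a \<Rightarrow> bool" where
  "n3 x a b c \<longleftrightarrow> a \<noteq> b \<and> a \<noteq> c \<and> b \<noteq> c \<and> (\<forall>y. E x y \<longleftrightarrow> y = a \<or> y = b \<or> y = c)"

text \<open>Branch vertices, that is, degree at least three. Degrees are expressed through named
  neighbours rather than cardinalities, since the neighbours themselves are what the arguments
  use.\<close>

definition B :: "'a \<Rightarrow> bool" where
  "B x \<longleftrightarrow> (\<exists>a b c. E x a \<and> E x b \<and> E x c \<and> a \<noteq> b \<and> a \<noteq> c \<and> b \<noteq> c)"

text \<open>The graph outside \<open>D\<close> is colourable by \<open>vcrit\<close>. The hypothesis
  on \<open>f\<close> does not ask it to be proper outside \<open>D\<close>, so checking an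
  extension is a purely local matter.\<close>

lemma reducible:
  assumes "x \<in> D" "D \<subseteq> V"
    and ext: "\<And>f :: 'a \<Rightarrow> col. \<exists>g. (\<forall>y. y \<notin> D \<longrightarrow> g y = f y) \<and> (\<forall>y\<in>D. \<forall>z. E y z \<longrightarrow> adj (g y) (g z))"
  shows False
proof -
  have "V - D \<subset> V" using assms by blast
  from vcrit[OF this] obtain f where f: "\<forall>x\<in>V-D. \<forall>y\<in>V-D. E x y \<longrightarrow> adj (f x) (f y)" by blast
  obtain g where g: "\<forall>y. y \<notin> D \<longrightarrow> g y = f y" "\<forall>y\<in>D. \<forall>z. E y z \<longrightarrow> adj (g y) (g z)"
    using ext by blast
  have "adj (g x) (g y)" if "E x y" for x y
    using f g that inV[OF that] inV[OF sym[OF that]] adj_sym sym[OF that]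
    by (metis DiffI)
  then show False using noncol by blast
qed

text \<open>In a colouring of the graph without \<open>x\<close>, the vertex \<open>x\<close> can
  copy the colour of \<open>y\<close>.\<close>

lemma fold:
  assumes "x \<in> V" "x \<noteq> y" "\<And>z. E x z \<Longrightarrow> E y z"
  shows False
proof -
  have "V - {x} \<subset> V" using assms by blast
  from vcrit[OF this] obtain f where f: "\<forall>u\<in>V-{x}. \<forall>y\<in>V-{x}. E u y \<longrightarrow> adj (f u) (f y)" by blast
  let ?g = "f(x := f y)"
  have "adj (?g u) (?g v)" if "E u v" for u v
    using f that inV[OF that] inV[OF sym[OF that]] assms adj_sym irr sym inV
    by (simp add: fun_upd_def) (metis Diff_iff empty_iff insert_iff)
  then show False using noncol by blast
qed

lemma deg2:
  assumes "x \<in> V" obtains a b where "E x a" "E x b" "a \<noteq> b"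
proof (rule ccontr)
  assume "\<not> thesis"
  then have u: "\<And>a b. E x a \<Longrightarrow> E x b \<Longrightarrow> a = b" using that by blast
  show False
  proof (rule reducible[of x "{x}"])
    fix f :: "'a \<Rightarrow> col"
    obtain k where k: "\<And>a. E x a \<Longrightarrow> adj k (f a)"
      by (metis u ex_adj adj_sym)
    show "\<exists>g. (\<forall>y. y \<notin> {x} \<longrightarrow> g y = f y) \<and> (\<forall>y\<in>{x}. \<forall>z. E y z \<longrightarrow> adj (g y) (g z))"
      by (rule exI[of _ "f(x := k)"]) (use k irr in auto)
  qed (use assms in auto)
qed

lemma other: assumes "E x y" obtains z where "E x z" "z \<noteq> y"
  using deg2[OF inV[OF assms]] by metis

lemma not_B_n2: assumes "E x y" "\<not> B x" obtains z where "n2 x y z"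
proof -
  obtain z where "E x z" "z \<noteq> y" using other[OF assms(1)] .
  then show thesis using assms that[of z] unfolding n2_def B_def by metis
qed

lemma n2_not_B: "n2 x a b \<Longrightarrow> \<not> B x"
  unfolding n2_def B_def by metis

lemma n3_B: "n3 x a b c \<Longrightarrow> B x"
  unfolding n3_def B_def by blast

lemma B_others: assumes "B x" obtains a b where "E x a" "E x b" "a \<noteq> b" "a \<noteq> y" "b \<noteq> y"
  using assms unfolding B_def by metis

lemma B_third: assumes "B x" obtains c where "E x c" "c \<noteq> a" "c \<noteq> b"
  using assms unfolding B_def by metis

text \<open>Either the degree is exactly three, or there are two neighbours besides the prescribed
  \<open>a\<close> and \<open>b\<close>, ready to be used as leaves of an \<open>H3\<close>.\<close>

lemma B_n3: assumes "B x" "E x a" "E x b" "a \<noteq> b" "\<not> (\<exists>c. n3 x a b c)"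
  obtains c d where "E x c" "E x d" "c \<noteq> d" "c \<noteq> a" "c \<noteq> b" "d \<noteq> a" "d \<noteq> b"
proof -
  obtain c where c: "E x c" "c \<noteq> a" "c \<noteq> b" using B_third[OF assms(1)] .
  then have "\<not> n3 x a b c" using assms by blast
  then show thesis using that c assms unfolding n3_def by metis
qed

lemma n2_E: "n2 x a b \<Longrightarrow> E x a" "n2 x a b \<Longrightarrow> E x b" "n2 x a b \<Longrightarrow> E a x" "n2 x a b \<Longrightarrow> E b x" 
  unfolding n2_def by (auto intro: sym)

lemma n3_E: "n3 x a b c \<Longrightarrow> E x a" "n3 x a b c \<Longrightarrow> E x b" "n3 x a b c \<Longrightarrow> E x c"
  "n3 x a b c \<Longrightarrow> E a x" "n3 x a b c \<Longrightarrow> E b x" "n3 x a b c \<Longrightarrow> E c x"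
  unfolding n3_def by (auto intro: sym)

lemma n2_swap: "n2 x a b \<Longrightarrow> n2 x b a"
  unfolding n2_def by auto

lemma no_three_n2:
  assumes "n2 p a q" "n2 q p r" "n2 r q b"
  shows False
proof -
  have d: "p \<noteq> q" "q \<noteq> r" "p \<noteq> r" "a \<noteq> q" "p \<noteq> r" "b \<noteq> q" "a \<noteq> p" "b \<noteq> r" "a \<noteq> r" "b \<noteq> p"
    using assms irr tri n2_def n2_E by metis+
  show False
  proof (rule reducible[of p "{p,q,r}"])
    fix f :: "'a \<Rightarrow> col"
    \<comment> \<open>The ends \<open>a\<close> and \<open>b\<close> may coincide;
      \<open>walk4\<close> covers equal colours as well.\<close>
    obtain i j k where k: "adj (f a) i" "adj i j" "adj j k" "adj k (f b)" using walk4 by blast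
    show "\<exists>g. (\<forall>y. y \<notin> {p,q,r} \<longrightarrow> g y = f y) \<and> (\<forall>y\<in>{p,q,r}. \<forall>z. E y z \<longrightarrow> adj (g y) (g z))"
      by (rule exI[of _ "f(p := i, q := j, r := k)"]) (use assms d k adj_sym in \<open>auto simp: n2_def\<close>)
  qed (use assms in \<open>auto dest: n2_E intro: inV\<close>)
qed

end

section \<open>Girth at least five: threads with two inner vertices\<close>

text \<open>Two vertices joined both by a path with two inner vertices and by one with a single
  inner vertex need colours at distance two. Such a pair can be chosen next to any given colours
  \<open>a\<close> and \<open>b\<close> of their outer neighbours.\<close>

lemma reach_apart: "\<exists>k l. adj a k \<and> adj l b \<and> k \<noteq> l \<and> \<not> adj k l"
proof -
  have "\<forall>a b. \<exists>k l. adj a k \<and> adj l b \<and> k \<noteq> l \<and> \<not> adj k l"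
    unfolding all_col ex_col by simp
  then show ?thesis by blast
qed

locale C4_free_counterexample = triangle_free_critical +
  assumes c4: "E a b \<Longrightarrow> E b c \<Longrightarrow> E c d \<Longrightarrow> E d a \<Longrightarrow> a \<noteq> c \<Longrightarrow> b \<noteq> d \<Longrightarrow> False"
    and noE1: "\<not> embeds E1_graph E" and noE2: "\<not> embeds E2_graph E"
    and noF: "n \<ge> 3 \<Longrightarrow> odd n \<Longrightarrow> \<not> embeds (flower n) E"
begin

text \<open>
  Leaves for an \<open>H3\<close> can be chosen at both ends of a path of length three unless both ends have
  degree exactly three and share a neighbour off the path (unique, as there is no 4-cycle).
\<close>

lemma path3_common_nbr:
  assumes "E u v" "E v w" "E w x" "u \<noteq> w" "v \<noteq> x" "B u" "B x"
  obtains c d e where "n3 u v c d" "n3 x w c e"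
proof -
  have ux: "u \<noteq> x" using assms tri by blast
  have nuw: "\<not> E u w" "\<not> E v x" "\<not> E u x" using assms tri sym c4 by metis+
  note S = assms(1-3) sym[OF assms(1)] sym[OF assms(2)] sym[OF assms(3)]
  \<comment> \<open>Stated for arbitrary vertices, so that it applies from either end of the path.
    Two neighbours \<open>d\<close>, \<open>d'\<close> of \<open>u\<close> besides \<open>v\<close>
    and \<open>c\<close> would be leaves at \<open>u\<close>, opposite to the leaves
    \<open>c\<close>, \<open>e\<close> at \<open>x\<close>.\<close>
  have key: "n3 u v c d" if H: "E u c" "E x c" "c \<noteq> v" "E u d" "d \<noteq> c" "d \<noteq> v" "E u v" "E v w" "E w x"
    "\<not> E u w" "\<not> E v x" "\<not> E u x" "u \<noteq> x" "u \<noteq> w" "v \<noteq> x" "B x"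
    for u v w x c d
  proof (rule ccontr)
    assume n: "\<not> n3 u v c d"
    then obtain d' where d': "E u d'" "d' \<noteq> c" "d' \<noteq> v" "d \<noteq> d'" using H unfolding n3_def by metis
    obtain e where e: "E x e" "e \<noteq> w" "e \<noteq> c" using B_third[OF \<open>B x\<close>] .
    have "E u d'' \<Longrightarrow> d'' \<noteq> c \<Longrightarrow> d'' \<noteq> e" for d'' using c4[of u d'' x c] H e sym by metis
    then have "distinct [u, v, w, x, d, d', c, e]" using H d' e irr sym
      by simp metis
    then show False using H3[of u v w x d d' c e] H d' e by blast
  qed
  show thesis
  proof (cases "\<exists>c. E u c \<and> E x c \<and> c \<noteq> v")
    case True
    then obtain c where c: "E u c" "E x c" "c \<noteq> v" by blast
    then have cw: "c \<noteq> w" using nuw by metis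
    obtain d where d: "E u d" "d \<noteq> v" "d \<noteq> c" using B_third[OF \<open>B u\<close>] .
    obtain e where e: "E x e" "e \<noteq> w" "e \<noteq> c" using B_third[OF \<open>B x\<close>] .
    have "n3 u v c d" by (rule key[where u = u and v = v and w = w and x = x]) (use assms c d nuw ux in auto)
    moreover have "n3 x w c e"
      by (rule key[where u = x and v = w and w = v and x = u]) (use assms c cw e nuw ux S sym in auto)
    ultimately show thesis using that by blast
  next
    case False
    obtain a b where ab: "E u a" "E u b" "a \<noteq> b" "a \<noteq> v" "b \<noteq> v" using B_others[OF \<open>B u\<close>] .
    obtain c d where cd: "E x c" "E x d" "c \<noteq> d" "c \<noteq> w" "d \<noteq> w" using B_others[OF \<open>B x\<close>] .
    have "distinct [u, v, w, x, a, b, c, d]" using False ab cd assms nuw ux irr sym by simp metis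
    then show thesis using H3[of u v w x a b c d] ab cd assms by blast
  qed
qed

text \<open>
  Here \<open>u, p, q, x\<close> is a path whose inner vertices have degree two and \<open>c\<close> is the common
  neighbour of its ends: one petal of a prospective flower with centre \<open>c\<close>.
\<close>

lemma thread_hub_B:
  assumes p: "n2 p u q" and q: "n2 q p x" and u: "n3 u p c u'" and x: "n3 x q c x'"
  shows "B c"
proof (rule ccontr)
  assume "\<not> B c"
  note es = n2_E[OF p] n2_E[OF q] n3_E[OF u] n3_E[OF x]
  have ux: "u \<noteq> x" using p q es tri by metis
  have c: "n2 c u x" 
    using not_B_n2[OF es(13) \<open>\<not> B c\<close>] ux es unfolding n2_def by metis
  have d: "u \<noteq> p" "u \<noteq> q" "u \<noteq> c" "u \<noteq> x" "p \<noteq> q" "p \<noteq> c" "p \<noteq> x" "q \<noteq> c" "q \<noteq> x" "c \<noteq> x"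
    using assms es irr ux unfolding n2_def n3_def by metis+
  have d': "u' \<noteq> u" "u' \<noteq> p" "u' \<noteq> q" "u' \<noteq> c" "u' \<noteq> x"
    using assms es irr ux c tri unfolding n2_def n3_def by metis+
  have d'': "x' \<noteq> u" "x' \<noteq> p" "x' \<noteq> q" "x' \<noteq> c" "x' \<noteq> x"
    using assms es irr ux c tri unfolding n2_def n3_def by metis+
  show False
  \<comment> \<open>If \<open>c\<close> had degree two, this set would be attached to the rest only
    at \<open>u'\<close> and \<open>x'\<close>. Colours of \<open>u\<close> and \<open>x\<close> at
    distance two leave room for both \<open>p, q\<close> and \<open>c\<close>.\<close>
  proof (rule reducible[of p "{u, p, q, x, c}"])
    fix f :: "'a \<Rightarrow> col"
    obtain k l where k: "adj (f u') k" "adj l (f x')" "k \<noteq> l" "\<not> adj k l" using reach_apart by blast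
    obtain i j where i: "adj k i" "adj i j" "adj j l" using walk3[of k l] k by blast
    obtain m where m: "adj k m" "adj m l" using walk2[of k l] k by blast
    show "\<exists>g. (\<forall>y. y \<notin> {u, p, q, x, c} \<longrightarrow> g y = f y) \<and> (\<forall>y\<in>{u, p, q, x, c}. \<forall>z. E y z \<longrightarrow> adj (g y) (g z))"
      by (rule exI[of _ "f(u := k, p := i, q := j, x := l, c := m)"])
        (use assms c d d' d'' k i m adj_sym in \<open>auto simp: n2_def n3_def\<close>)
  qed (use es in \<open>auto intro: inV\<close>)
qed

end

text \<open>Here \<open>m\<close> is the common neighbour of \<open>k\<close> and \<open>l\<close>,
  and \<open>n\<close> is the other neighbour of \<open>k\<close>; the latter is again joined to
  \<open>l\<close> by a walk of length two.\<close>

lemma apart_petal: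
  assumes "k \<noteq> l" "\<not> adj k l"
  shows "\<exists>m n. adj k m \<and> adj m l \<and> adj k n \<and> n \<noteq> m \<and> \<not> adj n l"
proof -
  have "\<forall>k l. k \<noteq> l \<and> \<not> adj k l \<longrightarrow> (\<exists>m n. adj k m \<and> adj m l \<and> adj k n \<and> n \<noteq> m \<and> \<not> adj n l)"
    unfolding all_col ex_col by simp
  then show ?thesis using assms by blast
qed

context C4_free_counterexample
begin

text \<open>If \<open>u'\<close> were a branch vertex, the path condition would close a pentagon
  \<open>u, c, x, x', u'\<close> next to the petal. Depending on the degree of \<open>x'\<close>,
  this is reducible, extends to the flower with three petals, or is contradictory.\<close>

lemma thread_third_not_B:
  assumes p: "n2 p u q" and q: "n2 q p x" and u: "n3 u p c u'" and x: "n3 x q c x'"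
  shows "\<not> B u'"
proof
  assume Bu': "B u'"
  note es = n2_E[OF p] n2_E[OF q] n3_E[OF u] n3_E[OF x]
  have Bc: "B c" using thread_hub_B[OF assms] .
  have Bu: "B u" and Bx: "B x" using u x n3_B by blast+
  have Bpq: "\<not> B p" "\<not> B q" using p q n2_not_B by blast+
  have ux: "u \<noteq> x" using p q es tri by metis
  have d: "u \<noteq> p" "u \<noteq> q" "u \<noteq> c" "p \<noteq> q" "p \<noteq> c" "p \<noteq> x" "q \<noteq> c" "q \<noteq> x" "c \<noteq> x"
      "u' \<noteq> u" "u' \<noteq> p" "u' \<noteq> q" "u' \<noteq> c" "x' \<noteq> p" "x' \<noteq> q" "x' \<noteq> c" "x' \<noteq> x"
    using es irr ux Bpq Bc Bu Bx Bu' p q u x unfolding n2_def n3_def by metis+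
  have d': "u' \<noteq> x" "x' \<noteq> u" using es tri by metis+
  have nq: "\<not> E q u'" "\<not> E p x'" "\<not> E q x'" "\<not> E p u'"
    using p q d d' unfolding n2_def n3_def by metis+
  obtain c2 d2 e2 where c2: "n3 u' u c2 d2" "n3 x c c2 e2"
    by (rule path3_common_nbr[of u' u c x]) (use es d d' ux Bu' Bx in auto)
  \<comment> \<open>Only \<open>x'\<close> among the neighbours of \<open>x\<close> can be the
    common neighbour, which closes the pentagon.\<close>
  have "c2 = x'" using c2 x nq sym unfolding n3_def by metis
  then obtain u2 where u': "n3 u' u x' u2" using c2 by blast
  note es' = n3_E[OF u']
  show False
  proof (cases "B x'")
    case False
    then have x': "n2 x' x u'" using not_B_n2[of x' x] es es' d' unfolding n2_def by metis
    obtain c3 d3 e3 where c3: "n3 c x c3 d3" "n3 u' x' c3 e3"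
      by (rule path3_common_nbr[of c x x' u']) (use es es' d d' ux Bu' Bc in auto)
    have "c3 \<noteq> u2" using c4[of c u u' u2] c3 es es' d u' sym unfolding n3_def by metis
    then have "c3 = u" using c3 u' unfolding n3_def by metis
    then obtain c' where c': "n3 c x u c'" using c3 by blast
    have dc: "c' \<noteq> u" "c' \<noteq> p" "c' \<noteq> q" "c' \<noteq> x" "c' \<noteq> x'" "c' \<noteq> c" "c' \<noteq> u'"
      using c' p q u x x' u' d d' ux irr tri sym unfolding n2_def n3_def by metis+
    have du: "u2 \<noteq> u" "u2 \<noteq> p" "u2 \<noteq> q" "u2 \<noteq> x" "u2 \<noteq> x'" "u2 \<noteq> c" "u2 \<noteq> u'"
      using c' p q u x x' u' d d' ux irr tri sym unfolding n2_def n3_def by metis+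
    show False
    \<comment> \<open>The set is left only through \<open>c'\<close> and \<open>u2\<close>. Choose
      colours at distance two for \<open>c\<close> and \<open>u'\<close>; then \<open>u\<close>
      takes their common neighbour and \<open>x\<close> the other neighbour of the colour of
      \<open>c\<close>.\<close>
    proof (rule reducible[of p "{u, p, q, x, x', c, u'}"])
      fix f :: "'a \<Rightarrow> col"
      obtain k l where k: "adj (f c') k" "adj l (f u2)" "k \<noteq> l" "\<not> adj k l" using reach_apart by blast
      obtain m n where m: "adj k m" "adj m l" "adj k n" "n \<noteq> m" "\<not> adj n l"
        using apart_petal k by blast
      obtain i j where i: "adj m i" "adj i j" "adj j n" using walk3[of m n] m by blast
      obtain r where r: "adj n r" "adj r l" using walk2[of n l] m by blast
      show "\<exists>g. (\<forall>y. y \<notin> {u, p, q, x, x', c, u'} \<longrightarrow> g y = f y) \<and>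
          (\<forall>y\<in>{u, p, q, x, x', c, u'}. \<forall>z. E y z \<longrightarrow> adj (g y) (g z))"
        by (rule exI[of _ "f(u := m, p := i, q := j, x := n, c := k, u' := l, x' := r)"])
          (use p q u x x' u' c' d d' dc du ux k i m r adj_sym in \<open>auto simp: n2_def n3_def\<close>)
    qed (use es es' in \<open>auto intro: inV\<close>)
  next
    \<comment> \<open>All five vertices of the pentagon now turn out to have degree three. The third
      neighbours \<open>u2\<close> of \<open>u'\<close> and \<open>x2\<close> of \<open>x'\<close>
      have degree two, and their continuations \<open>u3\<close> and \<open>x3\<close> are
      followed.\<close>
    case Bx': True
    obtain c3 d3 e3 where c3: "n3 c u c3 d3" "n3 x' u' c3 e3"
      by (rule path3_common_nbr[of c u u' x']) (use es es' d d' ux Bx' Bc in auto)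
    have "E x' x" "x \<noteq> u'" "E c x" using es d' by auto
    then have "c3 = x" using c4[of c x x' c3] c3 d es es' sym unfolding n3_def by metis
    then obtain c' x2 where c': "n3 c u x c'" and x': "n3 x' u' x x2" using c3 by blast
    note es'' = n3_E[OF c'] n3_E[OF x']
    have ncx2: "\<not> E c x2" using c4[of c x x' x2] es'' d d' x' sym unfolding n3_def by metis
    have ncu2: "\<not> E c u2" using c4[of c u u' u2] es'' es es' d d' u' sym unfolding n3_def by metis
    have nqx2: "\<not> E q x2" "\<not> E p x2" "\<not> E q u2" "\<not> E p u2"
      using p q es es' es'' nq tri d d' x' u' sym unfolding n2_def n3_def by metis+
    have e: "u2 \<noteq> x" "u2 \<noteq> c" "u2 \<noteq> u" "x2 \<noteq> x" "x2 \<noteq> c" "x2 \<noteq> u" "u2 \<noteq> x'" "x2 \<noteq> u'" "x2 \<noteq> u2"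
      "u2 \<noteq> p" "u2 \<noteq> q" "x2 \<noteq> p" "x2 \<noteq> q"
      using es es' es'' tri u' x' nq nqx2 sym p q unfolding n3_def n2_def by metis+
    have nBx2: "\<not> B x2"
    proof
      assume "B x2"
      obtain c4 d4 e4 where "n3 x2 x' c4 d4" "n3 u u' c4 e4"
        by (rule path3_common_nbr[of x2 x' u' u]) (use es es' es'' d d' e \<open>B x2\<close> Bu in auto)
      then show False using u ncx2 nqx2 sym unfolding n3_def by metis
    qed
    have nBu2: "\<not> B u2"
    proof
      assume "B u2"
      obtain c4 d4 e4 where "n3 u2 u' c4 d4" "n3 x x' c4 e4"
        by (rule path3_common_nbr[of u2 u' x' x]) (use es es' es'' d d' e \<open>B u2\<close> Bx in auto)
      then show False using x ncu2 nqx2 sym unfolding n3_def by metis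
    qed
    obtain x3 where x2: "n2 x2 x' x3" using not_B_n2 es'' nBx2 by metis
    obtain u3 where u2: "n2 u2 u' u3" using not_B_n2 es' nBu2 by metis
    note es3 = n2_E[OF x2] n2_E[OF u2]
    have h: "u3 \<noteq> u" "u3 \<noteq> x" "u3 \<noteq> c" "u3 \<noteq> q" "u3 \<noteq> p" "u3 \<noteq> x'" "u3 \<noteq> u'"
      using tri es es' es'' es3 e nqx2 ncu2 x x' c' u2 sym unfolding n3_def n2_def by metis+
    have g: "x3 \<noteq> u" "x3 \<noteq> x" "x3 \<noteq> c" "x3 \<noteq> q" "x3 \<noteq> p" "x3 \<noteq> x'" "x3 \<noteq> u'"
      using tri es es' es'' es3 e nqx2 ncx2 x u u' x' c' x2 sym unfolding n3_def n2_def by metis+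
    have np: "\<not> E u3 p" "\<not> E u3 q" "\<not> E x3 p" "\<not> E x3 q" using p q h g sym unfolding n2_def by metis+
    have nu: "\<not> E u u3" "\<not> E u x3" "\<not> E x x3" "\<not> E x u3" using u x h g unfolding n3_def by metis+
    show False
    proof (cases "B u3")
      case Bu3: True
      obtain c4 d4 e4 where "n3 u3 u2 c4 d4" "n3 u u' c4 e4"
        by (rule path3_common_nbr[of u3 u2 u' u]) (use es es' es'' es3 d d' e h Bu3 Bu in auto)
      then have "E c u3" using u np sym unfolding n3_def by metis
      then have uc: "u3 = c'" using c' h unfolding n3_def by metis
      obtain c4 d4 e4 where "n3 u3 u2 c4 d4" "n3 x' u' c4 e4"
        by (rule path3_common_nbr[of u3 u2 u' x']) (use es es' es'' es3 d d' e h Bu3 Bx' in auto)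
      then have "E u3 x2" using x' nu sym unfolding n3_def by metis
      have dd: "distinct [u, p, q, x, x', x2, u3, u2, u', c]"
        using d d' e h ux nBx2 nBu2 Bx' Bu3 es' es'' irr by auto
      \<comment> \<open>The petals are \<open>u, p, q, x\<close>, then \<open>x, x', x2, u3\<close>,
        then \<open>u3, u2, u', u\<close>, all around \<open>c\<close>.\<close>
      have "embeds (flower 3) E"
      proof (rule embeds_flowerI[where f = "\<lambda>k. [u, p, q, x, x', x2, u3, u2, u'] ! k" and c = c])
        let ?L = "[u, p, q, x, x', x2, u3, u2, u']"
        show "inj_on (\<lambda>k. ?L ! k) {..<3 * 3}"
          by (rule inj_on_nth) (use dd in auto)
        show "?L ! k \<noteq> c" if "k < 3 * 3" for k
        proof -
          have "?L ! k \<in> set ?L" by (rule nth_mem) (use that in simp)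
          then show ?thesis using dd by auto
        qed
        show "E (?L ! k) (?L ! (Suc k mod (3 * 3)))" if "k < 3 * 3" for k
        proof -
          have "k \<in> {0, 1, 2, 3, 4, 5, 6, 7, 8}" using that by auto
          then show ?thesis using es es' es'' es3 \<open>E u3 x2\<close> sym[OF \<open>E u3 x2\<close>] by auto
        qed
        show "E c (?L ! (3 * i))" if "i < 3" for i
        proof -
          have "i \<in> {0, 1, 2}" using that by auto
          then show ?thesis using es es' es'' es3 \<open>E c u3\<close> by auto
        qed
      qed (rule sym)
      then show False using noF[of 3] by simp
    next
      case nBu3: False
      have thr: "\<exists>y. n2 b a y \<and> B y" if H: "n2 a z b" "\<not> B b" for a b z
      proof -
        obtain y where y: "n2 b a y" using not_B_n2[OF n2_E(4)[OF H(1)] H(2)] by blast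
        have "B y"
        proof (rule ccontr)
          assume "\<not> B y"
          then obtain w where "n2 y b w" using not_B_n2 n2_E y by metis
          then show False using no_three_n2 H y by blast
        qed
        then show ?thesis using y by blast
      qed
      \<comment> \<open>The continuations through \<open>u2\<close> and through \<open>x2\<close>
        are both forced to reach \<open>c\<close> by way of the same vertex \<open>c'\<close>. Since
        it has degree two, \<open>u2\<close> and \<open>x2\<close> would coincide.\<close>
      obtain y where y: "n2 u3 u2 y" "B y" using thr u2 nBu3 by blast
      obtain c4 d4 e4 where "n3 u' u2 c4 d4" "n3 y u3 c4 e4"
        by (rule path3_common_nbr[of u' u2 u3 y]) (use es es' es'' es3 d d' e h y n2_E[OF y(1)] Bu' in \<open>auto simp: n2_def\<close>)
      then have "c4 = u \<or> c4 = x'" "E c4 y" using u' sym unfolding n3_def by metis+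
      then have "y = c" using u x' y h Bpq nBx2 nu n2_E[OF y(1)] sym tri es3 unfolding n3_def by metis
      then have uc: "u3 = c'" using y h c' n2_E[OF y(1)] unfolding n3_def by metis
      have nBx3: "\<not> B x3"
      proof
        assume "B x3"
        obtain c4 d4 e4 where "n3 x3 x2 c4 d4" "n3 x x' c4 e4"
          by (rule path3_common_nbr[of x3 x2 x' x]) (use es es' es'' es3 d d' e g \<open>B x3\<close> Bx in auto)
        then have "E c x3" using x np sym unfolding n3_def by metis
        then show False using c' g uc nBu3 \<open>B x3\<close> unfolding n3_def by metis
      qed
      obtain w where w: "n2 x3 x2 w" "B w" using thr x2 nBx3 by blast
      obtain c4 d4 e4 where "n3 x' x2 c4 d4" "n3 w x3 c4 e4"
        by (rule path3_common_nbr[of x' x2 x3 w]) (use es es' es'' es3 d d' e g w n2_E[OF w(1)] Bx' in \<open>auto simp: n2_def\<close>)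
      then have "c4 = x \<or> c4 = u'" "E c4 w" using x' sym unfolding n3_def by metis+
      then have "w = c" using x u' w g Bpq nBu2 nu n2_E[OF w(1)] sym tri es3 unfolding n3_def by metis
      then have "x3 = c'" using w g c' n2_E[OF w(1)] unfolding n3_def by metis
      then have "x2 = u2" using uc y w \<open>y = c\<close> \<open>w = c\<close> e unfolding n2_def by metis
      then show False using e by blast
    qed
  qed
qed

end

text \<open>The rim runs from one neighbour of \<open>a\<close> to the other, the long way round and
  avoiding \<open>a\<close>, and then back. This has period six and therefore closes up when the
  number of petals is even.\<close>

lemma petal_colouring:
  "\<exists>h :: nat \<Rightarrow> col. (\<forall>k. adj (h k) (h (Suc k))) \<and> (\<forall>k l. k mod 6 = l mod 6 \<longrightarrow> h k = h l) \<and> (\<forall>i. adj a (h (3 * i)))"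
proof (intro exI conjI allI impI)
  let ?t = "\<lambda>r :: nat. if r = 0 then nxt a else if r = 1 then nxt (nxt a) else if r = 2 then nxt (nxt (nxt a)) else
    if r = 3 then nxt (nxt (nxt (nxt a))) else if r = 4 then nxt (nxt (nxt a)) else nxt (nxt a)"
  let ?h = "\<lambda>k. ?t (k mod 6)"
  show "?h k = ?h l" if "k mod 6 = l mod 6" for k l using that by simp
  show "adj (?h k) (?h (Suc k))" for k
  proof -
    have "k mod 6 \<in> {0, 1, 2, 3, 4, 5}" by auto
    moreover have "Suc k mod 6 = (if k mod 6 = 5 then 0 else Suc (k mod 6))" by (simp add: mod_Suc)
    ultimately show ?thesis by (auto simp: adj_def)
  qed
  show "adj a (?h (3 * i))" for i
  proof -
    have "3 * i mod 6 \<in> {0, 3}" by (simp; presburger)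
    then show ?thesis by (cases a) (auto simp: adj_def)
  qed
qed

context C4_free_counterexample
begin

text \<open>After \<open>u'\<close> and \<open>u2\<close> the vertex \<open>u3\<close> is a branch
  vertex by \<open>no_three_n2\<close>. The path condition gives \<open>u\<close> and
  \<open>u3\<close> a common neighbour, which cannot be \<open>p\<close> and so is the hub
  \<open>c\<close>.\<close>

lemma thread_cont_side:
  assumes p: "n2 p u q" and nBq: "\<not> B q" and u: "n3 u p c u'" and u': "n2 u' u u2" and nBu2: "\<not> B u2"
  shows "\<exists>u3 e. n2 u2 u' u3 \<and> n3 u3 u2 c e"
proof -
  note es = n2_E[OF p] n3_E[OF u] n2_E[OF u']
  obtain u3 where u2: "n2 u2 u' u3" using not_B_n2 es nBu2 by metis
  note es2 = n2_E[OF u2]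
  have Bu: "B u" using n3_B[OF u] .
  have "B u3"
  proof (rule ccontr)
    assume "\<not> B u3"
    then obtain w where "n2 u3 u2 w" using not_B_n2[OF es2(4)] by blast
    then show False using no_three_n2 u' u2 by blast
  qed
  have d: "u3 \<noteq> u" "u \<noteq> u2" "u' \<noteq> u3" using es es2 tri u' u2 irr unfolding n2_def by metis+
  obtain k d e where k: "n3 u u' k d" "n3 u3 u2 k e"
    by (rule path3_common_nbr[of u u' u2 u3]) (use es es2 d \<open>B u3\<close> Bu in auto)
  have "\<not> E u3 p" using p d nBq \<open>B u3\<close> sym unfolding n2_def by metis
  then have "k = c" using k u unfolding n3_def by metis
  then show ?thesis using u2 k by blast
qed

text \<open>If \<open>u2\<close> were a branch vertex, it would share a neighbour \<open>c'\<close>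
  with the hub; comparing with the mirror image at \<open>x\<close> yields \<open>E1\<close> or a
  contradiction. Otherwise \<open>thread_cont_side\<close> supplies the next petal.\<close>

lemma thread_cont:
  assumes p: "n2 p u q" and q: "n2 q p x" and u: "n3 u p c u'" and x: "n3 x q c x'"
  shows "\<exists>u2 u3 e. n2 u' u u2 \<and> n2 u2 u' u3 \<and> n3 u3 u2 c e"
proof -
  note es = n2_E[OF p] n2_E[OF q] n3_E[OF u] n3_E[OF x]
  have nBu': "\<not> B u'" using thread_third_not_B[OF assms] .
  have nBx': "\<not> B x'" using thread_third_not_B[OF n2_swap[OF q] n2_swap[OF p] x u] .
  obtain u2 where u': "n2 u' u u2" using not_B_n2 es nBu' by metis
  obtain x2 where x': "n2 x' x x2" using not_B_n2 es nBx' by metis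
  note es' = n2_E[OF u'] n2_E[OF x']
  have nBpq: "\<not> B p" "\<not> B q" using p q n2_not_B by blast+
  have B: "B u" "B x" "B c" using u x n3_B thread_hub_B[OF assms] by blast+
  have ux: "u \<noteq> x" "\<not> E u x" using p q es tri sym by metis+
  have d: "u \<noteq> p" "u \<noteq> q" "u \<noteq> c" "p \<noteq> q" "p \<noteq> c" "p \<noteq> x" "q \<noteq> c" "q \<noteq> x" "c \<noteq> x"
      "u' \<noteq> u" "u' \<noteq> p" "u' \<noteq> q" "u' \<noteq> c" "u' \<noteq> x" "x' \<noteq> p" "x' \<noteq> q" "x' \<noteq> c" "x' \<noteq> x" "x' \<noteq> u"
    using es irr ux nBpq B nBu' nBx' p q u x unfolding n2_def n3_def by metis+
  have uc: "u2 \<noteq> u" "u2 \<noteq> c" "x2 \<noteq> x" "x2 \<noteq> c" using es es' irr u' x' u x sym tri d unfolding n2_def by metis+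
  show ?thesis
  proof (cases "B u2")
    case False
    then show ?thesis using thread_cont_side[OF p nBpq(2) u u'] u' by blast
  next
    case Bu2: True
    have nu2x: "\<not> E u2 x" using x nBpq nBx' Bu2 uc sym unfolding n3_def by metis
    obtain c' d1 e1 where c1: "n3 u2 u' c' d1" "n3 c u c' e1"
      by (rule path3_common_nbr[of u2 u' u c]) (use es es' d uc Bu2 B in auto)
    have "c' \<noteq> x" using c1 nu2x n3_E by metis
    then have c': "n3 c u x c'" using c1(2) es ux unfolding n3_def by metis
    have u2c': "E u2 c'" using c1 n3_E by metis
    note es2 = n3_E[OF c'] u2c' sym[OF u2c']
    have c'd: "c' \<noteq> u" "c' \<noteq> x" "c' \<noteq> c" using c' irr unfolding n3_def by metis+
 have u2x: "u2 \<noteq> x" using c4[of u' x c u] es es' d ux by metis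
    have ux': "u' \<noteq> x'" "u2 \<noteq> x'" "u2 \<noteq> u'" "u2 \<noteq> x" "u2 \<noteq> p" "u2 \<noteq> q"
      using u2x u' x' es es' irr nBx' nBpq Bu2 B ux d nBu' u x unfolding n2_def n3_def by metis+
    show ?thesis
    proof (cases "B x2")
      case False
      obtain x3 e where x2: "n2 x2 x' x3" and x3: "n3 x3 x2 c e"
        using thread_cont_side[OF n2_swap[OF q] nBpq(1) x x' False] by blast
      note es3 = n2_E[OF x2] n3_E[OF x3]
      have "x2 \<noteq> p" "x2 \<noteq> u'" using p u' es' ux' d ux unfolding n2_def by metis+
      then have "x3 \<noteq> u" using u es3 False B unfolding n3_def by metis
      moreover have "x3 \<noteq> x" using tri es3 es' sym by metis
      ultimately have "x3 = c'" using c' es3 unfolding n3_def by metis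
      then have Bc': "B c'" using n3_B x3 by metis
      obtain k e1 e2 where k: "n3 u2 c' k e1" "n3 x c k e2"
        by (rule path3_common_nbr[of u2 c' c x]) (use es es' es2 d uc c'd Bu2 B in auto)
      then have "k = q \<or> k = x'" "E k u2" using x n3_E unfolding n3_def by metis+
      moreover have "\<not> E q u2" using q ux' unfolding n2_def by metis
      moreover have "\<not> E x' u2" using x' ux' False Bu2 unfolding n2_def by metis
      ultimately show ?thesis by blast
    next
      case Bx2: True
      have x2n: "x2 \<noteq> p" "x2 \<noteq> u'" "x2 \<noteq> q" "x2 \<noteq> x'" "x2 \<noteq> u"
         using nBpq Bx2 nBu' nBx' es es' u d ux c4[of x' u c x] unfolding n3_def by metis+
      have nx2u: "\<not> E x2 u" using u x2n uc sym unfolding n3_def by metis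
      obtain k d1 e1 where k: "n3 x2 x' k d1" "n3 c x k e1"
        by (rule path3_common_nbr[of x2 x' x c]) (use es es' d uc Bx2 B in auto)
      then have x2c': "E x2 c'" using nx2u c' unfolding n3_def by metis
      show ?thesis
      proof (cases "u2 = x2")
        case True
        have c'e: "c' \<noteq> u2" "c' \<noteq> u'" "c' \<noteq> x'" "c' \<noteq> p" "c' \<noteq> q"
          using c' es2 irr u' x' p q ux' d ux uc c'd tri sym es unfolding n2_def n3_def by metis+
        \<comment> \<open>The paths leaving \<open>u\<close> and \<open>x\<close> meet in
          \<open>u2\<close>; \<open>x'\<close> plays the role of \<open>Em\<close>.\<close>
        have "embeds E1_graph E"
          by (rule embeds_E1I[where E = E and ?v1.0 = u and ?v2.0 = u' and ?v3.0 = u2 and ?v4.0 = c' and ?v5.0 = c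
                and ?u2.0 = p and ?u3.0 = q and ?u4.0 = x and m = x', OF sym])
            (use es es' es2 True c'e d uc c'd ux' ux in auto)
        then show ?thesis using noE1 by blast
      next
        case False
        have Bc': "B c'" unfolding B_def using es2 sym[OF x2c'] False uc by blast
        obtain k e1 e2 where k: "n3 x2 c' k e1" "n3 u c k e2"
          by (rule path3_common_nbr[of x2 c' c u]) (use es es' es2 x2c' d uc c'd Bx2 B Bc' in auto)
        then have "k = p \<or> k = u'" "E k x2" using u n3_E unfolding n3_def by metis+
        moreover have "\<not> E p x2" using p x2n unfolding n2_def by metis
        moreover have "\<not> E u' x2" using u' False x2n unfolding n2_def by metis
        ultimately show ?thesis by blast
      qed
    qed
  qed
qed

text \<open>
  The rim followed from petal to petal: by finiteness and absence of backtracking the walk first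
  returns to its starting point, so it is the rim of a flower. An odd flower is excluded and an even
  one is coloured after the rest of the graph, whatever the colour of its centre.
\<close>

lemma petal_walk:
  assumes nb: "\<And>k y. y \<noteq> c \<Longrightarrow> E (f (Suc k)) y \<longleftrightarrow> y = f k \<or> y = f (Suc (Suc k))"
    and nbt: "\<And>k. f k \<noteq> f (Suc (Suc k))" and fc: "\<And>k. f k \<noteq> c"
    and foot: "\<And>k. E c (f k) \<longleftrightarrow> 3 dvd k"
  shows False
proof -
  have e: "E (f k) (f (Suc k))" for k using nb[of "f k" k] fc sym by blast
  have "range f \<subseteq> V" using e inV by blast
  then have "\<not> inj f" using fin finite_subset finite_imageD infinite_UNIV_nat by metis
  then have ex: "\<exists>j. \<exists>i<j. f i = f j" unfolding inj_def by (metis nat_neq_iff)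
  define j where "j = (LEAST j. \<exists>i<j. f i = f j)"
  have "\<exists>i<j. f i = f j" unfolding j_def by (rule LeastI_ex) (rule ex)
  then obtain i where i: "i < j" "f i = f j" by blast
  have mn: "f a \<noteq> f b" if "a < b" "b < j" for a b
    using not_less_Least[of b "\<lambda>j. \<exists>i<j. f i = f j"] that unfolding j_def by blast
  have "i = 0"
  proof (rule ccontr)
    assume "i \<noteq> 0"
    then obtain i' where i': "i = Suc i'" using not0_implies_Suc by blast
    obtain j' where j': "j = Suc j'" using i by (cases j) auto
    have "f j' = f i' \<or> f j' = f (Suc i)" 
      using nb[of "f j'" i'] nb[of "f j'" j'] fc i i' j' by metis
    moreover have "f i' \<noteq> f j'" using mn[of i' j'] i i' j' by auto
    moreover have "f j' \<noteq> f (Suc i)"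
    proof
      assume a: "f j' = f (Suc i)"
      consider "Suc i < j'" | "Suc i = j'" | "i = j'" using i j' by linarith
      then show False
      proof cases
        case 1 then show False using mn[of "Suc i" j'] a j' by simp
      next
        case 2 then show False using nbt[of i] i j' by metis
      next
        case 3 then show False using e[of i] i j' irr by metis
      qed
    qed
    ultimately show False by auto
  qed
  then have f0: "f j = f 0" "j > 0" using i by auto
  have "3 dvd j" using foot[of 0] foot[of j] f0 by auto
  then obtain n where n: "j = 3 * n" by blast
  have "n \<noteq> 1" using tri[OF e[of 0] e[of "Suc 0"]] e[of "Suc (Suc 0)"] f0 n by (auto simp: numeral_3_eq_3)
  then have n2: "n \<ge> 2" using f0 n by (cases n) auto
  have inj: "inj_on f {..<j}" 
    by (rule inj_onI) (metis mn lessThan_iff nat_neq_iff)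
  \<comment> \<open>After the return the walk also continues as at the start, which makes the
    colouring consistent across the seam.\<close>
  have f1: "f (Suc j) = f (Suc 0)"
  proof -
    obtain j' where j': "j = Suc j'" using f0 by (cases j) auto
    have "f (Suc 0) = f j' \<or> f (Suc 0) = f (Suc (Suc j'))" using nb[of "f (Suc 0)" j'] e[of 0] f0 fc j' by metis
    moreover have "f (Suc 0) \<noteq> f j'" using mn[of "Suc 0" j'] n n2 j' by auto
    ultimately show ?thesis using j' by simp
  qed
  show False
  proof (cases "odd n")
    case True
    then have "n \<ge> 3" using n2 by (cases "n = 2") auto
    moreover have "embeds (flower n) E"
    proof (rule embeds_flowerI[where f = f and c = c])
      show "E (f k) (f (Suc k mod (3 * n)))" if "k < 3 * n" for k
        using e[of k] f0 that n by (cases "Suc k = 3 * n") auto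
    qed (use inj n fc foot sym in auto)
    ultimately show False using noF True by blast
  next
    case False
    then have six: "j mod 6 = 0" using n by (auto elim!: evenE)
    show False
    proof (rule reducible[of "f 0" "f ` {..<j}"])
      fix f0 :: "'a \<Rightarrow> col"
      obtain h where h: "\<forall>k. adj (h k) (h (Suc k))" "\<forall>k l. k mod 6 = l mod 6 \<longrightarrow> h k = h l"
        "\<forall>i. adj (f0 c) (h (3 * i))" using petal_colouring by blast
      define g where "g = (\<lambda>y. if y \<in> f ` {..<j} then h (the_inv_into {..<j} f y) else f0 y)"
      have g0: "g (f k) = h k" if "k < j" for k
        unfolding g_def using that the_inv_into_f_f[OF inj] by simp
      have gj: "g (f k) = h k" if H: "k \<le> Suc j" for k
      proof -
        consider "k < j" | "k = j" | "k = Suc j" using H by linarith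
        then show ?thesis
        proof cases
          case 1 then show ?thesis using g0 by simp
        next
          case 2
          have "h j = h 0" using h(2) six by (metis mod_0)
          then show ?thesis using g0[of 0] 2 \<open>f j = f 0\<close> \<open>j > 0\<close> by simp
        next
          case 3
          have "h (Suc j) = h (Suc 0)" using h(2) six by (metis mod_Suc_eq)
          then show ?thesis using g0[of "Suc 0"] 3 f1 n n2 by simp
        qed
      qed
      have gc: "g c = f0 c" unfolding g_def using fc by auto
      have "adj (g y) (g z)" if y: "y \<in> f ` {..<j}" and yz: "E y z" for y z
      proof -
        obtain k where k: "y = f (Suc k)" "k < j"
        proof -
          obtain l where l: "y = f l" "l < j" using y by blast
          show thesis
          proof (cases l)
            case 0 then show thesis using that[of "j - 1"] l \<open>f j = f 0\<close> \<open>j > 0\<close> by simp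
          next
            case (Suc m) then show thesis using that[of m] l by simp
          qed
        qed
        show ?thesis
        proof (cases "z = c")
          case True
          then have "3 dvd Suc k" using foot sym yz k by blast
          then obtain i where "Suc k = 3 * i" by blast
          then show ?thesis using True gc gj[of "Suc k"] k h(3) adj_sym by auto
        next
          case False
          then have "z = f k \<or> z = f (Suc (Suc k))" using nb yz k by blast
          then show ?thesis using gj k h(1) adj_sym by auto
        qed
      qed
      then show "\<exists>g. (\<forall>y. y \<notin> f ` {..<j} \<longrightarrow> g y = f0 y) \<and> (\<forall>y\<in>f ` {..<j}. \<forall>z. E y z \<longrightarrow> adj (g y) (g z))"
        by (intro exI[of _ g]) (auto simp: g_def)
    qed (use f0 \<open>range f \<subseteq> V\<close> in auto)
  qed
qed

text \<open>A petal is packed into one tuple so that dependent choice can iterate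
  \<open>petal_next\<close>.\<close>

definition petal :: "'a \<Rightarrow> 'a \<times> 'a \<times> 'a \<times> 'a \<Rightarrow> bool" where
  "petal c s \<longleftrightarrow> (case s of (u, p, q, x) \<Rightarrow> n2 p u q \<and> n2 q p x \<and> (\<exists>u' x'. n3 u p c u' \<and> n3 x q c x'))"

text \<open>This is \<open>thread_cont\<close> read from the end \<open>x\<close>. The last conjunct
  forbids turning back: the new petal leaves \<open>x\<close> through \<open>x'\<close> and not
  through \<open>q\<close>.\<close>

lemma petal_next:
  assumes "petal c s"
  shows "\<exists>t. petal c t \<and> fst t = snd (snd (snd s)) \<and> fst (snd t) \<noteq> fst (snd (snd s))"
proof -
  obtain u p q x u' x' where s: "s = (u, p, q, x)" "n2 p u q" "n2 q p x" "n3 u p c u'" "n3 x q c x'"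
    using assms unfolding petal_def by (cases s) auto
  obtain x2 x3 e where "n2 x' x x2" "n2 x2 x' x3" "n3 x3 x2 c e"
    using thread_cont[OF n2_swap[OF s(3)] n2_swap[OF s(2)] s(5,4)] by blast
  moreover have "n3 x x' c q" "x' \<noteq> q" using s(5) unfolding n3_def by auto
  ultimately have "petal c (x, x', x2, x3)" unfolding petal_def by auto
  then show ?thesis using s \<open>x' \<noteq> q\<close> by (intro exI[of _ "(x, x', x2, x3)"]) auto
qed

lemma no_petal: "\<not> petal c s"
proof
  assume "petal c s"
  obtain S where S: "\<And>n. petal c (S n)"
    and nx: "\<And>n. fst (S (Suc n)) = snd (snd (snd (S n)))" "\<And>n. fst (snd (S (Suc n))) \<noteq> fst (snd (snd (S n)))"
    using dependent_nat_choice[of "\<lambda>_. petal c"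
      "\<lambda>_ s t. fst t = snd (snd (snd s)) \<and> fst (snd t) \<noteq> fst (snd (snd s))"] petal_next \<open>petal c s\<close> by metis
  define u p q where "u = (\<lambda>n. fst (S n))" and "p = (\<lambda>n. fst (snd (S n)))" and "q = (\<lambda>n. fst (snd (snd (S n))))"
  have pet: "n2 (p n) (u n) (q n)" "n2 (q n) (p n) (u (Suc n))" "\<exists>z. n3 (u n) (p n) c z"
    "\<exists>z. n3 (u (Suc n)) (q n) c z" for n
    using S[of n] nx[of n] unfolding petal_def u_def p_def q_def by (auto split: prod.splits)
  have u3: "n3 (u (Suc n)) (q n) c (p (Suc n))" for n
    using pet(4)[of n] pet(3)[of "Suc n"] nx(2)[of n] unfolding n3_def p_def q_def by metis
  \<comment> \<open>The petals are concatenated: multiples of three are feet, the other indices are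
    inner vertices.\<close>
  define f where "f = (\<lambda>k. if k mod 3 = 0 then u (k div 3) else if k mod 3 = 1 then p (k div 3) else q (k div 3))"
  have f: "f (3 * n) = u n" "f (Suc (3 * n)) = p n" "f (Suc (Suc (3 * n))) = q n"
    "f (Suc (Suc (Suc (3 * n)))) = u (Suc n)" "f (Suc (Suc (Suc (Suc (3 * n))))) = p (Suc n)" for n
  proof -
    have "f (3 * m) = u m" "f (Suc (3 * m)) = p m" "f (Suc (Suc (3 * m))) = q m" for m
    proof -
      have "3 * m mod 3 = 0" "Suc (3 * m) mod 3 = 1" "Suc (Suc (3 * m)) mod 3 = 2"
        "3 * m div 3 = m" "Suc (3 * m) div 3 = m" "Suc (Suc (3 * m)) div 3 = m" by presburger+
      then show "f (3 * m) = u m" "f (Suc (3 * m)) = p m" "f (Suc (Suc (3 * m))) = q m"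
        unfolding f_def by simp_all
    qed
    moreover have "Suc (Suc (Suc (3 * n))) = 3 * Suc n" by simp
    ultimately show "f (3 * n) = u n" "f (Suc (3 * n)) = p n" "f (Suc (Suc (3 * n))) = q n"
      "f (Suc (Suc (Suc (3 * n)))) = u (Suc n)" "f (Suc (Suc (Suc (Suc (3 * n))))) = p (Suc n)" by metis+
  qed
  have cases3: "P k" if "\<And>n. P (3 * n)" "\<And>n. P (Suc (3 * n))" "\<And>n. P (Suc (Suc (3 * n)))" for P and k :: nat
  proof -
    have "k = 3 * (k div 3) \<or> k = Suc (3 * (k div 3)) \<or> k = Suc (Suc (3 * (k div 3)))" by presburger
    then show ?thesis using that by metis
  qed
  have cu: "E c (u n)" for n using pet(3)[of n] n3_E(5) by metis
  have nc: "\<not> E c (p n)" "\<not> E c (q n)" for n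
    using tri[of c "p n" "u n"] tri[of c "q n" "u (Suc n)"] cu[of n] cu[of "Suc n"] sym
      n2_E[OF pet(1)[of n]] n2_E[OF pet(2)[of n]] by blast+
  have neqc: "u n \<noteq> c" "p n \<noteq> c" "q n \<noteq> c" for n
    using cu irr pet(1,2) nc n2_E sym by metis+
  show False
  proof (rule petal_walk[of c f])
    show "E (f (Suc k)) y \<longleftrightarrow> y = f k \<or> y = f (Suc (Suc k))" if "y \<noteq> c" for k y
      by (rule cases3[of _ k]) (use that f pet(1,2) u3 in \<open>auto simp: n2_def n3_def\<close>)
    show "f k \<noteq> f (Suc (Suc k))" for k
      by (rule cases3[of _ k]) (use f pet(1,2) u3 in \<open>auto simp: n2_def n3_def\<close>)
    show "f k \<noteq> c" for k
      by (rule cases3[of _ k]) (use f neqc in auto)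
    show "E c (f k) \<longleftrightarrow> 3 dvd k" for k
    proof -
      have dv: "\<not> 3 dvd Suc (3 * n)" "\<not> 3 dvd Suc (Suc (3 * n))" for n :: nat by presburger+
      show ?thesis by (rule cases3[of "\<lambda>k. E c (f k) \<longleftrightarrow> 3 dvd k" k]) (use f cu nc dv in auto)
    qed
  qed
qed

text \<open>Extending the edge on both sides reaches branch vertices by \<open>no_three_n2\<close>;
  the path condition then turns the path into a petal.\<close>

lemma n2_adjacent: "E p q \<Longrightarrow> B p \<or> B q"
proof (rule ccontr)
  assume pq: "E p q" and nB: "\<not> (B p \<or> B q)"
  obtain u where p: "n2 p u q" using not_B_n2 pq nB n2_swap by metis
  obtain x where q: "n2 q p x" using not_B_n2 sym[OF pq] nB by metis
  note es = n2_E[OF p] n2_E[OF q]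
  have "B u"
  proof (rule ccontr)
    assume "\<not> B u"
    then obtain w where "n2 u w p" using not_B_n2 es n2_swap by metis
    then show False using no_three_n2 p q by blast
  qed
  have "B x"
  proof (rule ccontr)
    assume "\<not> B x"
    then obtain w where "n2 x q w" using not_B_n2 es by metis
    then show False using no_three_n2 p q by blast
  qed
  obtain c u' x' where "n3 u p c u'" "n3 x q c x'"
    by (rule path3_common_nbr[of u p q x]) (use es p q \<open>B u\<close> \<open>B x\<close> in \<open>auto simp: n2_def\<close>)
  then have "petal c (u, p, q, x)" using p q unfolding petal_def by auto
  then show False using no_petal by blast
qed

end

section \<open>Girth at least five: no such threads\<close>

text \<open>The edge \<open>k l\<close> of \<open>C5\<close> is the one opposite to the vertex
  \<open>s\<close>, so each of its ends reaches \<open>s\<close> by a walk of length two.\<close>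

lemma opposite_edge: "\<exists>k l m n. adj k l \<and> adj k m \<and> adj m s \<and> adj l n \<and> adj n s"
proof -
  have "\<forall>s. \<exists>k l m n. adj k l \<and> adj k m \<and> adj m s \<and> adj l n \<and> adj n s"
    unfolding all_col ex_col by simp
  then show ?thesis by blast
qed

context C4_free_counterexample
begin

text \<open>A branch vertex \<open>v\<close> is mixed if it has a branch neighbour \<open>u\<close>
  and a neighbour \<open>p\<close> of degree two. The path \<open>u, v, p, w\<close> closes to the
  pentagon \<open>u, v, p, w, c\<close>, and the path \<open>v, u, c, w\<close> makes
  \<open>v\<close> cubic.\<close>

lemma mixed_pentagon:
  assumes "E v u" "E v p" "B v" "B u" "\<not> B p"
  obtains w c u' w' t where "n2 p v w" "n3 u v c u'" "n3 w p c w'" "n3 v u p t" "E c u" "E c w"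
proof -
  obtain w where p: "n2 p v w" using not_B_n2 sym assms by metis
  note es = n2_E[OF p]
  have Bw: "B w" using n2_adjacent[of p w] es assms by blast
  have d: "u \<noteq> p" "v \<noteq> w" "u \<noteq> w" "u \<noteq> v"
    using assms p tri irr es unfolding n2_def by metis+
  obtain c u' w' where c: "n3 u v c u'" "n3 w p c w'"
    by (rule path3_common_nbr[of u v p w]) (use es assms sym d Bw in auto)
  note es2 = n3_E[OF c(1)] n3_E[OF c(2)]
  have dc: "c \<noteq> v" "c \<noteq> p" "c \<noteq> u" "c \<noteq> w" using c irr es2 unfolding n3_def by metis+
  obtain k e where "n3 v u k e"
    by (rule path3_common_nbr[of v u c w]) (use es es2 assms sym d dc Bw in auto)
  then obtain t where "n3 v u p t" using assms d unfolding n3_def by metis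
  then show thesis using that p c es2 by blast
qed

text \<open>
  If the fifth vertex \<open>c\<close> of the pentagon \<open>u, v, p, w, c\<close> had degree two, the third neighbour of
  \<open>w\<close> either closes up an \<open>E2\<close> or every branch leaving the pentagon has to have length two, and
  then any colouring of the remaining graph extends.
\<close>

lemma mixed_hub_B:
  assumes p: "n2 p v w" and u: "n3 u v c u'" and w: "n3 w p c w'" and v: "n3 v u p t"
  shows "B c"
proof (rule ccontr)
  assume nBc: "\<not> B c"
  note es = n2_E[OF p] n3_E[OF u] n3_E[OF w] n3_E[OF v]
  have uw: "u \<noteq> w" "u \<noteq> v" "w \<noteq> v" using es tri irr p unfolding n2_def by metis+
  have c: "n2 c u w" using not_B_n2[of c u] es nBc uw unfolding n2_def by metis
  have BB: "B u" "B v" "B w" "\<not> B p" using u v w p n3_B n2_not_B by blast+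
  have w'd: "w' \<noteq> p" "w' \<noteq> c" "w' \<noteq> u" "w' \<noteq> v" "w' \<noteq> w"
    using w u v c p es tri irr uw unfolding n2_def n3_def by metis+
  have td: "t \<noteq> p" "t \<noteq> c" "t \<noteq> u" "t \<noteq> v" "t \<noteq> w" "\<not> E t c" "\<not> E t p" "\<not> E u t"
    using w u v c p es tri irr uw sym unfolding n2_def n3_def by metis+
  have u'd: "u' \<noteq> p" "u' \<noteq> c" "u' \<noteq> u" "u' \<noteq> v" "u' \<noteq> w" "\<not> E u' c" "\<not> E u' p" "\<not> E v u'"
    using w u v c p es tri irr uw sym unfolding n2_def n3_def by metis+
  have pc: "p \<noteq> c" using w unfolding n3_def by blast
  have w't: "w' \<noteq> t" "w' \<noteq> u'" "t \<noteq> u'" 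
    using c4[of v p w w'] c4[of u c w w'] tri[of u v t] es w'd uw sym by metis+
  have Bt: "E w' t" if H: "B t"
  proof -
    obtain k e1 e2 where "n3 t v k e1" "n3 w p k e2"
      by (rule path3_common_nbr[of t v p w]) (use es BB td uw H in auto)
    then show ?thesis using w td sym unfolding n3_def by metis
  qed
  have Bu': "E w' u'" if H: "B u'"
  proof -
    obtain k e1 e2 where "n3 u' u k e1" "n3 w c k e2"
      by (rule path3_common_nbr[of u' u c w]) (use es BB u'd uw H in auto)
    then show ?thesis using w u'd sym unfolding n3_def by metis
  qed
  have w'n: "\<not> E w' u" "\<not> E w' v" "\<not> E w' p" "\<not> E w' c"
    using u v p c w't w'd sym uw unfolding n2_def n3_def by metis+
  show False
  proof (cases "B w'")
    case True
    obtain k e1 e2 where "n3 w' w k e1" "n3 v p k e2"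
      by (rule path3_common_nbr[of w' w p v]) (use es BB w'd uw True in auto)
    then have 1: "E w' t" using v w'n n3_E unfolding n3_def by metis
    obtain k e1 e2 where "n3 w' w k e1" "n3 u c k e2"
      by (rule path3_common_nbr[of w' w c u]) (use es BB w'd uw True in auto)
    then have 2: "E w' u'" using u w'n n3_E unfolding n3_def by metis
    have pd: "p \<noteq> v" "p \<noteq> w" "p \<noteq> u" "c \<noteq> u" "c \<noteq> w" "c \<noteq> v"
      using es irr BB nBc by metis+
    have "embeds E2_graph E"
      by (rule embeds_E2I[where E = E and ?v1.0 = u and ?v2.0 = c and ?v3.0 = w and ?v4.0 = p and ?v5.0 = v
            and ?u2.0 = u' and ?u3.0 = w' and ?u4.0 = t, OF sym])
        (use es 1 2 sym[OF 1] sym[OF 2] uw w'd td u'd pc w't pd in auto)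
    then show False using noE2 by blast
  next
    case nBw': False
    obtain a where w': "n2 w' w a" using not_B_n2 es nBw' by metis
    note es1 = n2_E[OF w']
    have Ba: "B a" using n2_adjacent[of w' a] es1 nBw' by blast
    \<comment> \<open>Fresh variables are used because the pentagon has a reflection exchanging
      \<open>v\<close> with \<open>u\<close>, \<open>p\<close> with \<open>c\<close> and
      \<open>t\<close> with \<open>u'\<close>; both versions are needed.\<close>
    have both: False if
        p: "n2 p v w" and u: "n3 u v c u'" and w: "n3 w p c w'" and v: "n3 v u p t" and c: "n2 c u w"
        and "B t" "E w' t" "\<not> B u'" and u'd: "u' \<noteq> v" "u' \<noteq> w" "u' \<noteq> p" "u' \<noteq> c" "u' \<noteq> w'" "u' \<noteq> t"
        "t \<noteq> w" "u \<noteq> w" and BB: "B v" "B w" "B u"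
        for p v u c u' t
    proof -
      note es = n2_E[OF p] n3_E[OF u] n3_E[OF w] n3_E[OF v]
      obtain z where u': "n2 u' u z" using not_B_n2 es \<open>\<not> B u'\<close> by metis
      note es2 = n2_E[OF u']
      have Bz: "B z" using n2_adjacent[of u' z] es2 \<open>\<not> B u'\<close> by blast
      have w't: "n2 w' w t" using w' \<open>E w' t\<close> \<open>t \<noteq> w\<close> unfolding n2_def by metis
      have zd: "z \<noteq> u" "z \<noteq> v" using u' u'd es es2 tri unfolding n2_def by metis+
      have zw: "z \<noteq> w" using w u'd es2 sym unfolding n3_def by metis
      have zn: "\<not> E z p" "\<not> E z c" using p c zd zw sym unfolding n2_def by metis+
      obtain k e1 e2 where "n3 z u' k e1" "n3 v u k e2"
        by (rule path3_common_nbr[of z u' u v]) (use es es2 zd u'd Bz BB in auto)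
      then have zt: "E z t" using v zn n3_E unfolding n3_def by metis
      have "z \<noteq> w'" using Bz nBw' by blast
      obtain k e1 e2 where "n3 z t k e1" "n3 w w' k e2"
        by (rule path3_common_nbr[of z t w' w]) (use es es2 zt zd zw n2_E[OF w't] \<open>t \<noteq> w\<close> \<open>z \<noteq> w'\<close> Bz BB in auto)
      then show False using w zn n3_E unfolding n3_def by metis
    qed
    have one: "\<not> (B t \<and> B u')" using Bt Bu' w' td u'd w't unfolding n2_def by metis
    have nBt: "\<not> B t"
    proof
      assume "B t"
      then show False using both[of p v u c u' t] p u v w c \<open>B t\<close> Bt one u'd w't td uw BB by auto
    qed
    have nBu': "\<not> B u'"
    proof
      assume "B u'"
      have "n3 v u p t" "n3 u v c u'" "n3 w c p w'" "n2 c u w" "n2 p v w"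
        using assms c unfolding n3_def n2_def by auto
      then show False using both[of c u v p t u'] \<open>B u'\<close> Bu' one u'd w't td uw BB by auto
    qed
    obtain z where t: "n2 t v z" using not_B_n2 es nBt by metis
    obtain y where u': "n2 u' u y" using not_B_n2 es nBu' by metis
    note es2 = n2_E[OF t] n2_E[OF u']
    have Bz: "B z" using n2_adjacent[of t z] es2 nBt by blast
    have "z \<noteq> u" using es es2 tri by metis
    have "z \<noteq> w" using w td w't es2 sym unfolding n3_def by metis
    have "z \<noteq> v" using t unfolding n2_def by metis
    have zn: "\<not> E z c" "\<not> E z p" using c p \<open>z \<noteq> u\<close> \<open>z \<noteq> w\<close> \<open>z \<noteq> v\<close> sym unfolding n2_def by metis+
    obtain k z' e2 where k: "n3 z t k z'" "n3 u v k e2"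
      by (rule path3_common_nbr[of z t v u]) (use es es2 Bz BB \<open>z \<noteq> v\<close> td in auto)
    then have "k = u'" using u zn n3_E unfolding n3_def by metis
    then have z: "n3 z t u' z'" using k by blast
    then have yz: "y = z" using u' \<open>z \<noteq> u\<close> n3_E unfolding n2_def by metis
    note es3 = n3_E[OF z]
    have z'd: "z' \<noteq> u" "z' \<noteq> v" "z' \<noteq> w" "z' \<noteq> z" "z' \<noteq> p" "z' \<noteq> c" "z' \<noteq> t" "z' \<noteq> u'"
    proof -
      show "z' \<noteq> u" using es3 es2 tri by metis
      show "z' \<noteq> v" using es3 es2 tri by metis
      show "z' \<noteq> w" using es3 w nBw' BB Bz p c n2_not_B unfolding n3_def by metis
      show "z' \<noteq> z" "z' \<noteq> t" "z' \<noteq> u'" using z irr es3 unfolding n3_def by metis+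
      show "z' \<noteq> p" "z' \<noteq> c" using zn es3 by metis+
    qed
    have nBz': "\<not> B z'"
    proof
      assume "B z'"
      obtain k e1 e2 where "n3 z' z k e1" "n3 v t k e2"
        by (rule path3_common_nbr[of z' z t v]) (use es es2 es3 Bz BB \<open>z \<noteq> v\<close> z'd \<open>B z'\<close> in auto)
      then have "E z' u \<or> E z' p" using v n3_E unfolding n3_def by metis
      moreover have "\<not> E z' p" using p z'd sym unfolding n2_def by metis
      moreover have "\<not> E z' u" using u z'd sym unfolding n3_def by metis
      ultimately show False by blast
    qed
    obtain b where z': "n2 z' z b" using not_B_n2 es3 nBz' by metis
    note es4 = n2_E[OF z']
    have Bb: "B b" using n2_adjacent[of z' b] es4 nBz' by blast
    have zz: "z \<noteq> t" "z \<noteq> u'" "z \<noteq> p" "z \<noteq> c" "z \<noteq> w'" using Bz nBt nBu' BB nBw' nBc by metis+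
    have ww: "w \<noteq> t" "w \<noteq> u'" "w \<noteq> p" "w \<noteq> c" "w \<noteq> w'" "u \<noteq> t" "u \<noteq> u'" "u \<noteq> p" "u \<noteq> c" "u \<noteq> w'"
       "v \<noteq> t" "v \<noteq> u'" "v \<noteq> p" "v \<noteq> c" "v \<noteq> w'" "z' \<noteq> a" "w' \<noteq> b" using BB nBt nBu' nBw' nBc nBz' Ba Bb by metis+
    show False
    proof (cases "a = z")
      case True
      then have "z' = w'" using z w' t u' yz es1 uw \<open>z \<noteq> w\<close> unfolding n3_def n2_def by metis
      show False
      \<comment> \<open>No edge leaves this set. Give \<open>w\<close> and \<open>z\<close> the same
        colour \<open>s\<close> and the edge \<open>u v\<close> the colours opposite to
        \<open>s\<close>; the four paths of length two between them then fit.\<close>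
      proof (rule reducible[of u "{u, v, w, z, p, c, t, u', w'}"])
        fix f :: "'a \<Rightarrow> col"
        obtain s k l m n r where o: "adj k l" "adj k m" "adj m s" "adj l n" "adj n s" "adj s r"
          using opposite_edge ex_adj by metis
        show "\<exists>g. (\<forall>y. y \<notin> {u, v, w, z, p, c, t, u', w'} \<longrightarrow> g y = f y) \<and>
          (\<forall>y\<in>{u, v, w, z, p, c, t, u', w'}. \<forall>z. E y z \<longrightarrow> adj (g y) (g z))"
          by (rule exI[of _ "f(u := k, v := l, w := s, z := s, p := n, c := m, t := n, u' := m, w' := r)"])
            (use p u w v c t u' z w' o adj_sym uw pc w'd td u'd w't zz ww True yz \<open>z' = w'\<close> 
              \<open>z \<noteq> u\<close> \<open>z \<noteq> w\<close> \<open>z \<noteq> v\<close> in \<open>auto simp: n2_def n3_def\<close>)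
      qed (use es es1 es2 es3 in \<open>auto intro: inV\<close>)
    next
      case False
      have w'z': "w' \<noteq> z'" using False w' z es3 \<open>z \<noteq> w\<close> sym unfolding n2_def by metis
      have ad: "a \<noteq> u" "a \<noteq> v" "a \<noteq> w" "a \<noteq> p" "a \<noteq> c" "a \<noteq> t" "a \<noteq> u'" "a \<noteq> w'"
        using w'n w' es1 Ba BB irr nBc nBt nBu' nBw' unfolding n2_def by metis+
      have bd: "b \<noteq> u" "b \<noteq> v" "b \<noteq> w" "b \<noteq> z" "b \<noteq> p" "b \<noteq> c" "b \<noteq> t" "b \<noteq> u'" "b \<noteq> z'"
        using u v w z'd w'z' es4 Bb BB irr nBc nBt nBu' nBz' z' unfolding n3_def n2_def by metis+
      show False
      proof (rule reducible[of u "{u, v, w, z, p, c, t, u', w', z'}"])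
        fix f :: "'a \<Rightarrow> col"
        \<comment> \<open>Now the set is attached to the rest at \<open>a\<close> and
          \<open>b\<close> only. The colour \<open>s\<close> is the midpoint of a walk of length
          four between their colours, whose other inner colours go to \<open>w'\<close> and
          \<open>z'\<close>.\<close>
        obtain i s j where i: "adj (f a) i" "adj i s" "adj s j" "adj j (f b)" using walk4 by blast
        obtain k l m n where o: "adj k l" "adj k m" "adj m s" "adj l n" "adj n s"
          using opposite_edge by metis
        show "\<exists>g. (\<forall>y. y \<notin> {u, v, w, z, p, c, t, u', w', z'} \<longrightarrow> g y = f y) \<and>
          (\<forall>y\<in>{u, v, w, z, p, c, t, u', w', z'}. \<forall>z. E y z \<longrightarrow> adj (g y) (g z))"
          by (rule exI[of _ "f(u := k, v := l, w := s, z := s, p := n, c := m, t := n, u' := m, w' := i, z' := j)"])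
            (use p u w v c t u' z w' z' i o adj_sym uw pc w'd td u'd w't zz ww False yz w'z' ad bd z'd
              \<open>z \<noteq> u\<close> \<open>z \<noteq> w\<close> \<open>z \<noteq> v\<close> in \<open>auto simp: n2_def n3_def\<close>)
      qed (use es es1 es2 es3 in \<open>auto intro: inV\<close>)
    qed
  qed
qed

text \<open>Once the hub is known to be a branch vertex, the path \<open>c, w, p, v\<close> makes it
  cubic, and \<open>p\<close> is the only vertex of the pentagon that is not.\<close>

lemma mixed_hub:
  assumes "E v u" "E v p" "B v" "B u" "\<not> B p"
  obtains w c u' w' t c' where "n2 p v w" "n3 u v c u'" "n3 w p c w'" "n3 v u p t" "n3 c w u c'" "B c"
proof -
  obtain w c u' w' t where c: "n2 p v w" "n3 u v c u'" "n3 w p c w'" "n3 v u p t" "E c u" "E c w"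
    using mixed_pentagon[OF assms] .
  have Bc: "B c" using mixed_hub_B c by blast
  note es = n2_E[OF c(1)] n3_E[OF c(2)] n3_E[OF c(3)]
  have d: "c \<noteq> p" "w \<noteq> v" "w \<noteq> u" using es c tri unfolding n2_def n3_def by metis+
  obtain k e e2 where "n3 c w k e" "n3 v p k e2"
    by (rule path3_common_nbr[of c w p v]) (use es d assms Bc in auto)
  then obtain c' where "n3 c w u c'" using c(5) d unfolding n3_def by metis
  then show thesis using that c Bc by blast
qed

text \<open>
  The path condition reconstructs the Petersen graph minus a vertex, which contains \<open>E2\<close>.
\<close>

lemma no_petersen:
  assumes "E p v" "E p w" and v: "n3 v u p t" and w: "n3 w c p s" and u: "n3 u v c u'" and c: "n3 c w u c'"
    and B: "B t" "B s"
  shows False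
proof -
  note es = n3_E[OF v] n3_E[OF w] n3_E[OF u] n3_E[OF c]
  have BB: "B u" "B c" "B v" "B w" using assms n3_B by blast+
  have d: "u \<noteq> v" "u \<noteq> c" "u \<noteq> w" "u \<noteq> p" "u \<noteq> t" "u \<noteq> s" "v \<noteq> w" "v \<noteq> p" "v \<noteq> t" "v \<noteq> s" "v \<noteq> c"
    "w \<noteq> p" "w \<noteq> c" "w \<noteq> s" "w \<noteq> t" "p \<noteq> t" "p \<noteq> s" "p \<noteq> c" "c \<noteq> s" "c \<noteq> t" "c' \<noteq> u" "c' \<noteq> w" "c' \<noteq> c" "c' \<noteq> v" "u' \<noteq> w"
    using v w u c es irr tri unfolding n3_def by metis+
  have nt: "\<not> E t c" "\<not> E t u" "\<not> E s c" using c4[of t v u c] es d tri sym by metis+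
  obtain k e1 e2 where "n3 t v k e1" "n3 w p k e2"
    by (rule path3_common_nbr[of t v p w]) (use es d assms BB in auto)
  then have ts: "E t s" using w nt n3_E unfolding n3_def by metis
  obtain k e1 e2 where "n3 t s k e1" "n3 c w k e2"
    by (rule path3_common_nbr[of t s w c]) (use es d assms BB ts in auto)
  then have tc': "E t c'" using c nt n3_E unfolding n3_def by metis
  have d2: "c' \<noteq> t" "c' \<noteq> s" "c' \<noteq> p" "t \<noteq> s" using ts tc' irr es tri sym nt by metis+
  have "embeds E2_graph E"
    by (rule embeds_E2I[where E = E and ?v1.0 = c and ?v2.0 = c' and ?v3.0 = t and ?v4.0 = s and ?v5.0 = w
          and ?u2.0 = u and ?u3.0 = v and ?u4.0 = p, OF sym])
      (use es ts tc' sym[OF ts] sym[OF tc'] d d2 assms(1,2) sym[OF assms(1)] sym[OF assms(2)] in auto)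
  then show False using noE2 by blast
qed

text \<open>If the third neighbours \<open>t\<close> and \<open>s\<close> of \<open>v\<close> and
  \<open>w\<close> are branch vertices, \<open>no_petersen\<close> applies. Otherwise both have
  degree two and the configuration closes up to nine vertices that meet the rest in a single vertex
  \<open>r\<close>.\<close>

lemma not_mixed:
  assumes "E v u" "E v p" "B v" "B u"
  shows "B p"
proof (rule ccontr)
  assume "\<not> B p"
  obtain w c u' s t c' where p: "n2 p v w" and u: "n3 u v c u'" and w: "n3 w p c s" and v: "n3 v u p t"
    and c: "n3 c w u c'" using mixed_hub[OF assms \<open>\<not> B p\<close>] by metis
  note es = n2_E[OF p] n3_E[OF v] n3_E[OF w] n3_E[OF u] n3_E[OF c]
  have BB: "B u" "B c" "B v" "B w" using u v c w n3_B by blast+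
  have d: "u \<noteq> v" "u \<noteq> c" "u \<noteq> w" "u \<noteq> p" "u \<noteq> t" "u \<noteq> s" "v \<noteq> w" "v \<noteq> p" "v \<noteq> t" "v \<noteq> s" "v \<noteq> c"
    "w \<noteq> p" "w \<noteq> s" "w \<noteq> t" "p \<noteq> t" "p \<noteq> s" "p \<noteq> c" "c \<noteq> s" "c \<noteq> t"
    "c' \<noteq> u" "c' \<noteq> w" "c' \<noteq> c" "c' \<noteq> v" "c' \<noteq> p" "u' \<noteq> w" "u' \<noteq> c" "u' \<noteq> p" "u' \<noteq> u" "u' \<noteq> v" "u' \<noteq> c'"
    using p v w u c es irr tri unfolding n3_def n2_def by metis+
  have nt: "\<not> E t c" "\<not> E t u" "\<not> E s c" "\<not> E s u" "t \<noteq> s"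
    using c4[of t v u c] c4[of s w c u] c4[of v p w t] es d tri sym by metis+
  \<comment> \<open>With \<open>t\<close> in place of \<open>u\<close>, the hub of
    \<open>mixed_hub\<close> is a common neighbour of \<open>t\<close> and \<open>w\<close> and
    hence equal to \<open>s\<close>.\<close>
  have ts: "B s" if H: "B t"
  proof -
    obtain w1 c1 x1 x2 x3 x4 where "n2 p v w1" "n3 t v c1 x1" "n3 w1 p c1 x2" "B c1"
      using mixed_hub[of v t p] es BB H \<open>\<not> B p\<close> by metis
    then show ?thesis using p w nt n3_E unfolding n2_def n3_def by metis
  qed
  have st: "B t" if H: "B s"
  proof -
    obtain w1 c1 x1 x2 x3 x4 where "n2 p w w1" "n3 s w c1 x1" "n3 w1 p c1 x2" "B c1"
      using mixed_hub[of w s p] es BB H \<open>\<not> B p\<close> by metis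
    then show ?thesis using p v nt n3_E unfolding n2_def n3_def by metis
  qed
  have w2: "n3 w c p s" using w unfolding n3_def by metis
  have nBts: "\<not> B t" "\<not> B s"
    using no_petersen[OF es(1,2) v w2 u c] ts st by blast+
  obtain z where t: "n2 t v z" using not_B_n2 es nBts by metis
  obtain y where s: "n2 s w y" using not_B_n2 es nBts by metis
  note es2 = n2_E[OF t] n2_E[OF s]
  have Bzy: "B z" "B y" using n2_adjacent[of t z] n2_adjacent[of s y] es2 nBts by blast+
  \<comment> \<open>Used for \<open>z\<close> beyond \<open>t\<close>, and in the mirror image for
    \<open>y\<close> beyond \<open>s\<close>; it leaves \<open>z = c'\<close> and
    \<open>y = u'\<close> as the only possibilities.\<close>
  have key: "\<not> E u' z" if
    p: "n2 p v w" and u: "n3 u v c u'" and w: "n3 w p c s" and c: "n3 c w u c'"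
    and s: "n2 s w y" and zd: "z \<noteq> u" "z \<noteq> v" "z \<noteq> w" "z \<noteq> s" and Bz: "B z" and u'd: "u' \<noteq> w" "u' \<noteq> c" "u' \<noteq> v" and "B w" "B u'" "u \<noteq> w"
    for u u' c s c' w v y z p
  proof
    assume uz: "E u' z"
    note es = n2_E[OF p] n3_E[OF w] n3_E[OF u] n3_E[OF c] n2_E[OF s]
    have nz: "\<not> E z p" using p zd sym unfolding n2_def by metis
    have nz2: "\<not> E z c" using c4[of z u' u c] uz sym es u'd zd by metis
    have nu: "\<not> E u' p" using p u'd sym unfolding n2_def by metis
    obtain k e1 e2 where "n3 u' u k e1" "n3 w c k e2"
      by (rule path3_common_nbr[of u' u c w]) (use es u'd \<open>B u'\<close> \<open>B w\<close> \<open>u \<noteq> w\<close> in auto)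
    then have "E u' s" using w nu n3_E unfolding n3_def by metis
    obtain k e1 e2 where "n3 z u' k e1" "n3 w s k e2"
      by (rule path3_common_nbr[of z u' s w]) (use es uz sym u'd \<open>E u' s\<close> zd Bz \<open>B w\<close> in auto)
    then show False using w nz nz2 n3_E unfolding n3_def by metis
  qed
  have zd: "z \<noteq> u" "z \<noteq> v" "z \<noteq> w" "z \<noteq> s" "z \<noteq> t"
    using es es2 t w d nt nBts Bzy \<open>\<not> B p\<close> BB sym unfolding n2_def n3_def by metis+
  have yd: "y \<noteq> c" "y \<noteq> v" "y \<noteq> w" "y \<noteq> s" "y \<noteq> t"
    using es es2 s v d nt nBts Bzy \<open>\<not> B p\<close> BB sym unfolding n2_def n3_def by metis+
  obtain z1 k x1 x2 where "n2 t v z1" "n3 u v k x1" "n3 z1 t k x2" "B k"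
    using mixed_hub[of v u t] es BB nBts by metis
  moreover then have "z1 = z" using t unfolding n2_def by metis
  ultimately have k: "E z k" "k = c \<or> k = u'" "B k" using u n3_E unfolding n3_def by metis+
  have "k \<noteq> u'"
    using key[OF p u w c s zd(1-4) Bzy(1)] d BB k sym by metis
  then have zc': "z = c'" using k c zd sym unfolding n3_def by metis
  obtain y1 m x1 x2 where "n2 s w y1" "n3 c w m x1" "n3 y1 s m x2" "B m"
    using mixed_hub[of w c s] es BB nBts by metis
  moreover then have "y1 = y" using s unfolding n2_def by metis
  ultimately have m: "E y m" "m = u \<or> m = c'" "B m" using c n3_E unfolding n3_def by metis+
  have v2: "n3 v p u t" using v unfolding n3_def by metis
  have "m \<noteq> c'"
    using key[OF n2_swap[OF p] c v2 u t yd(1,3,2,5) Bzy(2)] d BB m sym by metis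
  then have yu': "y = u'" using m u yd sym unfolding n3_def by metis
  have B': "B u'" "B c'" using Bzy zc' yu' by auto
  have nu: "\<not> E u' t" "\<not> E c' s" using t s zc' yu' d B' zd yd sym unfolding n2_def by metis+
  obtain r e1 e2 where r: "n3 u' u r e1" "n3 c' c r e2"
    by (rule path3_common_nbr[of u' u c c']) (use es d B' in auto)
  have u': "n3 u' u r s" and c': "n3 c' c r t"
    using r nu es2 yu' zc' d n3_E unfolding n3_def by metis+
  note es3 = n3_E[OF u'] n3_E[OF c']
  have "\<not> E p u'" "\<not> E p c'" using p d unfolding n2_def by metis+
  then have rd: "r \<noteq> u" "r \<noteq> c" "r \<noteq> v" "r \<noteq> w" "r \<noteq> u'" "r \<noteq> c'" "r \<noteq> s" "r \<noteq> t" "r \<noteq> p"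
    using u' c' es es3 tri irr sym unfolding n3_def by metis+
  show False
  proof (rule reducible[of u "{v, p, w, u, c, t, s, u', c'}"])
    fix f :: "'a \<Rightarrow> col"
    \<comment> \<open>The edge \<open>u c\<close> receives the colours opposite to that of
      \<open>r\<close>. Then \<open>p\<close>, \<open>s\<close> and \<open>t\<close> can all copy
      the colour of \<open>r\<close>.\<close>
    obtain i j k l where o: "adj i j" "adj i k" "adj k (f r)" "adj j l" "adj l (f r)"
      using opposite_edge by metis
    show "\<exists>g. (\<forall>y. y \<notin> {v, p, w, u, c, t, s, u', c'} \<longrightarrow> g y = f y) \<and>
      (\<forall>y\<in>{v, p, w, u, c, t, s, u', c'}. \<forall>z. E y z \<longrightarrow> adj (g y) (g z))"
      by (rule exI[of _ "f(u := i, c := j, v := k, u' := k, w := l, c' := l, p := f r, s := f r, t := f r)"])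
        (use p u w v c t[unfolded zc'] s[unfolded yu'] u' c' d rd zd yd nt o adj_sym zc' yu' in \<open>auto simp: n2_def n3_def\<close>)
  qed (use es es2 es3 in \<open>auto intro: inV\<close>)
qed

lemma no_counterexample: False
proof (cases "\<exists>u v. E u v \<and> B u \<and> B v")
  case False
  \<comment> \<open>By \<open>n2_adjacent\<close> every edge now has exactly one branch end.\<close>
  have "adj (if B x then C0 else C1) (if B y then C0 else C1)" if "E x y" for x y
    using that False n2_adjacent[OF that] by auto
  then show False using noncol[of "\<lambda>x. if B x then C0 else C1"] by blast
next
  case True
  then obtain u v where uv: "E u v" "B u" "B v" by blast
  \<comment> \<open>This propagates through the graph, so the pentagon found next and the third
    neighbours needed for \<open>no_petersen\<close> are all branch vertices.\<close>
  have nb: "B y" if "E x z" "B x" "B z" "E x y" for x y z using not_mixed that by blast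
  obtain p where p: "E v p" "p \<noteq> u" using other sym uv by metis
  have Bp: "B p" using nb p uv sym by metis
  obtain w where w: "E p w" "w \<noteq> v" using other sym p by metis
  have Bw: "B w" using nb w Bp p uv sym by metis
  obtain c u' s where c: "n3 u v c u'" "n3 w p c s"
    by (rule path3_common_nbr[of u v p w]) (use uv p w Bp Bw sym in auto)
  note es = n3_E[OF c(1)] n3_E[OF c(2)]
  have Bc: "B c" using nb uv es sym by metis
  have d: "u \<noteq> w" "v \<noteq> c" "c \<noteq> p" using tri uv p w c es irr sym unfolding n3_def by metis+
  obtain k e where "n3 v u k e"
    by (rule path3_common_nbr[of v u c w]) (use es uv sym d w Bw in auto)
  then obtain t where v: "n3 v u p t" using p unfolding n3_def by metis
  obtain k e2 e3 where "n3 c w k e2" "n3 v p k e3"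
    by (rule path3_common_nbr[of c w p v]) (use es d uv p w sym Bc in auto)
  then obtain c' where c': "n3 c w u c'" using es d unfolding n3_def by metis
  have "n3 w c p s" using c unfolding n3_def by metis
  moreover have "B t" "B s" using nb uv v Bp Bw es p w sym n3_E by metis+
  ultimately show False using no_petersen[of p v w u t c s u' c'] p w sym v c c' by metis
qed

end

section \<open>Girth four\<close>

locale E3_free_counterexample = triangle_free_critical +
  assumes noE3: "\<not> embeds E3_graph E"
begin

definition sq :: "'a \<Rightarrow> 'a \<Rightarrow> 'a \<Rightarrow> 'a \<Rightarrow> bool" where
  "sq a b c d \<longleftrightarrow> E a b \<and> E b c \<and> E c d \<and> E d a \<and> a \<noteq> c \<and> b \<noteq> d"

text \<open>
  Two links, one for each pair of opposite vertices of a 4-cycle, form an \<open>E3\<close>.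
\<close>

definition unlinked :: "'a \<Rightarrow> 'a \<Rightarrow> 'a \<Rightarrow> 'a \<Rightarrow> bool" where
  "unlinked a b c d \<longleftrightarrow> (\<forall>b' d'. E b b' \<longrightarrow> b' \<noteq> a \<longrightarrow> b' \<noteq> c \<longrightarrow> E d d' \<longrightarrow> d' \<noteq> a \<longrightarrow> d' \<noteq> c \<longrightarrow> \<not> E b' d')"

lemma sq_E:
  assumes "sq a b c d"
  shows "E a b" "E b a" "E b c" "E c b" "E c d" "E d c" "E d a" "E a d" "a \<noteq> c" "b \<noteq> d"
    "a \<noteq> b" "b \<noteq> c" "c \<noteq> d" "a \<noteq> d" "\<not> E a c" "\<not> E c a" "\<not> E b d" "\<not> E d b"
  using assms irr tri sym unfolding sq_def by metis+

lemma sq_sym: "sq a b c d \<Longrightarrow> sq c b a d" "sq a b c d \<Longrightarrow> sq a d c b" "sq a b c d \<Longrightarrow> sq b a d c"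
  "sq a b c d \<Longrightarrow> sq c d a b"
  unfolding sq_def using sym by metis+

lemma unlinked_sym: "unlinked a b c d \<Longrightarrow> unlinked c b a d" "unlinked a b c d \<Longrightarrow> unlinked a d c b"
  "unlinked a b c d \<Longrightarrow> unlinked c d a b"
  unfolding unlinked_def using sym by metis+

section \<open>Private neighbours of the vertices of a 4-cycle\<close>

lemma private_nbr:
  assumes "sq a b c d" obtains a' where "E a a'" "\<not> E c a'"
  using fold[of a c] sq_E[OF assms] inV by metis

lemma private_neq:
  assumes "sq a b c d" "E a a'" "\<not> E c a'"
  shows "a' \<noteq> a" "a' \<noteq> b" "a' \<noteq> c" "a' \<noteq> d" "\<not> E a' b" "\<not> E b a'" "\<not> E a' c" "\<not> E a' d" "\<not> E d a'"
  using assms(2,3) sq_E[OF assms(1)] irr tri sym by metis+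

text \<open>No 4-cycle passes through a vertex of degree two, since its neighbourhood would lie in
  that of the opposite vertex.\<close>

lemma fold_n2: "n2 x a b \<Longrightarrow> E y a \<Longrightarrow> E y b \<Longrightarrow> x \<noteq> y \<Longrightarrow> False"
  using fold[of x y] inV n2_E unfolding n2_def by metis

text \<open>Otherwise the path \<open>a', a, d, c\<close> with leaves \<open>b\<close>,
  \<open>c1\<close> at \<open>c\<close> and two further neighbours of \<open>a'\<close> is an
  \<open>H3\<close>.\<close>

lemma private_B_adj:
  assumes s: "sq a b c d" and a': "E a a'" "\<not> E c a'" "B a'" and c1: "E c c1" "c1 \<noteq> b" "c1 \<noteq> d"
  shows "E a' c1"
proof (rule ccontr)
  assume n: "\<not> E a' c1"
  note d = sq_E[OF s] private_neq[OF s a'(1,2)]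
  obtain e1 e2 where e: "E a' e1" "E a' e2" "e1 \<noteq> e2" "e1 \<noteq> a" "e2 \<noteq> a" using B_others[OF a'(3)] .
  have "distinct [a', a, d, c, e1, e2, b, c1]" using d e n a' c1 irr sym tri by simp metis
  then show False using H3[of a' a d c e1 e2 b c1] d e a' c1 sym by metis
qed

text \<open>The same \<open>H3\<close> as for \<open>private_B_adj\<close>: since \<open>c1\<close>
  is now adjacent to \<open>a'\<close>, two neighbours besides \<open>a\<close> and
  \<open>c1\<close> would serve as leaves.\<close>

lemma private_B_n3:
  assumes s: "sq a b c d" and a': "E a a'" "\<not> E c a'" "B a'" and c1: "E c c1" "c1 \<noteq> b" "c1 \<noteq> d"
  shows "\<exists>e. n3 a' a c1 e"
proof (rule ccontr)
  assume n: "\<not> (\<exists>e. n3 a' a c1 e)"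
  note d = sq_E[OF s] private_neq[OF s a'(1,2)]
  have ac: "E a' c1" using private_B_adj assms by metis
  have "a \<noteq> c1" using c1 d by metis
  obtain e1 e2 where e: "E a' e1" "E a' e2" "e1 \<noteq> e2" "e1 \<noteq> a" "e1 \<noteq> c1" "e2 \<noteq> a" "e2 \<noteq> c1"
    using B_n3[OF a'(3) sym[OF a'(1)] ac \<open>a \<noteq> c1\<close> n] .
  have "distinct [a', a, d, c, e1, e2, b, c1]" using d e n ac a' c1 irr sym tri by simp metis
  then show False using H3[of a' a d c e1 e2 b c1] d e a' c1 sym by metis
qed

text \<open>A branch vertex \<open>b'\<close> would be adjacent to the private neighbour of
  \<open>d\<close> by \<open>private_B_adj\<close>, and this edge is a link.\<close>

lemma private_not_B:
  assumes s: "sq a b c d" and u: "unlinked a b c d" and b': "E b b'" "\<not> E d b'"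
  shows "\<not> B b'"
proof
  assume "B b'"
  have s': "sq b a d c" "sq d a b c" using s sq_sym by metis+
  obtain d' where d': "E d d'" "\<not> E b d'" using private_nbr[OF s'(2)] .
  have "E b' d'" using private_B_adj[OF s'(1) b' \<open>B b'\<close> d'(1)] private_neq[OF s'(2) d'] by metis
  then show False using u b' d' private_neq[OF s'(2) d'] private_neq[OF s'(1) b'] unfolding unlinked_def by metis
qed

section \<open>Threads leaving an unlinked pair\<close>

lemma unlinked_second:
  assumes s: "sq a b c d" and u: "unlinked a b c d" and b': "E b b'" "\<not> E d b'" and n: "n2 b' b b2"
  shows "\<not> E a b2" "\<not> E c b2" "\<not> E d b2" "\<not> E b b2" "\<not> E b2 a" "\<not> E b2 c" "\<not> E b2 d" "\<not> E b2 b"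
    "b2 \<noteq> a" "b2 \<noteq> b" "b2 \<noteq> c" "b2 \<noteq> d" "b2 \<noteq> b'" "b' \<noteq> a" "b' \<noteq> c" "b' \<noteq> b" "b' \<noteq> d" "\<not> E b' a" "\<not> E b' c" "\<not> E b' d"
proof -
  have s': "sq b a d c" using s sq_sym by metis
  note d = sq_E[OF s] private_neq[OF s' b'] n2_E[OF n]
  show *: "\<not> E a b2" "\<not> E c b2" "b2 \<noteq> a" "b2 \<noteq> b" "b2 \<noteq> c" "b2 \<noteq> d" "b2 \<noteq> b'" "\<not> E b b2"
    using fold_n2[OF n, of a] fold_n2[OF n, of c] d irr n b' tri unfolding n2_def by metis+
  \<comment> \<open>Otherwise \<open>b', b2\<close> would link \<open>b\<close> with
    \<open>d\<close>.\<close>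
  show "\<not> E d b2" using u b' d * unfolding unlinked_def by metis
  then show "\<not> E b2 a" "\<not> E b2 c" "\<not> E b2 d" "\<not> E b2 b" using * sym by metis+
  show "b' \<noteq> a" "b' \<noteq> c" "b' \<noteq> b" "b' \<noteq> d" "\<not> E b' a" "\<not> E b' c" "\<not> E b' d" using d by metis+
qed

text \<open>For \<open>x\<close> among \<open>a\<close>, \<open>c\<close>, the path
  \<open>b2, b', b, x\<close> with leaf \<open>d\<close> at \<open>x\<close> is part of an
  \<open>H3\<close> unless every other outer neighbour of \<open>x\<close> is adjacent to
  \<open>b2\<close>. The same path bounds the degree of \<open>b2\<close> by three.\<close>

lemma unlinked_B_second:
  assumes s: "sq a b c d" and u: "unlinked a b c d" and b': "E b b'" "\<not> E d b'" and n: "n2 b' b b2" and B2: "B b2"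
  shows "\<exists>a' c'. n3 b2 b' a' c' \<and> n3 a b d a' \<and> n3 c b d c' \<and> n2 a' a b2 \<and> \<not> B a' \<and> \<not> B c'"
proof -
  note d = sq_E[OF s] unlinked_second[OF s u b' n] n2_E[OF n]
  have nb: "E b2 a1" if H: "E x a1" "a1 \<noteq> b" "a1 \<noteq> d" "x = a \<or> x = c" for a1 x
  proof (rule ccontr)
    assume "\<not> E b2 a1"
    obtain e1 e2 where e: "E b2 e1" "E b2 e2" "e1 \<noteq> e2" "e1 \<noteq> b'" "e2 \<noteq> b'" using B_others[OF B2] .
    have hx: "E b x" "E x d" "\<not> E b2 x" "\<not> E x b2" "\<not> E x b'" "x \<noteq> d" "x \<noteq> b" "x \<noteq> b'" "x \<noteq> b2"
      using H(4) d sym by blast+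
    have "distinct [b2, b', b, x, e1, e2, d, a1]" using d e hx H(1-3) \<open>\<not> E b2 a1\<close> irr by simp metis
    then show False using H3[of b2 b' b x e1 e2 d a1] n2_E[OF n] e hx H(1) by metis
  qed
  obtain a' where a': "E a a'" "\<not> E c a'" using private_nbr[OF s] .
  obtain c' where c': "E c c'" "\<not> E a c'" using private_nbr[OF sq_sym(1)[OF s]] .
  note d2 = private_neq[OF s a'] private_neq[OF sq_sym(1)[OF s] c']
  have ba: "E b2 a'" "E b2 c'" "a' \<noteq> c'" using nb a' c' d2 by metis+
  have d3: "b' \<noteq> a'" "b' \<noteq> c'" using a' c' d sym by metis+
  have "\<exists>k. n3 b2 b' a' k"
  proof (rule ccontr)
    assume m: "\<not> (\<exists>k. n3 b2 b' a' k)"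
    obtain e1 e2 where e: "E b2 e1" "E b2 e2" "e1 \<noteq> e2" "e1 \<noteq> b'" "e1 \<noteq> a'" "e2 \<noteq> b'" "e2 \<noteq> a'"
      using B_n3[OF B2 n2_E(4)[OF n] ba(1) d3(1) m] .
    have "distinct [b2, b', b, a, e1, e2, d, a']" using d d2 d3 e a' irr by simp metis
    then show False using H3[of b2 b' b a e1 e2 d a'] d e a' by metis
  qed
  then have b2: "n3 b2 b' a' c'" using ba d3 unfolding n3_def by metis
  have a: "n3 a b d a'" using nb[of a] b2 a' c' d d2 sym unfolding n3_def by metis
  have c: "n3 c b d c'" using nb[of c] b2 a' c' d d2 sym unfolding n3_def by metis
  have "\<not> B a'" using private_B_adj[OF s a' _ c'(1)] d2 ba tri sym by metis
  moreover have "\<not> B c'" using private_B_adj[OF sq_sym(1)[OF s] c' _ a'(1)] d2 ba tri sym by metis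
  moreover have "n2 a' a b2" using not_B_n2[OF sym[OF a'(1)]] \<open>\<not> B a'\<close> ba d sym unfolding n2_def by metis
  ultimately show ?thesis using b2 a c by blast
qed

text \<open>A branch vertex \<open>b2\<close> makes \<open>a\<close> and \<open>c\<close> cubic. The
  thread at \<open>d\<close> then either ends in a branch vertex that would have to be
  \<open>b2\<close> itself, or is longer, and its end \<open>d3\<close> yields an \<open>H3\<close>
  with leaves \<open>a\<close>, \<open>c\<close> at \<open>d\<close>.\<close>

lemma unlinked_not_B_second:
  assumes s: "sq a b c d" and u: "unlinked a b c d" and b': "E b b'" "\<not> E d b'" and n: "n2 b' b b2"
  shows "\<not> B b2"
proof
  assume B2: "B b2"
  obtain a' c' where U: "n3 b2 b' a' c'" "n3 a b d a'" "n3 c b d c'" "n2 a' a b2" "\<not> B a'" "\<not> B c'"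
    using unlinked_B_second[OF assms B2] by blast
  have s': "sq a d c b" "unlinked a d c b" "sq d a b c" using s u sq_sym unlinked_sym by metis+
  obtain d' where d': "E d d'" "\<not> E b d'" using private_nbr[OF s'(3)] .
  obtain d2 where n': "n2 d' d d2" using not_B_n2 private_not_B[OF s'(1,2) d'] d' sym by metis
  note f = sq_E[OF s] unlinked_second[OF s'(1,2) d' n'] n2_E[OF n'] n3_E[OF U(1)] n3_E[OF U(2)] n3_E[OF U(3)]
  show False
  proof (cases "B d2")
    case True
    obtain a'' c'' where U': "n3 d2 d' a'' c''" "n3 a d b a''" "n2 a'' a d2"
      using unlinked_B_second[OF s'(1,2) d' n' True] by blast
    have "a'' = a'" using U' U unfolding n3_def by metis
    then have "d2 = b2" using U' U(4) unfolding n2_def by metis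
    then have "E b2 d'" using U' n3_E by metis
    then show False using U(1) b' d' f tri unfolding n3_def by metis
  next
    case False
    obtain d3 where n'': "n2 d2 d' d3" using not_B_n2 f False by metis
    note g = n2_E[OF n'']
    have "B d3"
    proof (rule ccontr)
      assume "\<not> B d3"
      then obtain w where "n2 d3 d2 w" using not_B_n2 g by metis
      then show False using no_three_n2 n' n'' by blast
    qed
    have h: "d3 \<noteq> b" "d3 \<noteq> d" "d3 \<noteq> a'" "d3 \<noteq> c'" "d3 \<noteq> d'" using f g U \<open>B d3\<close> n'' unfolding n2_def by metis+
    have h2: "\<not> E d3 a" "\<not> E d3 c" using h U sym unfolding n3_def by metis+
    have h3: "\<not> E d3 d" using fold_n2[OF n', of d3] h g by metis
    have h4: "\<not> E d3 d'" using n' h g irr sym unfolding n2_def by metis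
    obtain e1 e2 where e: "E d3 e1" "E d3 e2" "e1 \<noteq> e2" "e1 \<noteq> d2" "e2 \<noteq> d2" using B_others[OF \<open>B d3\<close>] .
    have "d3 \<noteq> a" "d3 \<noteq> c" using g f by metis+
    then have "distinct [d, d', d2, d3, a, c, e1, e2]" using f g h h2 h3 h4 e irr by simp metis
    then show False using H3[of d d' d2 d3 a c e1 e2] f g e d' by metis
  qed
qed

text \<open>Both \<open>b'\<close> and \<open>b2\<close> have degree two, so \<open>b3\<close> is a
  branch vertex. Were it adjacent to neither \<open>a\<close> nor \<open>c\<close>, these would be
  leaves at \<open>b\<close> of an \<open>H3\<close> along \<open>b, b', b2, b3\<close>.\<close>

lemma unlinked_thread:
  assumes s: "sq a b c d" and u: "unlinked a b c d" and b': "E b b'" "\<not> E d b'"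
  obtains b2 b3 where "n2 b' b b2" "n2 b2 b' b3" "B b3" "E b3 a \<or> E b3 c"
    "b3 \<noteq> a" "b3 \<noteq> b" "b3 \<noteq> c" "b3 \<noteq> d" "b3 \<noteq> b'" "b3 \<noteq> b2" "\<not> E b b3" "\<not> E b3 b"
proof -
  obtain b2 where n: "n2 b' b b2" using not_B_n2 private_not_B[OF s u b'] b' sym by metis
  note f = sq_E[OF s] unlinked_second[OF s u b' n] n2_E[OF n]
  obtain b3 where n2: "n2 b2 b' b3" using not_B_n2 f unlinked_not_B_second[OF s u b' n] by metis
  note g = n2_E[OF n2]
  have "B b3"
  proof (rule ccontr)
    assume "\<not> B b3"
    then obtain w where "n2 b3 b2 w" using not_B_n2 g by metis
    then show False using no_three_n2 n n2 by blast
  qed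
  have h: "b3 \<noteq> a" "b3 \<noteq> b" "b3 \<noteq> c" "b3 \<noteq> d" "b3 \<noteq> b'" "b3 \<noteq> b2"
    using f g n2 irr unfolding n2_def by metis+
  have h2: "\<not> E b3 b" using fold_n2[OF n, of b3] h g by metis
  have h3: "\<not> E b3 b'" using n h g irr sym unfolding n2_def by metis
  have "E b3 a \<or> E b3 c"
  proof (rule ccontr)
    assume k: "\<not> (E b3 a \<or> E b3 c)"
    obtain e1 e2 where e: "E b3 e1" "E b3 e2" "e1 \<noteq> e2" "e1 \<noteq> b2" "e2 \<noteq> b2" using B_others[OF \<open>B b3\<close>] .
    have "distinct [b, b', b2, b3, a, c, e1, e2]" using f g h h2 h3 k e irr by simp metis
    then show False using H3[of b b' b2 b3 a c e1 e2] f g e b' by metis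
  qed
  then show thesis using that n n2 \<open>B b3\<close> h h2 sym by metis
qed

text \<open>If \<open>b3\<close> misses \<open>c\<close>, it is itself a private branch neighbour of
  \<open>a\<close>, so \<open>private_B_adj\<close> and \<open>private_B_n3\<close> apply to
  it.\<close>

lemma unlinked_lopsided:
  assumes s: "sq a b c d" and u: "unlinked a b c d" and b': "E b b'" "\<not> E d b'"
    and n: "n2 b' b b2" and m: "n2 b2 b' b3" and B3: "B b3" "E b3 a" "\<not> E b3 c"
    and h: "b3 \<noteq> a" "b3 \<noteq> b" "b3 \<noteq> c" "b3 \<noteq> d" "\<not> E b b3"
  shows "\<exists>c'. n3 b3 b2 a c' \<and> n3 c b d c' \<and> n3 b a c b' \<and> \<not> E a c'"
proof -
  note f = sq_E[OF s] unlinked_second[OF s u b' n] n2_E[OF n] n2_E[OF m]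
  obtain c' where c': "E c c'" "\<not> E a c'" using private_nbr[OF sq_sym(1)[OF s]] .
  note d2 = private_neq[OF sq_sym(1)[OF s] c']
  have b3p: "E a b3" "\<not> E c b3" using B3 sym by metis+
  obtain e where e: "n3 b3 a c' e" using private_B_n3[OF s b3p B3(1) c'(1)] d2 by metis
  have bc: "b2 \<noteq> c'" "b2 \<noteq> a" using f c' by metis+
  then have b3: "n3 b3 b2 a c'" using e f unfolding n3_def by metis
  have c: "n3 c b d c'"
    using private_B_adj[OF s b3p B3(1)] b3 c' f d2 unfolding n3_def by metis
  have "n3 b a c b'"
  proof (rule ccontr)
    assume "\<not> n3 b a c b'"
    then obtain b1 where b1: "E b b1" "b1 \<noteq> a" "b1 \<noteq> c" "b1 \<noteq> b'" using f b' unfolding n3_def by metis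
    have "distinct [b, b', b2, b3, c, b1, a, c']"
      using f b1 h c' d2 bc n3_E[OF b3] n m irr tri sym unfolding n2_def by simp metis
    then show False using H3[of b b' b2 b3 c b1 a c'] f b' b1 n3_E[OF b3] by metis
  qed
  then show ?thesis using b3 c c' by blast
qed

text \<open>The thread at \<open>d\<close> has the same form as the one at \<open>b\<close>. A third
  vertex \<open>d3\<close> adjacent to both \<open>a\<close> and \<open>c\<close> is impossible; in
  the other cases the configuration closes up completely and is coloured explicitly.\<close>

lemma unlinked_not_lopsided:
  assumes s: "sq a b c d" and u: "unlinked a b c d" and b': "E b b'" "\<not> E d b'"
    and n: "n2 b' b b2" and m: "n2 b2 b' b3" and B3: "B b3" "E b3 a" "\<not> E b3 c"
    and h: "b3 \<noteq> a" "b3 \<noteq> b" "b3 \<noteq> c" "b3 \<noteq> d" "\<not> E b b3"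
  shows False
proof -
  obtain c' where c': "n3 b3 b2 a c'" "n3 c b d c'" "n3 b a c b'" "\<not> E a c'"
    using unlinked_lopsided[OF assms] by blast
  have s': "sq a d c b" "unlinked a d c b" "sq d a b c" "sq c d a b" "unlinked c d a b" "sq c b a d"
    using s u sq_sym unlinked_sym by metis+
  obtain d' where d': "E d d'" "\<not> E b d'" using private_nbr[OF s'(3)] .
  obtain d2 d3 where d2: "n2 d' d d2" "n2 d2 d' d3" "B d3" "E d3 a \<or> E d3 c"
    and dn: "d3 \<noteq> a" "d3 \<noteq> d" "d3 \<noteq> c" "d3 \<noteq> b" "d3 \<noteq> d'" "d3 \<noteq> d2" "\<not> E d d3" "\<not> E d3 d"
    using unlinked_thread[OF s'(1,2) d'] .
  note f = sq_E[OF s] unlinked_second[OF s u b' n] n2_E[OF n] n2_E[OF m] n3_E[OF c'(1)] n3_E[OF c'(2)]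
    n3_E[OF c'(3)] unlinked_second[OF s'(1,2) d' d2(1)] n2_E[OF d2(1)] n2_E[OF d2(2)]
  have nBs: "\<not> B b'" "\<not> B b2" "\<not> B d'" "\<not> B d2" using n m d2 n2_not_B by metis+
  have BBs: "B a" "B b" "B c" "B d" using B_def sq_E[OF s] c' d' b' n3_B f h unlinked_second[OF s'(1,2) d' d2(1)] by metis+
  have e1: "b' \<noteq> d'" "b2 \<noteq> d'" "b' \<noteq> d2" "b2 \<noteq> d2" "b3 \<noteq> d3"
    using f n m d2 dn h b' d' BBs nBs c' unfolding n2_def n3_def by metis+
  have e2: "c' \<noteq> a" "c' \<noteq> b" "c' \<noteq> c" "c' \<noteq> d" "c' \<noteq> b'" "c' \<noteq> b2" "c' \<noteq> b3" "c' \<noteq> d'"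
    using f c' irr tri unfolding n3_def by metis+
  consider "E d3 a" "E d3 c" | "E d3 a" "\<not> E d3 c" | "E d3 c" "\<not> E d3 a" using d2 by blast
  then show False
  proof cases
    case 1
    then have "d3 = c'" using c' dn sym unfolding n3_def by metis
    then show False using 1 c' sym by metis
  next
    case 2
    obtain c'' where c'': "n3 d3 d2 a c''" "n3 c d b c''" "n3 d a c d'"
      using unlinked_lopsided[OF s'(1,2) d' d2(1,2,3) 2] dn by metis
    have "c'' = c'" using c'' c' unfolding n3_def by metis
    note g = n3_E[OF c''(1)] n3_E[OF c''(3)]
    have "B c'" unfolding B_def using f g e1 dn h \<open>c'' = c'\<close> by metis
    have c'p: "E c c'" using f by metis
    have b3a: "E a b3" using f by metis
    obtain e where "n3 c' c b3 e"
      using private_B_n3[OF s'(6) c'p c'(4) \<open>B c'\<close> b3a] h by metis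
    then have cc: "n3 c' c b3 d3" using g e1 dn \<open>c'' = c'\<close> unfolding n3_def by metis
    have a: "E a y \<Longrightarrow> y = b \<or> y = d \<or> y = b3 \<or> y = d3" for y
      using private_B_adj[OF s'(6) c'p c'(4) \<open>B c'\<close>, of y] cc f unfolding n3_def by metis
    have e3: "c' \<noteq> d2" "c' \<noteq> d3" "b' \<noteq> d3" "b2 \<noteq> d3" "d' \<noteq> b3" "d2 \<noteq> b3" "b' \<noteq> b3" "b2 \<noteq> b3"
      using nBs \<open>B c'\<close> c' 2 d2(3) B3(1) sym by metis+
    show False
    \<comment> \<open>No edge leaves this set, so the colours can be fixed regardless of
      \<open>f\<close>. The two threads are coloured alike.\<close>
    proof (rule reducible[of a "{a, b, c, d, c', b3, d3, b', b2, d', d2}"])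
      fix f :: "'a \<Rightarrow> col"
      show "\<exists>g. (\<forall>y. y \<notin> {a, b, c, d, c', b3, d3, b', b2, d', d2} \<longrightarrow> g y = f y) \<and>
        (\<forall>y\<in>{a, b, c, d, c', b3, d3, b', b2, d', d2}. \<forall>z. E y z \<longrightarrow> adj (g y) (g z))"
        by (rule exI[of _ "f(a := C0, b := C1, d := C1, c := C2, c' := C3, b3 := C4, d3 := C4,
              b' := C2, b2 := C3, d' := C2, d2 := C3)"])
          (use n m d2(1,2) c' c''[unfolded \<open>c'' = c'\<close>] cc e1 e2 e3 dn h sq_E[OF s] unlinked_second[OF s u b' n]
            unlinked_second[OF s'(1,2) d' d2(1)] in \<open>auto simp: n2_def n3_def dest!: a\<close>)
    qed (use f g in \<open>auto intro: inV\<close>)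
  next
    case 3
    obtain a'' where a'': "n3 d3 d2 c a''" "n3 a d b a''" "n3 d c a d'"
      using unlinked_lopsided[OF s'(4,5) d' d2(1,2,3) 3] dn by metis
    have dc: "d3 = c'" using 3 c' dn sym unfolding n3_def by metis
    have "a'' = b3" using a'' f h unfolding n3_def by metis
    note g = n3_E[OF a''(1)] n3_E[OF a''(3)]
    have e3: "c' \<noteq> d2" "b' \<noteq> c'" "b2 \<noteq> c'" "d' \<noteq> b3" "d2 \<noteq> b3" "b' \<noteq> b3" "b2 \<noteq> b3"
      using nBs c' dc d2(3) B3(1) sym by metis+
    show False
    \<comment> \<open>Again no edge leaves the set; this time the thread at \<open>d\<close> ends in
      \<open>c'\<close>, next to \<open>c\<close>.\<close>
    proof (rule reducible[of a "{a, b, c, d, c', b3, b', b2, d', d2}"])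
      fix f :: "'a \<Rightarrow> col"
      show "\<exists>g. (\<forall>y. y \<notin> {a, b, c, d, c', b3, b', b2, d', d2} \<longrightarrow> g y = f y) \<and>
        (\<forall>y\<in>{a, b, c, d, c', b3, b', b2, d', d2}. \<forall>z. E y z \<longrightarrow> adj (g y) (g z))"
        by (rule exI[of _ "f(a := C0, b := C1, d := C1, c := C2, c' := C3, b3 := C4,
              b' := C2, b2 := C3, d' := C0, d2 := C4)"])
          (use n m d2(1,2)[unfolded dc] c' a''[unfolded \<open>a'' = b3\<close> dc] e1 e2 e3 dn h sq_E[OF s] unlinked_second[OF s u b' n]
            unlinked_second[OF s'(1,2) d' d2(1)] in \<open>auto simp: n2_def n3_def\<close>)
    qed (use f g in \<open>auto intro: inV\<close>)
  qed
qed

text \<open>With both lopsided cases gone, \<open>b3\<close> is adjacent to \<open>a\<close> and to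
  \<open>c\<close> and forms with \<open>b\<close> a second 4-cycle through them.\<close>

lemma unlinked_twin:
  assumes s: "sq a b c d" and u: "unlinked a b c d"
  obtains b' b2 b3 where "E b b'" "\<not> E d b'" "n2 b' b b2" "n2 b2 b' b3" "E b3 a" "E b3 c"
    "b3 \<noteq> a" "b3 \<noteq> b" "b3 \<noteq> c" "b3 \<noteq> d" "b3 \<noteq> b'" "b3 \<noteq> b2" "\<not> E b b3"
proof -
  have s': "sq c b a d" "unlinked c b a d" "sq b a d c" using s u sq_sym unlinked_sym by metis+
  obtain b' where b': "E b b'" "\<not> E d b'" using private_nbr[OF s'(3)] .
  obtain b2 b3 where n: "n2 b' b b2" "n2 b2 b' b3" "B b3" "E b3 a \<or> E b3 c"
    and h: "b3 \<noteq> a" "b3 \<noteq> b" "b3 \<noteq> c" "b3 \<noteq> d" "b3 \<noteq> b'" "b3 \<noteq> b2" "\<not> E b b3" "\<not> E b3 b"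
    using unlinked_thread[OF s u b'] .
  have "E b3 a" "E b3 c"
    using unlinked_not_lopsided[OF s u b' n(1-3)] unlinked_not_lopsided[OF s'(1,2) b' n(1-3)] n h by metis+
  then show thesis using that b' n h by blast
qed

lemma not_unlinked:
  assumes s: "sq a b c d"
  shows "\<not> unlinked a b c d"
proof
  assume u: "unlinked a b c d"
  obtain b' b2 b3 where b: "E b b'" "\<not> E d b'" "n2 b' b b2" "n2 b2 b' b3" "E b3 a" "E b3 c"
    "b3 \<noteq> a" "b3 \<noteq> b" "b3 \<noteq> c" "b3 \<noteq> d" "b3 \<noteq> b'" "b3 \<noteq> b2" "\<not> E b b3" using unlinked_twin[OF s u] .
  have s': "sq b a d c" "sq c b a d" using s sq_sym by metis+
  note f = sq_E[OF s] unlinked_second[OF s u b(1-3)] n2_E[OF b(3)] n2_E[OF b(4)]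
  show False
  proof (cases "unlinked b a d c")
    case True
    obtain a' a2 a3 where a: "E a a'" "\<not> E c a'" "n2 a' a a2" "n2 a2 a' a3" "E a3 b" "E a3 d"
    "a3 \<noteq> b" "a3 \<noteq> a" "a3 \<noteq> d" "a3 \<noteq> c" "a3 \<noteq> a'" "a3 \<noteq> a2" "\<not> E a a3" using unlinked_twin[OF s'(1) True] .
    \<comment> \<open>With twins on both sides, the path \<open>a, d, c, b\<close> has leaves
      \<open>b3\<close>, \<open>a'\<close> at \<open>a\<close> and \<open>b'\<close>,
      \<open>a3\<close> at \<open>b\<close>.\<close>
    have "distinct [a, d, c, b, b3, a', b', a3]"
      using f a b private_neq[OF s a(1,2)] private_neq[OF s'(1) b(1,2)] sym by simp metis
    then show False using H3[of a d c b b3 a' b' a3] f a b sym by metis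
  next
    case False
    then obtain a1 c1 where l: "E a a1" "a1 \<noteq> b" "a1 \<noteq> d" "E c c1" "c1 \<noteq> b" "c1 \<noteq> d" "E a1 c1"
      unfolding unlinked_def by blast
    \<comment> \<open>In the 4-cycle \<open>a, b, c, b3\<close> one pair is linked through
      \<open>b', b2\<close> and the other through \<open>a1, c1\<close>.\<close>
    have "distinct [a, b, b', b2, b3, a1, c1, c]"
      using f b l irr tri sym by simp metis
    then have "embeds E3_graph E"
      by (intro embeds_E3I[where E = E and ?v1.0 = a and ?v2.0 = b and ?v3.0 = b' and ?v4.0 = b2 and ?v5.0 = b3
            and ?u2.0 = a1 and ?u3.0 = c1 and ?u4.0 = c]) (use f l b sym[OF b(6)] sym[OF l(4)] in \<open>auto intro: sym\<close>)
    then show False using noE3 by blast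
  qed
qed

lemma no_sq: "\<not> sq a b c d"
proof
  assume s: "sq a b c d"
  have s': "sq b a d c" using s sq_sym by metis
  obtain b1 d1 where b: "E b b1" "b1 \<noteq> a" "b1 \<noteq> c" "E d d1" "d1 \<noteq> a" "d1 \<noteq> c" "E b1 d1"
    using not_unlinked[OF s] unfolding unlinked_def by blast
  obtain a1 c1 where l: "E a a1" "a1 \<noteq> b" "a1 \<noteq> d" "E c c1" "c1 \<noteq> b" "c1 \<noteq> d" "E a1 c1"
    using not_unlinked[OF s'] unfolding unlinked_def by blast
  note f = sq_E[OF s]
  have "distinct [a, b, b1, d1, d, a1, c1, c]"
    using f b l irr tri sym by simp metis
  then have "embeds E3_graph E"
    by (intro embeds_E3I[where E = E and ?v1.0 = a and ?v2.0 = b and ?v3.0 = b1 and ?v4.0 = d1 and ?v5.0 = d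
          and ?u2.0 = a1 and ?u3.0 = c1 and ?u4.0 = c]) (use f l b sym[OF b(4)] sym[OF l(4)] in \<open>auto intro: sym\<close>)
  then show False using noE3 by blast
qed

end

section \<open>Subgraphs, isomorphism and girth\<close>

lemma subgraph_pair_iff:
  "subgraph (with_proj S) (with_proj G) \<longleftrightarrow>
    pverts S \<subseteq> pverts G \<and> parcs S \<subseteq> parcs G \<and> pair_wf_digraph S \<and> pair_wf_digraph G"
  by (auto simp: subgraph_def compatible_def wf_digraph_wp_iff)

lemma pair_graph_symcl:
  assumes "finite V" "A \<subseteq> V \<times> V" "\<And>x. (x, x) \<notin> A"
  shows "pair_graph \<lparr>pverts = V, parcs = A\<^sup>s\<rparr>"
proof -
  have "A\<^sup>s \<subseteq> V \<times> V" using assms(2) by (auto simp: symcl_def)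
  moreover then have "finite (A\<^sup>s)" using assms(1) finite_subset by blast
  ultimately show ?thesis
    using assms by unfold_locales (auto simp: symmetric_def symcl_def sym_def)
qed

text \<open>A digraph isomorphism also carries maps for arcs, heads and tails. For arcs that are
  pairs these are determined by the vertex map.\<close>

lemma graph_iso_iff:
  assumes "pair_wf_digraph G"
  shows "G \<cong>\<^sub>g H \<longleftrightarrow> (\<exists>\<phi>. inj_on \<phi> (pverts G) \<and> pverts H = \<phi> ` pverts G \<and>
    parcs H = (\<lambda>(a, b). (\<phi> a, \<phi> b)) ` parcs G)"
proof
  assume "G \<cong>\<^sub>g H"
  then obtain f where f: "pre_digraph.digraph_isomorphism (with_proj G) f" "with_proj H = app_iso f (with_proj G)"
    unfolding digraph_iso_def by blast
  have ht: "iso_tail f = fst" "iso_head f = snd" and vs: "pverts H = iso_verts f ` pverts G"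
    and as: "parcs H = iso_arcs f ` parcs G"
    using arg_cong[OF f(2), of tail] arg_cong[OF f(2), of head] arg_cong[OF f(2), of verts]
      arg_cong[OF f(2), of arcs] by (simp_all add: app_iso_def)
  have "iso_arcs f a = (\<lambda>(a, b). (iso_verts f a, iso_verts f b)) a" if "a \<in> parcs G" for a
    using f(1) that ht unfolding pre_digraph.digraph_isomorphism_def
    by (simp add: prod_eq_iff split: prod.splits)
  then have "parcs H = (\<lambda>(a, b). (iso_verts f a, iso_verts f b)) ` parcs G"
    using as by (metis (no_types, lifting) image_cong)
  then show "\<exists>\<phi>. inj_on \<phi> (pverts G) \<and> pverts H = \<phi> ` pverts G \<and>
    parcs H = (\<lambda>(a, b). (\<phi> a, \<phi> b)) ` parcs G"
    using f(1) vs unfolding pre_digraph.digraph_isomorphism_def by auto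
next
  assume "\<exists>\<phi>. inj_on \<phi> (pverts G) \<and> pverts H = \<phi> ` pverts G \<and>
    parcs H = (\<lambda>(a, b). (\<phi> a, \<phi> b)) ` parcs G"
  then obtain \<phi> where \<phi>: "inj_on \<phi> (pverts G)" "pverts H = \<phi> ` pverts G"
    "parcs H = (\<lambda>(a, b). (\<phi> a, \<phi> b)) ` parcs G" by blast
  interpret G: pair_wf_digraph G by fact
  let ?f = "\<lparr>iso_verts = \<phi>, iso_arcs = (\<lambda>(a, b). (\<phi> a, \<phi> b)), iso_head = snd, iso_tail = fst\<rparr>"
  have "inj_on (\<lambda>(a, b). (\<phi> a, \<phi> b)) (parcs G)"
    using \<phi>(1) by (auto simp: inj_on_def dest: G.in_arcsD1 G.in_arcsD2)
  then have "pre_digraph.digraph_isomorphism (with_proj G) ?f"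
    using \<phi>(1) G.wf_digraph_axioms
    by (auto simp: pre_digraph.digraph_isomorphism_def wf_digraph_wp_iff assms)
  moreover have "with_proj H = app_iso ?f (with_proj G)"
    using \<phi> by (simp add: app_iso_def with_proj_def)
  ultimately show "G \<cong>\<^sub>g H" unfolding digraph_iso_def by blast
qed

lemma graph_iso_sym:
  assumes "pair_wf_digraph G" "pair_wf_digraph H" "G \<cong>\<^sub>g H"
  shows "H \<cong>\<^sub>g G"
proof -
  interpret G: pair_wf_digraph G by fact
  obtain \<phi> where \<phi>: "inj_on \<phi> (pverts G)" "pverts H = \<phi> ` pverts G"
    "parcs H = (\<lambda>(a, b). (\<phi> a, \<phi> b)) ` parcs G" using assms(3) graph_iso_iff[OF assms(1), of H] by blast
  let ?\<psi> = "the_inv_into (pverts G) \<phi>"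
  have i: "?\<psi> (\<phi> x) = x" if "x \<in> pverts G" for x using the_inv_into_f_f[OF \<phi>(1) that] .
  have "inj_on ?\<psi> (pverts H)" using \<phi> inj_on_the_inv_into by metis
  moreover have "pverts G = ?\<psi> ` pverts H" using \<phi>(2) i by (force simp: image_image)
  moreover have "parcs G = (\<lambda>(a, b). (?\<psi> a, ?\<psi> b)) ` parcs H"
  proof -
    have "(\<lambda>(a, b). (?\<psi> a, ?\<psi> b)) ` parcs H = (\<lambda>e. e) ` parcs G"
      unfolding \<phi>(3) image_image
      by (rule image_cong) (auto simp: i dest: G.in_arcsD1 G.in_arcsD2)
    then show ?thesis by simp
  qed
  ultimately show ?thesis using graph_iso_iff[OF assms(2)] by blast
qed

definition hom_image :: "('a \<Rightarrow> 'b) \<Rightarrow> 'a pair_pre_digraph \<Rightarrow> 'b pair_pre_digraph" where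
  "hom_image \<phi> H = \<lparr>pverts = \<phi> ` pverts H, parcs = (\<lambda>(a, b). (\<phi> a, \<phi> b)) ` parcs H\<rparr>"

lemma hom_image_simps [simp]:
  "pverts (hom_image \<phi> H) = \<phi> ` pverts H" "parcs (hom_image \<phi> H) = (\<lambda>(a, b). (\<phi> a, \<phi> b)) ` parcs H"
  by (simp_all add: hom_image_def)

lemma hom_image_wf: "pair_wf_digraph H \<Longrightarrow> pair_wf_digraph (hom_image \<phi> H)"
  by unfold_locales (auto dest: pair_wf_digraph.in_arcsD1 pair_wf_digraph.in_arcsD2)

lemma hom_image_iso: "pair_wf_digraph H \<Longrightarrow> inj_on \<phi> (pverts H) \<Longrightarrow> H \<cong>\<^sub>g hom_image \<phi> H"
  using graph_iso_iff[of H "hom_image \<phi> H"] by (auto intro!: exI[of _ \<phi>])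

lemma pair_graph_symD: "pair_graph G \<Longrightarrow> (x, y) \<in> parcs G \<Longrightarrow> (y, x) \<in> parcs G"
  by (metis pair_graph.axioms(2) pair_pseudo_graph.axioms(2) pair_sym_digraph.arcs_symmetric)

lemma pair_graph_wf: "pair_graph G \<Longrightarrow> pair_wf_digraph G"
  by (metis pair_graph.axioms(2) pair_pseudo_graph.axioms(2) pair_sym_digraph.axioms(1))

lemma pair_graph_irrefl: "pair_graph G \<Longrightarrow> (x, x) \<notin> parcs G"
  by (metis fst_conv pair_digraph.axioms(2) pair_graph.axioms(1) pair_loopfree_digraph.pair_no_loops snd_conv)

lemma pair_graph_fin: "pair_graph G \<Longrightarrow> finite (pverts G)" "pair_graph G \<Longrightarrow> finite (parcs G)"
  by (metis pair_digraph.axioms(1) pair_fin_digraph.pair_finite_verts pair_graph.axioms(1),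
      metis pair_digraph.axioms(1) pair_fin_digraph.pair_finite_arcs pair_graph.axioms(1))

lemma pair_graphI:
  assumes "finite (pverts G)" "\<And>x y. (x, y) \<in> parcs G \<Longrightarrow> x \<in> pverts G \<and> (y, x) \<in> parcs G \<and> x \<noteq> y"
  shows "pair_graph G"
proof -
  have e: "fst e \<in> pverts G" "snd e \<in> pverts G" "fst e \<noteq> snd e" if "e \<in> parcs G" for e
    using assms(2)[of "fst e" "snd e"] assms(2)[of "snd e" "fst e"] that by auto
  then have "parcs G \<subseteq> pverts G \<times> pverts G" by (auto simp: mem_Times_iff)
  then have "finite (parcs G)" using assms(1) finite_subset by blast
  then show ?thesis using assms e by unfold_locales (auto simp: symmetric_def intro!: symI)
qed

lemma hom_image_graph:
  assumes "pair_graph H" "inj_on \<phi> (pverts H)"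
  shows "pair_graph (hom_image \<phi> H)"
proof (rule pair_graphI)
  interpret H: pair_graph H by fact
  show "finite (pverts (hom_image \<phi> H))" using pair_graph_fin[OF assms(1)] by simp
  show "x \<in> pverts (hom_image \<phi> H) \<and> (y, x) \<in> parcs (hom_image \<phi> H) \<and> x \<noteq> y"
    if xy: "(x, y) \<in> parcs (hom_image \<phi> H)" for x y
  proof -
    obtain a b where ab: "(a, b) \<in> parcs H" "x = \<phi> a" "y = \<phi> b" using xy by auto
    then have "a \<in> pverts H" "b \<in> pverts H" "(b, a) \<in> parcs H" "a \<noteq> b"
      using H.in_arcsD1 H.in_arcsD2 pair_graph_symD[OF assms(1)] pair_graph_irrefl[OF assms(1)] by metis+
    have "(\<lambda>(a, b). (\<phi> a, \<phi> b)) (b, a) \<in> parcs (hom_image \<phi> H)"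
      unfolding hom_image_simps by (rule imageI) fact
    then have "(y, x) \<in> parcs (hom_image \<phi> H)" unfolding ab prod.case .
    moreover have "x \<in> pverts (hom_image \<phi> H)" using ab \<open>a \<in> pverts H\<close> by simp
    moreover have "x \<noteq> y" using ab inj_onD[OF assms(2), of a b] \<open>a \<in> pverts H\<close> \<open>b \<in> pverts H\<close> \<open>a \<noteq> b\<close> by blast
    ultimately show ?thesis by blast
  qed
qed

definition arc_rel :: "'a pair_pre_digraph \<Rightarrow> 'a \<Rightarrow> 'a \<Rightarrow> bool" where
  "arc_rel G x y \<longleftrightarrow> (x, y) \<in> parcs G"

text \<open>If every vertex of \<open>H\<close> lies on an arc, an embedding automatically maps the
  vertices of \<open>H\<close> into those of \<open>G\<close>.\<close>

lemma contains_subgraph_iff: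
  assumes G: "pair_wf_digraph G" and H: "pair_wf_digraph H" and iso: "\<And>v. v \<in> pverts H \<Longrightarrow> \<exists>w. (v, w) \<in> parcs H"
  shows "contains_subgraph G H \<longleftrightarrow> embeds H (arc_rel G)"
proof
  assume "contains_subgraph G H"
  then obtain S where S: "subgraph (with_proj S) (with_proj G)" "H \<cong>\<^sub>g S" unfolding contains_subgraph_def by blast
  then obtain \<phi> where \<phi>: "inj_on \<phi> (pverts H)" "parcs S = (\<lambda>(a, b). (\<phi> a, \<phi> b)) ` parcs H"
    using graph_iso_iff[OF H, of S] by blast
  then show "embeds H (arc_rel G)"
    using S(1) unfolding embeds_def arc_rel_def subgraph_pair_iff by (intro exI[of _ \<phi>]) auto
next
  assume "embeds H (arc_rel G)"
  then obtain \<phi> where \<phi>: "inj_on \<phi> (pverts H)" "\<And>a b. (a, b) \<in> parcs H \<Longrightarrow> (\<phi> a, \<phi> b) \<in> parcs G"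
    unfolding embeds_def arc_rel_def by blast
  have "\<phi> ` pverts H \<subseteq> pverts G" using \<phi>(2) iso pair_wf_digraph.in_arcsD1[OF G] by blast
  then have "subgraph (with_proj (hom_image \<phi> H)) (with_proj G)"
    unfolding subgraph_pair_iff using \<phi>(2) hom_image_wf[OF H] G by auto
  then show "contains_subgraph G H" unfolding contains_subgraph_def using hom_image_iso[OF H \<phi>(1)] by blast
qed

primrec col_index :: "col \<Rightarrow> nat" where
  "col_index C0 = 0" | "col_index C1 = 1" | "col_index C2 = 2" | "col_index C3 = 3" | "col_index C4 = 4"

lemma cycle5_arcs: "parcs (cycle_graph 5) = {(0, 1), (1, 2), (2, 3), (3, 4), (4, 0)}\<^sup>s"
proof -
  have "{(i, Suc i mod 5) | i. i < 5} = (\<lambda>i. (i, Suc i mod 5)) ` {..<5 :: nat}" by blast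
  also have "{..<5 :: nat} = {0, 1, 2, 3, 4}" by auto
  finally show ?thesis
    by (simp add: cycle_graph_def numeral_2_eq_2)
qed

lemma C5_colourable_iff:
  assumes "pair_wf_digraph G"
  shows "C5_colourable G \<longleftrightarrow> (\<exists>f. \<forall>x y. arc_rel G x y \<longrightarrow> adj (f x) (f y))"
proof
  assume "C5_colourable G"
  then obtain f where f: "graph_hom f G (cycle_graph 5)" unfolding C5_colourable_def by blast
  let ?c = "\<lambda>n :: nat. if n = 0 then C0 else if n = 1 then C1 else if n = 2 then C2 else if n = 3 then C3 else C4"
  have "adj (?c (f x)) (?c (f y))" if "arc_rel G x y" for x y
  proof -
    have "(f x, f y) \<in> parcs (cycle_graph 5)" using f that unfolding graph_hom_def arc_rel_def by blast
    then show ?thesis unfolding cycle5_arcs by (auto simp: symcl_def)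
  qed
  then show "\<exists>f. \<forall>x y. arc_rel G x y \<longrightarrow> adj (f x) (f y)" by (intro exI[of _ "\<lambda>x. ?c (f x)"]) blast
next
  assume "\<exists>f. \<forall>x y. arc_rel G x y \<longrightarrow> adj (f x) (f y)"
  then obtain f where f: "\<And>x y. (x, y) \<in> parcs G \<Longrightarrow> adj (f x) (f y)" unfolding arc_rel_def by blast
  have a: "adj a b \<Longrightarrow> (col_index a, col_index b) \<in> parcs (cycle_graph 5)" for a b
    unfolding cycle5_arcs by (cases a) (auto simp: symcl_def)
  have "col_index a < 5" for a by (cases a) auto
  then have "graph_hom (\<lambda>x. col_index (f x)) G (cycle_graph 5)"
    unfolding graph_hom_def using f a by (auto simp: cycle_graph_def)
  then show "C5_colourable G" unfolding C5_colourable_def by blast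
qed

text \<open>Criticality turns containment into isomorphism: the image of a non-colourable graph is a
  non-colourable subgraph and so cannot be proper.\<close>

lemma critical_embeds_iso:
  assumes G: "pair_graph G" "C5_critical G" and H: "pair_graph H" "\<not> C5_colourable H"
    and iso: "\<And>v. v \<in> pverts H \<Longrightarrow> \<exists>w. (v, w) \<in> parcs H" and emb: "embeds H (arc_rel G)"
  shows "G \<cong>\<^sub>g H"
proof -
  note wG = pair_graph_wf[OF G(1)] and wH = pair_graph_wf[OF H(1)]
  obtain \<phi> where \<phi>: "inj_on \<phi> (pverts H)" "\<And>a b. (a, b) \<in> parcs H \<Longrightarrow> (\<phi> a, \<phi> b) \<in> parcs G"
    using emb unfolding embeds_def arc_rel_def by blast
  let ?S = "hom_image \<phi> H"
  have S: "pair_graph ?S" by (rule hom_image_graph[OF H(1) \<phi>(1)])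
  have "\<phi> ` pverts H \<subseteq> pverts G" using \<phi>(2) iso pair_wf_digraph.in_arcsD1[OF wG] by blast
  then have sub: "subgraph (with_proj ?S) (with_proj G)"
    unfolding subgraph_pair_iff using \<phi>(2) hom_image_wf[OF wH] wG by auto
  have "\<not> C5_colourable ?S"
  proof
    assume "C5_colourable ?S"
    then obtain f where f: "\<forall>x y. arc_rel ?S x y \<longrightarrow> adj (f x) (f y)"
      using C5_colourable_iff[OF pair_graph_wf[OF S]] by blast
    have "adj (f (\<phi> x)) (f (\<phi> y))" if "arc_rel H x y" for x y
    proof -
      have "arc_rel ?S (\<phi> x) (\<phi> y)" using that unfolding arc_rel_def by (auto intro: rev_image_eqI[of "(x, y)"])
      then show ?thesis using f by blast
    qed
    then have "C5_colourable H" unfolding C5_colourable_iff[OF wH] by (intro exI[of _ "\<lambda>x. f (\<phi> x)"]) blast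
    then show False using H(2) by blast
  qed
  then have "?S = G" using G(2) S sub unfolding C5_critical_def by blast
  then show ?thesis using graph_iso_sym[OF wH wG] hom_image_iso[OF wH \<phi>(1)] by metis
qed

lemma critical_colour_induced:
  assumes "pair_graph G" "C5_critical G" "W \<subset> pverts G"
  shows "\<exists>f. \<forall>x\<in>W. \<forall>y\<in>W. arc_rel G x y \<longrightarrow> adj (f x) (f y)"
proof -
  let ?S = "\<lparr>pverts = W, parcs = parcs G \<inter> W \<times> W\<rparr>"
  have S: "pair_graph ?S"
    by (rule pair_graphI) (use assms pair_graph_fin[OF assms(1)] finite_subset pair_graph_symD[OF assms(1)]
        pair_graph_irrefl[OF assms(1)] in auto)
  have "subgraph (with_proj ?S) (with_proj G)"
    unfolding subgraph_pair_iff using assms pair_graph_wf[OF S] pair_graph_wf[OF assms(1)] by auto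
  moreover have "?S \<noteq> G" using assms(3) by (metis pair_pre_digraph.select_convs(1) psubset_eq)
  ultimately have "C5_colourable ?S" using assms(2) S unfolding C5_critical_def by blast
  then show ?thesis using C5_colourable_iff[OF pair_graph_wf[OF S]] unfolding arc_rel_def by auto
qed

text \<open>Without isolated vertices every proper subgraph misses an edge, so only the deletion of
  single edges has to be examined. Unordered pairs are compared because an edge consists of two
  arcs.\<close>

lemma C5_criticalI:
  assumes G: "pair_graph G" and nc: "\<not> C5_colourable G"
    and iso: "\<And>v. v \<in> pverts G \<Longrightarrow> \<exists>w. (v, w) \<in> parcs G"
    and ec: "\<And>x y. arc_rel G x y \<Longrightarrow> \<exists>f. \<forall>a b. arc_rel G a b \<longrightarrow> {a, b} \<noteq> {x, y} \<longrightarrow> adj (f a) (f b)"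
  shows "C5_critical G"
  unfolding C5_critical_def
proof (intro conjI allI impI nc)
  fix S assume S: "pair_graph S \<and> subgraph (with_proj S) (with_proj G) \<and> S \<noteq> G"
  then have s: "pverts S \<subseteq> pverts G" "parcs S \<subseteq> parcs G" unfolding subgraph_pair_iff by auto
  have "parcs S \<noteq> parcs G"
  proof
    assume e: "parcs S = parcs G"
    then have "pverts G \<subseteq> pverts S"
      using iso pair_wf_digraph.in_arcsD1[of S] pair_graph_wf[of S] S by blast
    then show False using S s e by auto
  qed
  then obtain x y where xy: "(x, y) \<in> parcs G" "(x, y) \<notin> parcs S" using s by auto
  obtain f where f: "\<forall>a b. arc_rel G a b \<longrightarrow> {a, b} \<noteq> {x, y} \<longrightarrow> adj (f a) (f b)"
    using ec xy unfolding arc_rel_def by blast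
  have "adj (f a) (f b)" if "arc_rel S a b" for a b
  proof -
    have "(b, a) \<in> parcs S" using that S pair_graph_symD unfolding arc_rel_def by metis
    then have "{a, b} \<noteq> {x, y}" using xy that unfolding arc_rel_def by (auto simp: doubleton_eq_iff)
    then show ?thesis using f that s unfolding arc_rel_def by blast
  qed
  then show "C5_colourable S" using C5_colourable_iff S pair_graph_wf by blast
qed

section \<open>Cycles of length three, four and five and the girth\<close>

definition has_C3 :: "('a \<Rightarrow> 'a \<Rightarrow> bool) \<Rightarrow> bool" where
  "has_C3 E \<longleftrightarrow> (\<exists>a b c. E a b \<and> E b c \<and> E c a)"

text \<open>Only degenerate closed walks are excluded; the remaining inequalities hold in every
  loopless graph.\<close>

definition has_C4 :: "('a \<Rightarrow> 'a \<Rightarrow> bool) \<Rightarrow> bool" where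
  "has_C4 E \<longleftrightarrow> (\<exists>a b c d. E a b \<and> E b c \<and> E c d \<and> E d a \<and> a \<noteq> c \<and> b \<noteq> d)"

definition has_C5 :: "('a \<Rightarrow> 'a \<Rightarrow> bool) \<Rightarrow> bool" where
  "has_C5 E \<longleftrightarrow> (\<exists>a b c d e. E a b \<and> E b c \<and> E c d \<and> E d e \<and> E e a \<and> distinct [a, b, c, d, e])"

lemma cycle_pair_iff:
  "pre_digraph.cycle (with_proj G) p \<longleftrightarrow>
    (\<exists>u. u \<in> pverts G \<and> set p \<subseteq> parcs G \<and> pcas u p u \<and> distinct (tl (pawalk_verts u p)) \<and> p \<noteq> [])"
  unfolding pre_digraph.cycle_def pre_digraph.awalk_def cas_with_proj_eq awalk_verts_with_proj_eq
  by auto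

lemma girth_le: "pre_digraph.cycle (with_proj G) p \<Longrightarrow> 3 \<le> length p \<Longrightarrow> girth G \<le> enat (length p)"
  unfolding girth_def by (rule Inf_lower) blast

context
  fixes G :: "'a pair_pre_digraph"
  assumes G: "pair_graph G"
begin

lemma girth_C3: assumes "has_C3 (arc_rel G)" shows "girth G \<le> 3"
proof -
  obtain a b c where e: "(a, b) \<in> parcs G" "(b, c) \<in> parcs G" "(c, a) \<in> parcs G"
    using assms unfolding has_C3_def arc_rel_def by blast
  have "a \<noteq> b" "b \<noteq> c" "c \<noteq> a" using e pair_graph_irrefl[OF G] by metis+
  then have "pre_digraph.cycle (with_proj G) [(a, b), (b, c), (c, a)]"
    unfolding cycle_pair_iff using e pair_wf_digraph.in_arcsD1[OF pair_graph_wf[OF G]] by auto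
  from girth_le[OF this] show ?thesis by (simp add: numeral_eq_enat eval_nat_numeral)
qed

lemma girth_C4: assumes "has_C4 (arc_rel G)" shows "girth G \<le> 4"
proof -
  obtain a b c d where e: "(a, b) \<in> parcs G" "(b, c) \<in> parcs G" "(c, d) \<in> parcs G" "(d, a) \<in> parcs G" "a \<noteq> c" "b \<noteq> d"
    using assms unfolding has_C4_def arc_rel_def by blast
  have "a \<noteq> b" "b \<noteq> c" "c \<noteq> d" "d \<noteq> a" using e pair_graph_irrefl[OF G] by metis+
  then have "pre_digraph.cycle (with_proj G) [(a, b), (b, c), (c, d), (d, a)]"
    unfolding cycle_pair_iff using e pair_wf_digraph.in_arcsD1[OF pair_graph_wf[OF G]] by auto
  from girth_le[OF this] show ?thesis by (simp add: numeral_eq_enat eval_nat_numeral)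
qed

lemma girth_C5: assumes "has_C5 (arc_rel G)" shows "girth G \<le> 5"
proof -
  obtain a b c d e where e: "(a, b) \<in> parcs G" "(b, c) \<in> parcs G" "(c, d) \<in> parcs G" "(d, e) \<in> parcs G"
      "(e, a) \<in> parcs G" "distinct [a, b, c, d, e]"
    using assms unfolding has_C5_def arc_rel_def by blast
  then have "pre_digraph.cycle (with_proj G) [(a, b), (b, c), (c, d), (d, e), (e, a)]"
    unfolding cycle_pair_iff using pair_wf_digraph.in_arcsD1[OF pair_graph_wf[OF G]] by auto
  from girth_le[OF this] show ?thesis by (simp add: numeral_eq_enat eval_nat_numeral)
qed

lemma cycle3: assumes "pre_digraph.cycle (with_proj G) p" "length p = 3" shows "has_C3 (arc_rel G)"
proof -
  obtain e1 e2 e3 where "p = [e1, e2, e3]" using assms(2) by (auto simp: numeral_3_eq_3 length_Suc_conv)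
  then show ?thesis using assms(1) unfolding cycle_pair_iff has_C3_def arc_rel_def
    by (cases e1; cases e2; cases e3) auto
qed

lemma cycle4: assumes "pre_digraph.cycle (with_proj G) p" "length p = 4" shows "has_C4 (arc_rel G)"
proof -
  obtain e1 e2 e3 e4 where "p = [e1, e2, e3, e4]" using assms(2) by (auto simp: numeral_eq_Suc length_Suc_conv)
  then show ?thesis using assms(1) unfolding cycle_pair_iff has_C4_def arc_rel_def
    by (cases e1; cases e2; cases e3; cases e4) auto
qed

lemma girth_ge4: assumes "\<not> has_C3 (arc_rel G)" shows "4 \<le> girth G"
  unfolding girth_def
proof (rule Inf_greatest)
  fix x assume "x \<in> {enat (length p) |p. pre_digraph.cycle (with_proj G) p \<and> 3 \<le> length p}"
  then obtain p where p: "x = enat (length p)" "pre_digraph.cycle (with_proj G) p" "3 \<le> length p" by blast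
  then have "length p \<noteq> 3" using cycle3 assms by blast
  then show "4 \<le> x" using p by (simp add: numeral_eq_enat)
qed

lemma girth_ge5: assumes "\<not> has_C3 (arc_rel G)" "\<not> has_C4 (arc_rel G)" shows "5 \<le> girth G"
  unfolding girth_def
proof (rule Inf_greatest)
  fix x assume "x \<in> {enat (length p) |p. pre_digraph.cycle (with_proj G) p \<and> 3 \<le> length p}"
  then obtain p where p: "x = enat (length p)" "pre_digraph.cycle (with_proj G) p" "3 \<le> length p" by blast
  then have "length p \<noteq> 3" "length p \<noteq> 4" using cycle3 cycle4 assms by blast+
  then show "5 \<le> x" using p by (simp add: numeral_eq_enat)
qed

end

section \<open>Transfer along isomorphisms\<close>

lemma iso_rel:
  assumes "pair_graph G" "pair_graph H" "G \<cong>\<^sub>g H"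
  obtains \<phi> where "bij_betw \<phi> (pverts G) (pverts H)"
    "\<And>x y. arc_rel G x y \<Longrightarrow> arc_rel H (\<phi> x) (\<phi> y)"
    "\<And>x y. x \<in> pverts G \<Longrightarrow> y \<in> pverts G \<Longrightarrow> arc_rel H (\<phi> x) (\<phi> y) \<Longrightarrow> arc_rel G x y"
proof -
  interpret G: pair_graph G by fact
  obtain \<phi> where \<phi>: "inj_on \<phi> (pverts G)" "pverts H = \<phi> ` pverts G"
    "parcs H = (\<lambda>(a, b). (\<phi> a, \<phi> b)) ` parcs G" using assms(3) graph_iso_iff[OF pair_graph_wf[OF assms(1)], of H] by blast
  show thesis
  proof
    show "bij_betw \<phi> (pverts G) (pverts H)" using \<phi> by (simp add: bij_betw_def)
    show "arc_rel H (\<phi> x) (\<phi> y)" if "arc_rel G x y" for x y using that \<phi>(3) unfolding arc_rel_def by auto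
    show "arc_rel G x y" if v: "x \<in> pverts G" "y \<in> pverts G" and e: "arc_rel H (\<phi> x) (\<phi> y)" for x y
    proof -
      obtain a b where ab: "(a, b) \<in> parcs G" "\<phi> x = \<phi> a" "\<phi> y = \<phi> b" using e \<phi>(3) unfolding arc_rel_def by auto
      then have "x = a" "y = b" using v \<phi>(1) G.in_arcsD1 G.in_arcsD2 by (metis inj_onD)+
      then show ?thesis using ab unfolding arc_rel_def by simp
    qed
  qed
qed

lemma iso_embeds:
  assumes GH: "pair_graph G" "pair_graph H" "G \<cong>\<^sub>g H" and wK: "pair_wf_digraph K" and iK: "\<And>v. v \<in> pverts K \<Longrightarrow> \<exists>w. (v, w) \<in> parcs K"
    and e: "embeds K (arc_rel G)"
  shows "embeds K (arc_rel H)"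
proof -
  obtain \<phi> where \<phi>: "bij_betw \<phi> (pverts G) (pverts H)" "\<And>x y. arc_rel G x y \<Longrightarrow> arc_rel H (\<phi> x) (\<phi> y)"
    using iso_rel[OF GH] by metis
  obtain \<psi> where \<psi>: "inj_on \<psi> (pverts K)" "\<forall>(a, b)\<in>parcs K. arc_rel G (\<psi> a) (\<psi> b)" using e unfolding embeds_def by blast
  have "\<psi> ` pverts K \<subseteq> pverts G"
    using iK \<psi>(2) pair_wf_digraph.in_arcsD1[OF pair_graph_wf[OF GH(1)]] unfolding arc_rel_def by blast
  then have "inj_on (\<phi> \<circ> \<psi>) (pverts K)" using \<psi>(1) \<phi>(1) by (meson bij_betw_imp_inj_on comp_inj_on inj_on_subset)
  then show ?thesis unfolding embeds_def using \<psi>(2) \<phi>(2) by (intro exI[of _ "\<phi> \<circ> \<psi>"]) auto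
qed

lemma iso_girth:
  assumes GH: "pair_graph G" "pair_graph H" "G \<cong>\<^sub>g H"
  shows "has_C3 (arc_rel G) \<Longrightarrow> has_C3 (arc_rel H)" "has_C4 (arc_rel G) \<Longrightarrow> has_C4 (arc_rel H)"
    "has_C5 (arc_rel G) \<Longrightarrow> has_C5 (arc_rel H)"
proof -
  obtain \<phi> where \<phi>: "bij_betw \<phi> (pverts G) (pverts H)" "\<And>x y. arc_rel G x y \<Longrightarrow> arc_rel H (\<phi> x) (\<phi> y)"
    using iso_rel[OF GH] by metis
  have v: "arc_rel G x y \<Longrightarrow> x \<in> pverts G" for x y
    using pair_wf_digraph.in_arcsD1[OF pair_graph_wf[OF GH(1)]] unfolding arc_rel_def by blast
  have i: "\<phi> x = \<phi> y \<longleftrightarrow> x = y" if "x \<in> pverts G" "y \<in> pverts G" for x y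
    using that \<phi>(1) by (metis bij_betw_inv_into_left)
  show "has_C3 (arc_rel G) \<Longrightarrow> has_C3 (arc_rel H)" unfolding has_C3_def using \<phi>(2) by blast
  show "has_C4 (arc_rel G) \<Longrightarrow> has_C4 (arc_rel H)" unfolding has_C4_def using \<phi>(2) v i by metis
  assume "has_C5 (arc_rel G)"
  then obtain a b c d e where e: "arc_rel G a b" "arc_rel G b c" "arc_rel G c d" "arc_rel G d e" "arc_rel G e a" 
    "distinct [a, b, c, d, e]" unfolding has_C5_def by blast
  then have "distinct (map \<phi> [a, b, c, d, e])" using v i by auto
  then show "has_C5 (arc_rel H)" unfolding has_C5_def using \<phi>(2) e by (intro exI[of _ "\<phi> a"] exI[of _ "\<phi> b"]
      exI[of _ "\<phi> c"] exI[of _ "\<phi> d"] exI[of _ "\<phi> e"]) auto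
qed

lemma iso_critical:
  assumes GH: "pair_graph G" "pair_graph H" "G \<cong>\<^sub>g H" and H: "\<not> C5_colourable H"
    and iso: "\<And>v. v \<in> pverts H \<Longrightarrow> \<exists>w. (v, w) \<in> parcs H"
    and ec: "\<And>x y. arc_rel H x y \<Longrightarrow> \<exists>f. \<forall>a b. arc_rel H a b \<longrightarrow> {a, b} \<noteq> {x, y} \<longrightarrow> adj (f a) (f b)"
  shows "C5_critical G"
proof (rule C5_criticalI[OF GH(1)])
  note HG = GH(2,1) graph_iso_sym[OF pair_graph_wf[OF GH(1)] pair_graph_wf[OF GH(2)] GH(3)]
  obtain \<phi> where \<phi>: "bij_betw \<phi> (pverts G) (pverts H)" "\<And>x y. arc_rel G x y \<Longrightarrow> arc_rel H (\<phi> x) (\<phi> y)"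
    "\<And>x y. x \<in> pverts G \<Longrightarrow> y \<in> pverts G \<Longrightarrow> arc_rel H (\<phi> x) (\<phi> y) \<Longrightarrow> arc_rel G x y"
    using iso_rel[OF GH] by metis
  obtain \<psi> where \<psi>: "bij_betw \<psi> (pverts H) (pverts G)" "\<And>x y. arc_rel H x y \<Longrightarrow> arc_rel G (\<psi> x) (\<psi> y)"
    using iso_rel[OF HG] by metis
  have v: "arc_rel G x y \<Longrightarrow> x \<in> pverts G \<and> y \<in> pverts G" for x y
    using pair_wf_digraph.in_arcsD1[OF pair_graph_wf[OF GH(1)]] pair_wf_digraph.in_arcsD2[OF pair_graph_wf[OF GH(1)]]
    unfolding arc_rel_def by blast
  have i: "\<phi> x = \<phi> y \<longleftrightarrow> x = y" if "x \<in> pverts G" "y \<in> pverts G" for x y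
    using that \<phi>(1) by (metis bij_betw_inv_into_left)
  show "\<not> C5_colourable G"
  proof
    assume "C5_colourable G"
    then obtain f where "\<forall>x y. arc_rel G x y \<longrightarrow> adj (f x) (f y)" using C5_colourable_iff pair_graph_wf[OF GH(1)] by blast
    then have "C5_colourable H" unfolding C5_colourable_iff[OF pair_graph_wf[OF GH(2)]]
      using \<psi>(2) by (intro exI[of _ "\<lambda>x. f (\<psi> x)"]) blast
    then show False using H by blast
  qed
  show "\<exists>w. (x, w) \<in> parcs G" if x: "x \<in> pverts G" for x
  proof -
    have "\<phi> x \<in> pverts H" using \<phi>(1) x by (auto simp: bij_betw_def)
    then obtain w where w: "(\<phi> x, w) \<in> parcs H" using iso by blast
    then have "w \<in> \<phi> ` pverts G"
      using \<phi>(1) pair_wf_digraph.in_arcsD2[OF pair_graph_wf[OF GH(2)]] by (auto simp: bij_betw_def)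
    then show ?thesis using \<phi>(3) x w unfolding arc_rel_def by blast
  qed
  show "\<exists>f. \<forall>a b. arc_rel G a b \<longrightarrow> {a, b} \<noteq> {x, y} \<longrightarrow> adj (f a) (f b)" if xy: "arc_rel G x y" for x y
  proof -
    obtain f where f: "\<forall>a b. arc_rel H a b \<longrightarrow> {a, b} \<noteq> {\<phi> x, \<phi> y} \<longrightarrow> adj (f a) (f b)"
      using ec[OF \<phi>(2)[OF xy]] by blast
    have "adj (f (\<phi> a)) (f (\<phi> b))" if ab: "arc_rel G a b" "{a, b} \<noteq> {x, y}" for a b
    proof -
      have "{\<phi> a, \<phi> b} \<noteq> {\<phi> x, \<phi> y}" using ab v[OF xy] v[OF ab(1)] i by (simp add: doubleton_eq_iff)
      then show ?thesis using f \<phi>(2)[OF ab(1)] by blast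
    qed
    then show ?thesis by (intro exI[of _ "\<lambda>a. f (\<phi> a)"]) blast
  qed
qed

section \<open>The graphs \<open>E1\<close>, \<open>E2\<close> and \<open>E3\<close>\<close>

text \<open>The form of criticality that is checked on the explicit graphs and then used both ways:
  to recognise an embedded copy and to transfer criticality to isomorphic graphs.\<close>

definition edge_critical :: "'a pair_pre_digraph \<Rightarrow> bool" where
  "edge_critical H \<longleftrightarrow> pair_graph H \<and> (\<forall>v\<in>pverts H. \<exists>w. (v, w) \<in> parcs H) \<and> \<not> C5_colourable H \<and>
    (\<forall>x y. arc_rel H x y \<longrightarrow> (\<exists>f. \<forall>a b. arc_rel H a b \<longrightarrow> {a, b} \<noteq> {x, y} \<longrightarrow> adj (f a) (f b)))"

lemma edge_critical_symcl:
  assumes G: "G = \<lparr>pverts = V, parcs = A\<^sup>s\<rparr>" and A: "finite V" "A \<subseteq> V \<times> V" "\<And>x. (x, x) \<notin> A"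
    and iso: "\<And>v. v \<in> V \<Longrightarrow> \<exists>w. (v, w) \<in> A \<or> (w, v) \<in> A"
    and nc: "\<And>f. \<exists>(a, b)\<in>A. \<not> adj (f a) (f b)"
    and ec: "\<And>e. e \<in> A \<Longrightarrow> \<exists>f. \<forall>(a, b)\<in>A. (a, b) \<noteq> e \<longrightarrow> adj (f a) (f b)"
  shows "edge_critical G"
proof -
  have pg: "pair_graph G" unfolding G by (rule pair_graph_symcl[OF A])
  have rel: "arc_rel G x y \<longleftrightarrow> (x, y) \<in> A \<or> (y, x) \<in> A" for x y
    unfolding arc_rel_def G by (auto simp: symcl_def)
  have "\<exists>w. (v, w) \<in> parcs G" if "v \<in> pverts G" for v
    using iso[of v] that rel unfolding arc_rel_def G by auto
  moreover have "\<not> C5_colourable G"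
    unfolding C5_colourable_iff[OF pair_graph_wf[OF pg]] rel using nc by blast
  moreover have "\<exists>f. \<forall>a b. arc_rel G a b \<longrightarrow> {a, b} \<noteq> {x, y} \<longrightarrow> adj (f a) (f b)" if xy: "arc_rel G x y" for x y
  proof -
    obtain e where e: "e \<in> A" "e = (x, y) \<or> e = (y, x)" using xy rel by blast
    then obtain f where f: "\<forall>(a, b)\<in>A. (a, b) \<noteq> e \<longrightarrow> adj (f a) (f b)" using ec by blast
    have "adj (f a) (f b)" if "arc_rel G a b" "{a, b} \<noteq> {x, y}" for a b
    proof -
      have "(a, b) \<noteq> e" "(b, a) \<noteq> e" using that e by auto
      then show ?thesis using f that(1) rel adj_sym by (metis (mono_tags, lifting) case_prodD)
    qed
    then show ?thesis by blast
  qed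
  ultimately show ?thesis unfolding edge_critical_def using pg by blast
qed

lemma arc_rel_sym: "pair_graph H \<Longrightarrow> arc_rel H x y \<Longrightarrow> arc_rel H y x"
  unfolding arc_rel_def by (rule pair_graph_symD)

lemma evertex_map_simps [simp]:
  "evertex_map v1 v2 v3 v4 v5 u2 u3 u4 m (Ev 1) = v1" "evertex_map v1 v2 v3 v4 v5 u2 u3 u4 m (Ev (Suc 0)) = v1"
  "evertex_map v1 v2 v3 v4 v5 u2 u3 u4 m (Ev 2) = v2" "evertex_map v1 v2 v3 v4 v5 u2 u3 u4 m (Ev 3) = v3"
  "evertex_map v1 v2 v3 v4 v5 u2 u3 u4 m (Ev 4) = v4" "evertex_map v1 v2 v3 v4 v5 u2 u3 u4 m (Ev 5) = v5"
  "evertex_map v1 v2 v3 v4 v5 u2 u3 u4 m (Eu 2) = u2" "evertex_map v1 v2 v3 v4 v5 u2 u3 u4 m (Eu 3) = u3"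
  "evertex_map v1 v2 v3 v4 v5 u2 u3 u4 m (Eu 4) = u4" "evertex_map v1 v2 v3 v4 v5 u2 u3 u4 m Em = m"
  by (simp_all add: evertex_map_def)

lemma embeds_H3D:
  assumes "embeds H3_graph E" "\<And>x y. E x y \<Longrightarrow> E y x"
  obtains u v w x a b c d where "E u v" "E v w" "E w x" "E u a" "E u b" "E x c" "E x d" "distinct [u, v, w, x, a, b, c, d]"
proof -
  obtain \<phi> where \<phi>: "inj_on \<phi> {..<8 :: nat}"
    "\<forall>(a, b)\<in>{(0, 1), (1, 2), (2, 3), (0, 4), (0, 5), (3, 6), (3, 7)}\<^sup>s. E (\<phi> a) (\<phi> b)"
    using assms(1) unfolding embeds_def H3_graph_def by auto
  have "distinct (map \<phi> [0..<8])" using \<phi>(1) by (simp add: distinct_map atLeast0LessThan)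
  moreover have "[0..<8] = [0, 1, 2, 3, 4, 5, 6, 7 :: nat]" by (simp add: upt_rec)
  ultimately have "distinct [\<phi> 0, \<phi> 1, \<phi> 2, \<phi> 3, \<phi> 4, \<phi> 5, \<phi> 6, \<phi> 7]" by simp
  moreover have "\<forall>(a, b)\<in>{(0, 1), (1, 2), (2, 3), (0, 4), (0, 5), (3, 6), (3, 7)}. E (\<phi> a) (\<phi> b)"
    by (rule iffD1[OF symcl_ball[of E] \<phi>(2)]) (rule assms(2))
  ultimately show thesis by (intro that[of "\<phi> 0" "\<phi> 1" "\<phi> 2" "\<phi> 3" "\<phi> 4" "\<phi> 5" "\<phi> 6" "\<phi> 7"]) auto
qed

lemma embeds_H3I:
  assumes "\<And>x y. E x y \<Longrightarrow> E y x" "E u v" "E v w" "E w x" "E u a" "E u b" "E x c" "E x d" "distinct [u, v, w, x, a, b, c, d]"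
  shows "embeds H3_graph E"
  unfolding embeds_def
proof (intro exI conjI)
  let ?f = "\<lambda>i. [u, v, w, x, a, b, c, d] ! i"
  show "inj_on ?f (pverts H3_graph)"
    by (rule inj_on_nth) (use assms(9) in \<open>auto simp: H3_graph_def\<close>)
  show "\<forall>(a, b)\<in>parcs H3_graph. E (?f a) (?f b)"
    using assms by (simp add: H3_graph_def symcl_ball)
qed

lemma E1_graph_eq: "E1_graph = \<lparr>pverts = {Ev 1, Ev 2, Ev 3, Ev 4, Ev 5, Eu 2, Eu 3, Eu 4, Em},
    parcs = {(Ev 1, Ev 2), (Ev 2, Ev 3), (Ev 3, Ev 4), (Ev 4, Ev 5), (Ev 5, Ev 1), (Ev 1, Eu 2), (Eu 2, Eu 3), (Eu 3, Eu 4), (Eu 4, Ev 5), (Ev 3, Em), (Em, Eu 4)}\<^sup>s\<rparr>"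
  unfolding E1_graph_def E_base_def pair_pre_digraph.simps symcl_Un[symmetric] by (simp add: insert_commute)

lemma arc_rel_E1:
  "arc_rel E1_graph (Ev 1) y \<longleftrightarrow> y = Ev 2 \<or> y = Eu 2 \<or> y = Ev 5"
  "arc_rel E1_graph (Ev 2) y \<longleftrightarrow> y = Ev 3 \<or> y = Ev 1"
  "arc_rel E1_graph (Ev 3) y \<longleftrightarrow> y = Ev 4 \<or> y = Em \<or> y = Ev 2"
  "arc_rel E1_graph (Ev 4) y \<longleftrightarrow> y = Ev 5 \<or> y = Ev 3"
  "arc_rel E1_graph (Ev 5) y \<longleftrightarrow> y = Ev 1 \<or> y = Ev 4 \<or> y = Eu 4"
  "arc_rel E1_graph (Eu 2) y \<longleftrightarrow> y = Eu 3 \<or> y = Ev 1"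
  "arc_rel E1_graph (Eu 3) y \<longleftrightarrow> y = Eu 4 \<or> y = Eu 2"
  "arc_rel E1_graph (Eu 4) y \<longleftrightarrow> y = Ev 5 \<or> y = Eu 3 \<or> y = Em"
  "arc_rel E1_graph (Em) y \<longleftrightarrow> y = Eu 4 \<or> y = Ev 3"
  unfolding arc_rel_def E1_graph_eq by (auto simp: symcl_def)

lemmas arc_rel_E1_simps = arc_rel_E1[unfolded One_nat_def]

lemma arc_rel_E1_vert:
  "arc_rel E1_graph x y \<Longrightarrow> x = Ev 1 \<or> x = Ev 2 \<or> x = Ev 3 \<or> x = Ev 4 \<or> x = Ev 5 \<or> x = Eu 2 \<or> x = Eu 3 \<or> x = Eu 4 \<or> x = Em"
  unfolding arc_rel_def E1_graph_eq by (auto simp: symcl_def)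

lemma E1_edge_critical: "edge_critical E1_graph"
proof (rule edge_critical_symcl[OF E1_graph_eq])
  let ?A = "{(Ev 1, Ev 2), (Ev 2, Ev 3), (Ev 3, Ev 4), (Ev 4, Ev 5), (Ev 5, Ev 1), (Ev 1, Eu 2), (Eu 2, Eu 3), (Eu 3, Eu 4), (Eu 4, Ev 5), (Ev 3, Em), (Em, Eu 4)}"
  show "\<exists>(a, b)\<in>?A. \<not> adj (f a) (f b)" for f
  proof (rule ccontr)
    assume "\<not> (\<exists>(a, b)\<in>?A. \<not> adj (f a) (f b))"
    then have f: "adj (f (Ev 1)) (f (Ev 2))" "adj (f (Ev 2)) (f (Ev 3))" "adj (f (Ev 3)) (f (Ev 4))" "adj (f (Ev 4)) (f (Ev 5))" "adj (f (Ev 5)) (f (Ev 1))" "adj (f (Ev 1)) (f (Eu 2))" "adj (f (Eu 2)) (f (Eu 3))" "adj (f (Eu 3)) (f (Eu 4))" "adj (f (Eu 4)) (f (Ev 5))" "adj (f (Ev 3)) (f (Em))" "adj (f (Em)) (f (Eu 4))" by auto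
    \<comment> \<open>Paths of length two and three become conditions on their ends. A colour
      adjacent to neither end of an edge is the one opposite to it, so the colours of
      \<open>Ev 3\<close> and \<open>Ev 5\<close> force the same colour on \<open>Ev 1\<close> and
      \<open>Eu 4\<close>.\<close>
    have "\<not> adj (f (Ev 1)) (f (Ev 3))" "\<not> adj (f (Ev 3)) (f (Ev 5))" "\<not> adj (f (Ev 3)) (f (Eu 4))" "f (Ev 1) \<noteq> f (Eu 4)"
      using walk2[of "f (Ev 1)" "f (Ev 3)"] walk2[of "f (Ev 3)" "f (Ev 5)"] walk2[of "f (Ev 3)" "f (Eu 4)"]
        walk3[of "f (Ev 1)" "f (Eu 4)"] f by blast+
    moreover have "\<forall>p q r s. adj q p \<and> adj s q \<and> \<not> adj p r \<and> \<not> adj r q \<and> \<not> adj r s \<longrightarrow> p = s"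
      unfolding all_col by simp
    ultimately show False using f by blast
  qed
  let ?P = "\<lambda>e. \<exists>f. \<forall>(a, b)\<in>?A. (a, b) \<noteq> e \<longrightarrow> adj (f a) (f b)"
  \<comment> \<open>One colouring per deleted edge; the arguments are the colours of the vertices in
    the order of \<open>evertex_map\<close>.\<close>
  have c1: "?P (Ev 1, Ev 2)" by (rule exI[of _ "evertex_map C0 C0 C1 C0 C4 C1 C2 C3 C2"]) simp
  have c2: "?P (Ev 2, Ev 3)" by (rule exI[of _ "evertex_map C0 C1 C1 C0 C4 C1 C2 C3 C2"]) simp
  have c3: "?P (Ev 3, Ev 4)" by (rule exI[of _ "evertex_map C0 C1 C0 C0 C1 C4 C3 C2 C1"]) simp
  have c4: "?P (Ev 4, Ev 5)" by (rule exI[of _ "evertex_map C0 C1 C0 C1 C1 C4 C3 C2 C1"]) simp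
  have c5: "?P (Ev 5, Ev 1)" by (rule exI[of _ "evertex_map C0 C1 C0 C1 C2 C1 C2 C3 C4"]) simp
  have c6: "?P (Ev 1, Eu 2)" by (rule exI[of _ "evertex_map C0 C1 C2 C3 C4 C0 C1 C0 C1"]) simp
  have c7: "?P (Eu 2, Eu 3)" by (rule exI[of _ "evertex_map C0 C1 C2 C3 C4 C1 C1 C0 C1"]) simp
  have c8: "?P (Eu 3, Eu 4)" by (rule exI[of _ "evertex_map C0 C1 C2 C3 C4 C1 C0 C0 C1"]) simp
  have c9: "?P (Eu 4, Ev 5)" by (rule exI[of _ "evertex_map C0 C1 C2 C3 C4 C1 C0 C4 C3"]) simp
  have c10: "?P (Ev 3, Em)" by (rule exI[of _ "evertex_map C0 C1 C2 C3 C4 C1 C2 C3 C2"]) simp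
  have c11: "?P (Em, Eu 4)" by (rule exI[of _ "evertex_map C0 C1 C2 C3 C4 C1 C2 C3 C1"]) simp
  show "?P e" if "e \<in> ?A" for e
    using that unfolding insert_iff empty_iff by (elim disjE FalseE; simp only: c1 c2 c3 c4 c5 c6 c7 c8 c9 c10 c11)
qed auto

text \<open>The ends of the path in an \<open>H3\<close> have degree three and disjoint closed
  neighbourhoods, whereas those of any two cubic vertices of \<open>E1_graph\<close> meet.\<close>

lemma E1_H3_free: "\<not> embeds H3_graph (arc_rel E1_graph)"
proof
  let ?E = "arc_rel E1_graph"
  have pg: "pair_graph E1_graph" using E1_edge_critical unfolding edge_critical_def by blast
  assume "embeds H3_graph ?E"
  then obtain u v w x a b c d where h: "?E u v" "?E w x" "?E u a" "?E u b" "?E x c" "?E x d" "?E x w"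
      "distinct [u, v, w, x, a, b, c, d]"
    using arc_rel_sym[OF pg] by (elim embeds_H3D) blast+
  have br: "(u, {v, a, b}) \<in> {(Ev 1, {Ev 2, Eu 2, Ev 5}), (Ev 3, {Ev 4, Em, Ev 2}), (Ev 5, {Ev 1, Ev 4, Eu 4}), (Eu 4, {Ev 5, Eu 3, Em})}"
    if "?E u v" "?E u a" "?E u b" "distinct [v, a, b]" for u v a b
    using arc_rel_E1_vert[OF that(1)] that by (elim disjE) (auto simp: arc_rel_E1_simps)
  have meet: "insert u P \<inter> insert x Q \<noteq> {}"
    if "(u, P) \<in> {(Ev 1, {Ev 2, Eu 2, Ev 5}), (Ev 3, {Ev 4, Em, Ev 2}), (Ev 5, {Ev 1, Ev 4, Eu 4}), (Eu 4, {Ev 5, Eu 3, Em})}" "(x, Q) \<in> {(Ev 1, {Ev 2, Eu 2, Ev 5}), (Ev 3, {Ev 4, Em, Ev 2}), (Ev 5, {Ev 1, Ev 4, Eu 4}), (Eu 4, {Ev 5, Eu 3, Em})}" "u \<noteq> x" for u x P Q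
    using that unfolding insert_iff empty_iff prod.inject by (elim disjE conjE FalseE) simp_all
  have "distinct [v, a, b]" "distinct [w, c, d]" "u \<noteq> x" using h(8) by simp_all
  then have "insert u {v, a, b} \<inter> insert x {w, c, d} \<noteq> {}" using meet[OF br[OF h(1,3,4)] br[OF h(7,5,6)]] by blast
  moreover have "insert u {v, a, b} \<inter> insert x {w, c, d} = {}" using h(8) by auto
  ultimately show False by contradiction
qed

lemma E1_girth: "\<not> has_C3 (arc_rel E1_graph)" "\<not> has_C4 (arc_rel E1_graph)" "has_C5 (arc_rel E1_graph)"
proof -
  show "\<not> has_C3 (arc_rel E1_graph)" unfolding has_C3_def
  proof clarify
    fix a b c assume h: "arc_rel E1_graph a b" "arc_rel E1_graph b c" "arc_rel E1_graph c a"
    show False using arc_rel_E1_vert[OF h(1)] h by (elim disjE) (auto simp: arc_rel_E1_simps)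
  qed
  show "\<not> has_C4 (arc_rel E1_graph)" unfolding has_C4_def
  proof clarify
    fix a b c d assume h: "arc_rel E1_graph a b" "arc_rel E1_graph b c" "arc_rel E1_graph c d" "arc_rel E1_graph d a"
      "a \<noteq> c" "b \<noteq> d"
    show False using arc_rel_E1_vert[OF h(1)] h by (elim disjE) (auto simp: arc_rel_E1_simps)
  qed
  show "has_C5 (arc_rel E1_graph)" unfolding has_C5_def
    by (rule exI[of _ "Ev 1"], rule exI[of _ "Ev 2"], rule exI[of _ "Ev 3"], rule exI[of _ "Ev 4"], rule exI[of _ "Ev 5"]) (simp add: arc_rel_E1_simps)
qed

lemma E2_graph_eq: "E2_graph = \<lparr>pverts = {Ev 1, Ev 2, Ev 3, Ev 4, Ev 5, Eu 2, Eu 3, Eu 4},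
    parcs = {(Ev 1, Ev 2), (Ev 2, Ev 3), (Ev 3, Ev 4), (Ev 4, Ev 5), (Ev 5, Ev 1), (Ev 1, Eu 2), (Eu 2, Eu 3), (Eu 3, Eu 4), (Eu 4, Ev 5), (Ev 3, Eu 3)}\<^sup>s\<rparr>"
  unfolding E2_graph_def E_base_def pair_pre_digraph.simps symcl_Un[symmetric] by (simp add: insert_commute)

lemma arc_rel_E2:
  "arc_rel E2_graph (Ev 1) y \<longleftrightarrow> y = Ev 2 \<or> y = Eu 2 \<or> y = Ev 5"
  "arc_rel E2_graph (Ev 2) y \<longleftrightarrow> y = Ev 3 \<or> y = Ev 1"
  "arc_rel E2_graph (Ev 3) y \<longleftrightarrow> y = Ev 4 \<or> y = Eu 3 \<or> y = Ev 2"
  "arc_rel E2_graph (Ev 4) y \<longleftrightarrow> y = Ev 5 \<or> y = Ev 3"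
  "arc_rel E2_graph (Ev 5) y \<longleftrightarrow> y = Ev 1 \<or> y = Ev 4 \<or> y = Eu 4"
  "arc_rel E2_graph (Eu 2) y \<longleftrightarrow> y = Eu 3 \<or> y = Ev 1"
  "arc_rel E2_graph (Eu 3) y \<longleftrightarrow> y = Eu 4 \<or> y = Eu 2 \<or> y = Ev 3"
  "arc_rel E2_graph (Eu 4) y \<longleftrightarrow> y = Ev 5 \<or> y = Eu 3"
  unfolding arc_rel_def E2_graph_eq by (auto simp: symcl_def)

lemmas arc_rel_E2_simps = arc_rel_E2[unfolded One_nat_def]

lemma arc_rel_E2_vert:
  "arc_rel E2_graph x y \<Longrightarrow> x = Ev 1 \<or> x = Ev 2 \<or> x = Ev 3 \<or> x = Ev 4 \<or> x = Ev 5 \<or> x = Eu 2 \<or> x = Eu 3 \<or> x = Eu 4"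
  unfolding arc_rel_def E2_graph_eq by (auto simp: symcl_def)

lemma E2_edge_critical: "edge_critical E2_graph"
proof (rule edge_critical_symcl[OF E2_graph_eq])
  let ?A = "{(Ev 1, Ev 2), (Ev 2, Ev 3), (Ev 3, Ev 4), (Ev 4, Ev 5), (Ev 5, Ev 1), (Ev 1, Eu 2), (Eu 2, Eu 3), (Eu 3, Eu 4), (Eu 4, Ev 5), (Ev 3, Eu 3)}"
  show "\<exists>(a, b)\<in>?A. \<not> adj (f a) (f b)" for f
  proof (rule ccontr)
    assume "\<not> (\<exists>(a, b)\<in>?A. \<not> adj (f a) (f b))"
    then have f: "adj (f (Ev 1)) (f (Ev 2))" "adj (f (Ev 2)) (f (Ev 3))" "adj (f (Ev 3)) (f (Ev 4))" "adj (f (Ev 4)) (f (Ev 5))" "adj (f (Ev 5)) (f (Ev 1))" "adj (f (Ev 1)) (f (Eu 2))" "adj (f (Eu 2)) (f (Eu 3))" "adj (f (Eu 3)) (f (Eu 4))" "adj (f (Eu 4)) (f (Ev 5))" "adj (f (Ev 3)) (f (Eu 3))" by auto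
    \<comment> \<open>The colour of \<open>Ev 3\<close> is opposite to the edge \<open>Ev 1\<close>,
      \<open>Ev 5\<close>, so the colour of its neighbour \<open>Eu 3\<close> is adjacent to that of
      \<open>Ev 1\<close> or \<open>Ev 5\<close>, against the paths through \<open>Eu 2\<close> and
      \<open>Eu 4\<close>.\<close>
    have "\<not> adj (f (Ev 1)) (f (Ev 3))" "\<not> adj (f (Ev 3)) (f (Ev 5))" "\<not> adj (f (Ev 1)) (f (Eu 3))" "\<not> adj (f (Eu 3)) (f (Ev 5))"
      using walk2[of "f (Ev 1)" "f (Ev 3)"] walk2[of "f (Ev 3)" "f (Ev 5)"] walk2[of "f (Ev 1)" "f (Eu 3)"]
        walk2[of "f (Eu 3)" "f (Ev 5)"] f by blast+
    moreover have "\<forall>p q r s. adj q p \<and> adj r s \<and> \<not> adj p r \<and> \<not> adj r q \<longrightarrow> adj p s \<or> adj s q"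
      unfolding all_col by simp
    ultimately show False using f by blast
  qed
  let ?P = "\<lambda>e. \<exists>f. \<forall>(a, b)\<in>?A. (a, b) \<noteq> e \<longrightarrow> adj (f a) (f b)"
  have c1: "?P (Ev 1, Ev 2)" by (rule exI[of _ "evertex_map C0 C0 C1 C0 C4 C1 C2 C3 C0"]) simp
  have c2: "?P (Ev 2, Ev 3)" by (rule exI[of _ "evertex_map C0 C1 C1 C0 C4 C1 C2 C3 C0"]) simp
  have c3: "?P (Ev 3, Ev 4)" by (rule exI[of _ "evertex_map C0 C1 C2 C0 C1 C4 C3 C2 C0"]) simp
  have c4: "?P (Ev 4, Ev 5)" by (rule exI[of _ "evertex_map C0 C1 C2 C1 C1 C4 C3 C2 C0"]) simp
  have c5: "?P (Ev 5, Ev 1)" by (rule exI[of _ "evertex_map C0 C1 C2 C1 C0 C4 C3 C4 C0"]) simp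
  have c6: "?P (Ev 1, Eu 2)" by (rule exI[of _ "evertex_map C0 C1 C2 C3 C4 C0 C1 C0 C0"]) simp
  have c7: "?P (Eu 2, Eu 3)" by (rule exI[of _ "evertex_map C0 C1 C2 C3 C4 C1 C1 C0 C0"]) simp
  have c8: "?P (Eu 3, Eu 4)" by (rule exI[of _ "evertex_map C0 C1 C2 C3 C4 C4 C3 C0 C0"]) simp
  have c9: "?P (Eu 4, Ev 5)" by (rule exI[of _ "evertex_map C0 C1 C2 C3 C4 C4 C3 C2 C0"]) simp
  have c10: "?P (Ev 3, Eu 3)" by (rule exI[of _ "evertex_map C0 C1 C2 C3 C4 C1 C2 C3 C0"]) simp
  show "?P e" if "e \<in> ?A" for e
    using that unfolding insert_iff empty_iff by (elim disjE FalseE; simp only: c1 c2 c3 c4 c5 c6 c7 c8 c9 c10)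
qed auto

lemma E2_H3_free: "\<not> embeds H3_graph (arc_rel E2_graph)"
proof
  let ?E = "arc_rel E2_graph"
  have pg: "pair_graph E2_graph" using E2_edge_critical unfolding edge_critical_def by blast
  assume "embeds H3_graph ?E"
  then obtain u v w x a b c d where h: "?E u v" "?E w x" "?E u a" "?E u b" "?E x c" "?E x d" "?E x w"
      "distinct [u, v, w, x, a, b, c, d]"
    using arc_rel_sym[OF pg] by (elim embeds_H3D) blast+
  have br: "(u, {v, a, b}) \<in> {(Ev 1, {Ev 2, Eu 2, Ev 5}), (Ev 3, {Ev 4, Eu 3, Ev 2}), (Ev 5, {Ev 1, Ev 4, Eu 4}), (Eu 3, {Eu 4, Eu 2, Ev 3})}"
    if "?E u v" "?E u a" "?E u b" "distinct [v, a, b]" for u v a b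
    using arc_rel_E2_vert[OF that(1)] that by (elim disjE) (auto simp: arc_rel_E2_simps)
  have meet: "insert u P \<inter> insert x Q \<noteq> {}"
    if "(u, P) \<in> {(Ev 1, {Ev 2, Eu 2, Ev 5}), (Ev 3, {Ev 4, Eu 3, Ev 2}), (Ev 5, {Ev 1, Ev 4, Eu 4}), (Eu 3, {Eu 4, Eu 2, Ev 3})}" "(x, Q) \<in> {(Ev 1, {Ev 2, Eu 2, Ev 5}), (Ev 3, {Ev 4, Eu 3, Ev 2}), (Ev 5, {Ev 1, Ev 4, Eu 4}), (Eu 3, {Eu 4, Eu 2, Ev 3})}" "u \<noteq> x" for u x P Q
    using that unfolding insert_iff empty_iff prod.inject by (elim disjE conjE FalseE) simp_all
  have "distinct [v, a, b]" "distinct [w, c, d]" "u \<noteq> x" using h(8) by simp_all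
  then have "insert u {v, a, b} \<inter> insert x {w, c, d} \<noteq> {}" using meet[OF br[OF h(1,3,4)] br[OF h(7,5,6)]] by blast
  moreover have "insert u {v, a, b} \<inter> insert x {w, c, d} = {}" using h(8) by auto
  ultimately show False by contradiction
qed

lemma E2_girth: "\<not> has_C3 (arc_rel E2_graph)" "\<not> has_C4 (arc_rel E2_graph)" "has_C5 (arc_rel E2_graph)"
proof -
  show "\<not> has_C3 (arc_rel E2_graph)" unfolding has_C3_def
  proof clarify
    fix a b c assume h: "arc_rel E2_graph a b" "arc_rel E2_graph b c" "arc_rel E2_graph c a"
    show False using arc_rel_E2_vert[OF h(1)] h by (elim disjE) (auto simp: arc_rel_E2_simps)
  qed
  show "\<not> has_C4 (arc_rel E2_graph)" unfolding has_C4_def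
  proof clarify
    fix a b c d assume h: "arc_rel E2_graph a b" "arc_rel E2_graph b c" "arc_rel E2_graph c d" "arc_rel E2_graph d a"
      "a \<noteq> c" "b \<noteq> d"
    show False using arc_rel_E2_vert[OF h(1)] h by (elim disjE) (auto simp: arc_rel_E2_simps)
  qed
  show "has_C5 (arc_rel E2_graph)" unfolding has_C5_def
    by (rule exI[of _ "Ev 1"], rule exI[of _ "Ev 2"], rule exI[of _ "Ev 3"], rule exI[of _ "Ev 4"], rule exI[of _ "Ev 5"]) (simp add: arc_rel_E2_simps)
qed

lemma E3_graph_eq: "E3_graph = \<lparr>pverts = {Ev 1, Ev 2, Ev 3, Ev 4, Ev 5, Eu 2, Eu 3, Eu 4},
    parcs = {(Ev 1, Ev 2), (Ev 2, Ev 3), (Ev 3, Ev 4), (Ev 4, Ev 5), (Ev 5, Ev 1), (Ev 1, Eu 2), (Eu 2, Eu 3), (Eu 3, Eu 4), (Eu 4, Ev 5), (Ev 2, Eu 4)}\<^sup>s\<rparr>"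
  unfolding E3_graph_def E_base_def pair_pre_digraph.simps symcl_Un[symmetric] by (simp add: insert_commute)

lemma arc_rel_E3:
  "arc_rel E3_graph (Ev 1) y \<longleftrightarrow> y = Ev 2 \<or> y = Eu 2 \<or> y = Ev 5"
  "arc_rel E3_graph (Ev 2) y \<longleftrightarrow> y = Ev 3 \<or> y = Eu 4 \<or> y = Ev 1"
  "arc_rel E3_graph (Ev 3) y \<longleftrightarrow> y = Ev 4 \<or> y = Ev 2"
  "arc_rel E3_graph (Ev 4) y \<longleftrightarrow> y = Ev 5 \<or> y = Ev 3"
  "arc_rel E3_graph (Ev 5) y \<longleftrightarrow> y = Ev 1 \<or> y = Ev 4 \<or> y = Eu 4"
  "arc_rel E3_graph (Eu 2) y \<longleftrightarrow> y = Eu 3 \<or> y = Ev 1"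
  "arc_rel E3_graph (Eu 3) y \<longleftrightarrow> y = Eu 4 \<or> y = Eu 2"
  "arc_rel E3_graph (Eu 4) y \<longleftrightarrow> y = Ev 5 \<or> y = Eu 3 \<or> y = Ev 2"
  unfolding arc_rel_def E3_graph_eq by (auto simp: symcl_def)

lemmas arc_rel_E3_simps = arc_rel_E3[unfolded One_nat_def]

lemma arc_rel_E3_vert:
  "arc_rel E3_graph x y \<Longrightarrow> x = Ev 1 \<or> x = Ev 2 \<or> x = Ev 3 \<or> x = Ev 4 \<or> x = Ev 5 \<or> x = Eu 2 \<or> x = Eu 3 \<or> x = Eu 4"
  unfolding arc_rel_def E3_graph_eq by (auto simp: symcl_def)

lemma E3_edge_critical: "edge_critical E3_graph"
proof (rule edge_critical_symcl[OF E3_graph_eq])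
  let ?A = "{(Ev 1, Ev 2), (Ev 2, Ev 3), (Ev 3, Ev 4), (Ev 4, Ev 5), (Ev 5, Ev 1), (Ev 1, Eu 2), (Eu 2, Eu 3), (Eu 3, Eu 4), (Eu 4, Ev 5), (Ev 2, Eu 4)}"
  show "\<exists>(a, b)\<in>?A. \<not> adj (f a) (f b)" for f
  proof (rule ccontr)
    assume "\<not> (\<exists>(a, b)\<in>?A. \<not> adj (f a) (f b))"
    then have f: "adj (f (Ev 1)) (f (Ev 2))" "adj (f (Ev 2)) (f (Ev 3))" "adj (f (Ev 3)) (f (Ev 4))" "adj (f (Ev 4)) (f (Ev 5))" "adj (f (Ev 5)) (f (Ev 1))" "adj (f (Ev 1)) (f (Eu 2))" "adj (f (Eu 2)) (f (Eu 3))" "adj (f (Eu 3)) (f (Eu 4))" "adj (f (Eu 4)) (f (Ev 5))" "adj (f (Ev 2)) (f (Eu 4))" by auto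
    \<comment> \<open>A 4-cycle can only be mapped to \<open>C5\<close> by identifying two opposite
      vertices; here both opposite pairs are joined by paths of length three.\<close>
    have "f (Ev 2) \<noteq> f (Ev 5)" "f (Ev 1) \<noteq> f (Eu 4)"
      using walk3[of "f (Ev 2)" "f (Ev 5)"] walk3[of "f (Ev 1)" "f (Eu 4)"] f by blast+
    moreover have "\<forall>p q r s. adj p q \<and> adj q r \<and> adj r s \<and> adj s p \<longrightarrow> p = r \<or> q = s"
      unfolding all_col by simp
    ultimately show False using f by blast
  qed
  let ?P = "\<lambda>e. \<exists>f. \<forall>(a, b)\<in>?A. (a, b) \<noteq> e \<longrightarrow> adj (f a) (f b)"
  have c1: "?P (Ev 1, Ev 2)" by (rule exI[of _ "evertex_map C0 C2 C1 C0 C4 C1 C2 C3 C0"]) simp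
  have c2: "?P (Ev 2, Ev 3)" by (rule exI[of _ "evertex_map C0 C1 C1 C0 C1 C4 C3 C2 C0"]) simp
  have c3: "?P (Ev 3, Ev 4)" by (rule exI[of _ "evertex_map C0 C1 C0 C0 C1 C4 C3 C2 C0"]) simp
  have c4: "?P (Ev 4, Ev 5)" by (rule exI[of _ "evertex_map C0 C1 C0 C1 C1 C4 C3 C2 C0"]) simp
  have c5: "?P (Ev 5, Ev 1)" by (rule exI[of _ "evertex_map C0 C1 C0 C4 C3 C4 C3 C2 C0"]) simp
  have c6: "?P (Ev 1, Eu 2)" by (rule exI[of _ "evertex_map C0 C1 C2 C3 C4 C0 C1 C0 C0"]) simp
  have c7: "?P (Eu 2, Eu 3)" by (rule exI[of _ "evertex_map C0 C1 C2 C3 C4 C1 C1 C0 C0"]) simp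
  have c8: "?P (Eu 3, Eu 4)" by (rule exI[of _ "evertex_map C0 C1 C2 C3 C4 C1 C0 C0 C0"]) simp
  have c9: "?P (Eu 4, Ev 5)" by (rule exI[of _ "evertex_map C0 C1 C2 C3 C4 C4 C3 C2 C0"]) simp
  have c10: "?P (Ev 2, Eu 4)" by (rule exI[of _ "evertex_map C0 C1 C2 C3 C4 C1 C2 C3 C0"]) simp
  show "?P e" if "e \<in> ?A" for e
    using that unfolding insert_iff empty_iff by (elim disjE FalseE; simp only: c1 c2 c3 c4 c5 c6 c7 c8 c9 c10)
qed auto

lemma E3_H3_free: "\<not> embeds H3_graph (arc_rel E3_graph)"
proof
  let ?E = "arc_rel E3_graph"
  have pg: "pair_graph E3_graph" using E3_edge_critical unfolding edge_critical_def by blast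
  assume "embeds H3_graph ?E"
  then obtain u v w x a b c d where h: "?E u v" "?E w x" "?E u a" "?E u b" "?E x c" "?E x d" "?E x w"
      "distinct [u, v, w, x, a, b, c, d]"
    using arc_rel_sym[OF pg] by (elim embeds_H3D) blast+
  have br: "(u, {v, a, b}) \<in> {(Ev 1, {Ev 2, Eu 2, Ev 5}), (Ev 2, {Ev 3, Eu 4, Ev 1}), (Ev 5, {Ev 1, Ev 4, Eu 4}), (Eu 4, {Ev 5, Eu 3, Ev 2})}"
    if "?E u v" "?E u a" "?E u b" "distinct [v, a, b]" for u v a b
    using arc_rel_E3_vert[OF that(1)] that by (elim disjE) (auto simp: arc_rel_E3_simps)
  have meet: "insert u P \<inter> insert x Q \<noteq> {}"
    if "(u, P) \<in> {(Ev 1, {Ev 2, Eu 2, Ev 5}), (Ev 2, {Ev 3, Eu 4, Ev 1}), (Ev 5, {Ev 1, Ev 4, Eu 4}), (Eu 4, {Ev 5, Eu 3, Ev 2})}" "(x, Q) \<in> {(Ev 1, {Ev 2, Eu 2, Ev 5}), (Ev 2, {Ev 3, Eu 4, Ev 1}), (Ev 5, {Ev 1, Ev 4, Eu 4}), (Eu 4, {Ev 5, Eu 3, Ev 2})}" "u \<noteq> x" for u x P Q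
    using that unfolding insert_iff empty_iff prod.inject by (elim disjE conjE FalseE) simp_all
  have "distinct [v, a, b]" "distinct [w, c, d]" "u \<noteq> x" using h(8) by simp_all
  then have "insert u {v, a, b} \<inter> insert x {w, c, d} \<noteq> {}" using meet[OF br[OF h(1,3,4)] br[OF h(7,5,6)]] by blast
  moreover have "insert u {v, a, b} \<inter> insert x {w, c, d} = {}" using h(8) by auto
  ultimately show False by contradiction
qed

lemma E3_girth: "\<not> has_C3 (arc_rel E3_graph)" "has_C4 (arc_rel E3_graph)"
proof -
  show "\<not> has_C3 (arc_rel E3_graph)" unfolding has_C3_def
  proof clarify
    fix a b c assume h: "arc_rel E3_graph a b" "arc_rel E3_graph b c" "arc_rel E3_graph c a"
    show False using arc_rel_E3_vert[OF h(1)] h by (elim disjE) (auto simp: arc_rel_E3_simps)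
  qed
  show "has_C4 (arc_rel E3_graph)" unfolding has_C4_def
    by (rule exI[of _ "Ev 1"], rule exI[of _ "Ev 2"], rule exI[of _ "Eu 4"], rule exI[of _ "Ev 5"]) (simp add: arc_rel_E3_simps)
qed

section \<open>Flowers\<close>

context
  fixes n :: nat
  assumes n3: "n \<ge> 3"
begin

lemma arc_rel_flower:
  "arc_rel (flower n) x y \<longleftrightarrow>
    x < 3 * n \<and> y = Suc x mod (3 * n) \<or> y < 3 * n \<and> x = Suc y mod (3 * n) \<or>
    x = 3 * n \<and> y < 3 * n \<and> 3 dvd y \<or> y = 3 * n \<and> x < 3 * n \<and> 3 dvd x"
proof -
  have "{(3 * n, 3 * i) | i. i < n} = {(3 * n, y) | y. y < 3 * n \<and> 3 dvd y}" by auto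
  then show ?thesis unfolding arc_rel_def flower_def cycle_graph_def by (auto simp: symcl_def)
qed

lemma flower_arc_less: "x < 3 * n \<Longrightarrow> Suc x mod (3 * n) = (if Suc x = 3 * n then 0 else Suc x)"
  by auto

lemma flower_foot: "x < 3 * n \<Longrightarrow> 3 dvd x \<Longrightarrow> arc_rel (flower n) x (3 * n)"
  unfolding arc_rel_flower by simp

lemma flower_rim:
  assumes "arc_rel (flower n) x y" "x \<noteq> 3 * n" "y \<noteq> 3 * n"
  shows "x < 3 * n" "y < 3 * n" "y = (if Suc x = 3 * n then 0 else Suc x) \<or> x = (if Suc y = 3 * n then 0 else Suc y)"
proof -
  have "Suc x mod (3 * n) < 3 * n" "Suc y mod (3 * n) < 3 * n" using n3 by auto
  then show *: "x < 3 * n" "y < 3 * n" using assms unfolding arc_rel_flower by auto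
  show "y = (if Suc x = 3 * n then 0 else Suc x) \<or> x = (if Suc y = 3 * n then 0 else Suc y)"
    using assms * flower_arc_less unfolding arc_rel_flower by metis
qed

lemma flower_centre:
  assumes "arc_rel (flower n) x y" "x = 3 * n \<or> y = 3 * n"
  shows "x = 3 * n \<and> y < 3 * n \<and> 3 dvd y \<or> y = 3 * n \<and> x < 3 * n \<and> 3 dvd x"
proof -
  have "Suc x mod (3 * n) < 3 * n" "Suc y mod (3 * n) < 3 * n" using n3 by auto
  then show ?thesis using assms unfolding arc_rel_flower by (metis less_irrefl)
qed

lemma flower_sym: "arc_rel (flower n) x y \<Longrightarrow> arc_rel (flower n) y x"
  unfolding arc_rel_flower by blast

lemma flower_feet_nonadj:
  assumes "arc_rel (flower n) x y" "x \<noteq> 3 * n" "y \<noteq> 3 * n" "3 dvd x" "3 dvd y"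
  shows False
  using flower_rim[OF assms(1-3)] assms(4,5) n3 by (auto split: if_splits; presburger)

lemma flower_unique_foot:
  assumes "arc_rel (flower n) x w" "arc_rel (flower n) y w" "x \<noteq> 3 * n" "y \<noteq> 3 * n" "w \<noteq> 3 * n" "3 dvd x" "3 dvd y"
  shows "x = y"
  using flower_rim[OF assms(1,3,5)] flower_rim[OF assms(2,4,5)] assms(6,7) n3
  by (auto split: if_splits; presburger)

lemma flower_girth:
  "\<not> has_C3 (arc_rel (flower n))" "\<not> has_C4 (arc_rel (flower n))" "has_C5 (arc_rel (flower n))"
proof -
  let ?E = "arc_rel (flower n)"
  show "\<not> has_C3 ?E"
    unfolding has_C3_def
  proof clarify
    \<comment> \<open>A triangle through the centre may be read as starting there.\<close>
    have cen: False if "?E (3 * n) b" "?E b c" "?E c (3 * n)" for b c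
      using flower_centre[OF that(1)] flower_centre[OF that(3)] flower_feet_nonadj[OF that(2)] by auto
    fix a b c assume h: "?E a b" "?E b c" "?E c a"
    show False
    proof (cases "a = 3 * n \<or> b = 3 * n \<or> c = 3 * n")
      case True then show False using cen h by blast
    next
      case False
      then show False using flower_rim[OF h(1)] flower_rim[OF h(2)] flower_rim[OF h(3)] n3
        by (auto split: if_splits)
    qed
  qed
  show "\<not> has_C4 ?E"
    unfolding has_C4_def
  proof clarify
    have cen: False if "?E (3 * n) b" "?E b c" "?E c d" "?E d (3 * n)" "b \<noteq> d" "3 * n \<noteq> c" for b c d
      using flower_centre[OF that(1)] flower_centre[OF that(4)] flower_unique_foot[OF that(2) flower_sym[OF that(3)]] that(5,6)
      by auto
    fix a b c d assume h: "?E a b" "?E b c" "?E c d" "?E d a" "a \<noteq> c" "b \<noteq> d"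
    show False
    proof (cases "a = 3 * n \<or> b = 3 * n \<or> c = 3 * n \<or> d = 3 * n")
      case True then show False using cen h by metis
    next
      case False
      then show False using flower_rim[OF h(1)] flower_rim[OF h(2)] flower_rim[OF h(3)] flower_rim[OF h(4)] h(5,6) n3
        by (auto split: if_splits)
    qed
  qed
  show "has_C5 ?E"
    unfolding has_C5_def
    by (rule exI[of _ "3 * n"], rule exI[of _ 0], rule exI[of _ 1], rule exI[of _ 2], rule exI[of _ 3])
      (use n3 in \<open>auto simp: arc_rel_flower\<close>)
qed

text \<open>A rim vertex of degree three is a foot whose neighbours include the centre, so two such
  ends would both use the centre. If one end is the centre, the path passes through two feet with a
  common rim neighbour, which does not exist as feet are three apart.\<close>

lemma flower_H3_free: "\<not> embeds H3_graph (arc_rel (flower n))"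
proof
  let ?E = "arc_rel (flower n)"
  assume "embeds H3_graph ?E"
  then obtain u v w x a b c d where h: "?E u v" "?E v w" "?E w x" "?E u a" "?E u b" "?E x c" "?E x d"
      "distinct [u, v, w, x, a, b, c, d]"
    using flower_sym by (elim embeds_H3D) blast+
  have foot: "3 dvd u \<and> (v = 3 * n \<or> a = 3 * n \<or> b = 3 * n)"
    if "?E u v" "?E u a" "?E u b" "distinct [v, a, b]" "u \<noteq> 3 * n" for u v a b
  proof -
    have "v = 3 * n \<or> a = 3 * n \<or> b = 3 * n"
    proof (rule ccontr)
      assume "\<not> ?thesis"
      then show False using flower_rim[OF that(1,5)] flower_rim[OF that(2,5)] flower_rim[OF that(3,5)] that(4)
        by (auto split: if_splits)
    qed
    moreover have "3 dvd u" if "?E u (3 * n)" using flower_centre[OF that] \<open>u \<noteq> 3 * n\<close> by auto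
    ultimately show ?thesis using that by auto
  qed
  have cen: False if "?E (3 * n) v" "?E v w" "?E w x" "3 dvd x" "v \<noteq> x" "w \<noteq> 3 * n" "x \<noteq> 3 * n" for v w x
    using flower_centre[OF that(1)] flower_unique_foot[OF that(2) flower_sym[OF that(3)]] that by auto
  have hx: "?E x w" "?E w v" "?E v u" using h flower_sym by blast+
  show False
  proof (cases "u = 3 * n \<or> x = 3 * n")
    case True
    then show False
    proof
      assume "u = 3 * n"
      then show False using cen[of v w x] h foot[OF hx(1) h(6,7)] by auto
    next
      assume "x = 3 * n"
      then show False using cen[of w v u] h hx foot[OF h(1,4,5)] by auto
    qed
  next
    case False
    then show False using foot[OF h(1,4,5)] foot[OF hx(1) h(6,7)] h(8) by auto
  qed
qed

text \<open>
  Consecutive feet receive the two different neighbours of the colour of the centre.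
\<close>

lemma flower_not_colourable:
  assumes "odd n" "\<And>x y. arc_rel (flower n) x y \<Longrightarrow> adj (f x) (f y)"
  shows False
proof -
  \<comment> \<open>The colour of the foot number \<open>i\<close>, read cyclically, so that
    \<open>h n = h 0\<close>.\<close>
  define h where "h = (\<lambda>i. f (3 * i mod (3 * n)))"
  have c: "adj (f (3 * n)) (h i)" for i
  proof -
    have "3 * i mod (3 * n) = 3 * (i mod n)" by (simp only: mult_mod_right)
    then show ?thesis unfolding h_def using n3 flower_sym[OF flower_foot[of "3 * (i mod n)"]]
      by (intro assms(2)) simp
  qed
  have step: "adj (f (k mod (3 * n))) (f (Suc k mod (3 * n)))" for k
    by (rule assms(2)) (use n3 in \<open>auto simp: arc_rel_flower mod_Suc_eq\<close>)
  have ne: "h i \<noteq> h (Suc i)" for i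
  proof -
    have "\<exists>p q. adj (h i) p \<and> adj p q \<and> adj q (h (Suc i))"
      using step[of "3 * i"] step[of "Suc (3 * i)"] step[of "Suc (Suc (3 * i))"] unfolding h_def
      by (auto simp: numeral_3_eq_3)
    then show ?thesis using walk3 by blast
  qed
  have "\<forall>c p q r. adj c p \<and> adj c q \<and> adj c r \<and> p \<noteq> q \<and> q \<noteq> r \<longrightarrow> p = r"
    unfolding all_col by simp
  then have two: "h (Suc (Suc i)) = h i" for i using c ne by metis
  have "h (2 * k) = h 0" for k
  proof (induction k)
    case (Suc k) then show ?case using two[of "2 * k"] by simp
  qed simp
  then have "h (n - 1) = h 0" using \<open>odd n\<close> by (metis oddE add_diff_cancel_right')
  moreover have "h n = h 0" unfolding h_def by simp
  ultimately show False using ne[of "n - 1"] n3 by simp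
qed

text \<open>
  \<open>R\<close> and \<open>S\<close> mark the rim edges and the spokes that may be violated; \<open>F\<close> colours the feet.
\<close>

lemma flower_colouring:
  assumes col: "\<And>j. j < n \<Longrightarrow> S (3 * j) \<or> adj C0 (F j)"
    and seg: "\<And>j. j < n \<Longrightarrow> \<exists>p q. (R (3 * j) \<or> adj (F j) p) \<and> (R (3 * j + 1) \<or> adj p q) \<and> (R (3 * j + 2) \<or> adj q (F (Suc j mod n)))"
  shows "\<exists>g. (\<forall>k<3 * n. R k \<or> adj (g k) (g (Suc k mod (3 * n)))) \<and> (\<forall>j<n. S (3 * j) \<or> adj (g (3 * n)) (g (3 * j)))"
proof -
  obtain P Q where PQ: "\<And>j. j < n \<Longrightarrow> (R (3 * j) \<or> adj (F j) (P j)) \<and> (R (3 * j + 1) \<or> adj (P j) (Q j)) \<and> (R (3 * j + 2) \<or> adj (Q j) (F (Suc j mod n)))"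
    using seg by metis
  define g where "g = (\<lambda>k. if k = 3 * n then C0 else if k mod 3 = 0 then F (k div 3) else if k mod 3 = 1 then P (k div 3) else Q (k div 3))"
  have g: "g (3 * n) = C0" "j < n \<Longrightarrow> g (3 * j) = F j" "g (3 * j + 1) = P j" "g (3 * j + 2) = Q j" for j
  proof -
    have "3 * j + 1 \<noteq> 3 * n" "3 * j + 2 \<noteq> 3 * n" "(3 * j + 1) mod 3 = 1" "(3 * j + 2) mod 3 = 2" 
        "(3 * j + 1) div 3 = j" "(3 * j + 2) div 3 = j" by presburger+
    then show "g (3 * n) = C0" "j < n \<Longrightarrow> g (3 * j) = F j" "g (3 * j + 1) = P j" "g (3 * j + 2) = Q j"
      unfolding g_def by simp_all
  qed
  have "R k \<or> adj (g k) (g (Suc k mod (3 * n)))" if "k < 3 * n" for k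
  proof -
    define j where "j = k div 3"
    have j: "j < n" using that unfolding j_def by auto
    have "k = 3 * j \<or> k = 3 * j + 1 \<or> k = 3 * j + 2" unfolding j_def by presburger
    then consider "k = 3 * j" | "k = 3 * j + 1" | "k = 3 * j + 2" by blast
    then show ?thesis
    proof cases
      case 1
      then have "Suc k mod (3 * n) = 3 * j + 1" using j by simp
      then show ?thesis using PQ[OF j] g j 1 by metis
    next
      case 2
      then have "Suc k mod (3 * n) = 3 * j + 2" using j by simp
      then show ?thesis using PQ[OF j] g j 2 by metis
    next
      case 3
      then have "Suc k = 3 * Suc j" by simp
      then have "Suc k mod (3 * n) = 3 * (Suc j mod n)" by (simp only: mult_mod_right)
      moreover have "Suc j mod n < n" using n3 by simp
      ultimately show ?thesis using PQ[OF j] g(2)[of "Suc j mod n"] g(4)[of j] 3 by metis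
    qed
  qed
  moreover have "S (3 * j) \<or> adj (g (3 * n)) (g (3 * j))" if "j < n" for j
    using col[OF that] g(1) g(2)[OF that] by simp
  ultimately show ?thesis by blast
qed

text \<open>Deleting a rim edge allows the two feet of its petal to agree; deleting a spoke frees
  one foot from the two neighbours of the centre's colour. Either breaks the parity
  obstruction.\<close>

lemma flower_edge_critical:
  assumes "odd n"
  shows "edge_critical (flower n)"
proof -
  let ?A = "{(k, Suc k mod (3 * n)) | k. k < 3 * n} \<union> {(3 * n, 3 * i) | i. i < n}"
  let ?V = "insert (3 * n) {..<3 * n}"
  have A: "(a, b) \<in> ?A \<longleftrightarrow> a < 3 * n \<and> b = Suc a mod (3 * n) \<or> a = 3 * n \<and> (\<exists>i<n. b = 3 * i)" for a b by auto
  have step: "\<exists>p q. adj a p \<and> adj p q \<and> adj q b" if "a \<noteq> b" for a b using walk3 that by blast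
  show ?thesis
  proof (rule edge_critical_symcl)
    show "flower n = \<lparr>pverts = ?V, parcs = ?A\<^sup>s\<rparr>"
      unfolding flower_def cycle_graph_def by (simp add: symcl_Un)
    show "finite ?V" by simp
    show "?A \<subseteq> ?V \<times> ?V" using n3 by auto
    show "(x, x) \<notin> ?A" for x
    proof -
      have "Suc x mod (3 * n) \<noteq> x" if "x < 3 * n" using flower_arc_less[OF that] n3 by auto
      then show ?thesis unfolding A by (auto; metis)
    qed
    show "\<exists>w. (v, w) \<in> ?A \<or> (w, v) \<in> ?A" if "v \<in> ?V" for v
    proof (cases "v = 3 * n")
      case True
      then have "(v, 3 * 0) \<in> ?A" unfolding A using n3 by auto
      then show ?thesis by blast
    next
      case False
      then have "(v, Suc v mod (3 * n)) \<in> ?A" unfolding A using that by auto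
      then show ?thesis by blast
    qed
    show "\<exists>(a, b)\<in>?A. \<not> adj (f a) (f b)" for f
    proof (rule ccontr)
      assume "\<not> ?thesis"
      then have f: "(a, b) \<in> ?A \<Longrightarrow> adj (f a) (f b)" for a b by blast
      have "arc_rel (flower n) x y \<Longrightarrow> (x, y) \<in> ?A \<or> (y, x) \<in> ?A" for x y
        unfolding arc_rel_def flower_def cycle_graph_def by (auto simp: symcl_def)
      then show False using flower_not_colourable[OF assms, of f] f adj_sym by blast
    qed
    show "\<exists>f. \<forall>(a, b)\<in>?A. (a, b) \<noteq> e \<longrightarrow> adj (f a) (f b)" if eA: "e \<in> ?A" for e
    proof -
      consider k where "k < 3 * n" "e = (k, Suc k mod (3 * n))" | i where "i < n" "e = (3 * n, 3 * i)"
        using eA by blast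
      then show ?thesis
      proof cases
        case 1
        define i where "i = k div 3"
        have i: "i < n" "k = 3 * i \<or> k = 3 * i + 1 \<or> k = 3 * i + 2" using 1 unfolding i_def by presburger+
        \<comment> \<open>Feet alternate between \<open>C1\<close> and \<open>C4\<close>, with the
          single repetition placed after foot \<open>i\<close>, at the broken petal; this includes
          the wrap-around if \<open>i = n - 1\<close>.\<close>
        define F where "F = (\<lambda>j. if even j = (j \<le> i) then C1 else C4)"
        have F: "F j \<noteq> F (Suc j mod n)" if "j < n" "j \<noteq> i" for j
        proof (cases "Suc j = n")
          case True
          then show ?thesis unfolding F_def using that i \<open>odd n\<close> by auto
        next
          case False
          then have "Suc j mod n = Suc j" using that by simp
          then show ?thesis unfolding F_def using that by (auto simp: le_Suc_eq not_le)
        qed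
        have Fi: "F (Suc i mod n) = F i"
        proof (cases "Suc i = n")
          case True
          then show ?thesis unfolding F_def using i \<open>odd n\<close> by auto
        next
          case False
          then have "Suc i mod n = Suc i" using i by simp
          then show ?thesis unfolding F_def by auto
        qed
        have two: "\<exists>q. adj a q \<and> adj q a" for a by (metis ex_adj adj_sym)
        have "\<exists>g. (\<forall>l<3 * n. l = k \<or> adj (g l) (g (Suc l mod (3 * n)))) \<and> (\<forall>j<n. False \<or> adj (g (3 * n)) (g (3 * j)))"
        proof (rule flower_colouring[where F = F])
          show "False \<or> adj C0 (F j)" for j unfolding F_def by auto
          fix j assume j: "j < n"
          show "\<exists>p q. (3 * j = k \<or> adj (F j) p) \<and> (3 * j + 1 = k \<or> adj p q) \<and> (3 * j + 2 = k \<or> adj q (F (Suc j mod n)))"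
          proof (cases "j = i")
            case False
            then show ?thesis using step[OF F[OF j False]] by blast
          next
            case True
            then show ?thesis using i(2) Fi two[of "F i"] adj_sym ex_adj by metis
          qed
        qed
        then obtain g where "\<And>l. l < 3 * n \<Longrightarrow> l \<noteq> k \<Longrightarrow> adj (g l) (g (Suc l mod (3 * n)))"
          "\<And>j. j < n \<Longrightarrow> adj (g (3 * n)) (g (3 * j))" by blast
        then show ?thesis using 1(2) by (intro exI[of _ g]) auto
      next
        case 2
        \<comment> \<open>Foot \<open>i\<close> takes the colour \<open>C0\<close> of the centre,
          which differs from \<open>C1\<close> and \<open>C4\<close>; the remaining feet, an even
          number in a row, alternate.\<close>
        define F where "F = (\<lambda>j. if j = i then C0 else if even j = (j < i) then C1 else C4)"
        have F: "F j \<noteq> F (Suc j mod n)" if "j < n" for j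
        proof (cases "Suc j = n")
          case True
          then show ?thesis unfolding F_def using that 2 \<open>odd n\<close> n3 by auto
        next
          case False
          then have "Suc j mod n = Suc j" using that by simp
          then show ?thesis unfolding F_def using that by (auto simp: less_Suc_eq)
        qed
        have "\<exists>g. (\<forall>l<3 * n. False \<or> adj (g l) (g (Suc l mod (3 * n)))) \<and> (\<forall>j<n. 3 * j = 3 * i \<or> adj (g (3 * n)) (g (3 * j)))"
        proof (rule flower_colouring[where F = F])
          show "3 * j = 3 * i \<or> adj C0 (F j)" for j unfolding F_def by auto
          show "\<exists>p q. (False \<or> adj (F j) p) \<and> (False \<or> adj p q) \<and> (False \<or> adj q (F (Suc j mod n)))" if "j < n" for j
            using step[OF F[OF that]] by blast
        qed
        then obtain g where "\<And>l. l < 3 * n \<Longrightarrow> adj (g l) (g (Suc l mod (3 * n)))"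
          "\<And>j. j < n \<Longrightarrow> j \<noteq> i \<Longrightarrow> adj (g (3 * n)) (g (3 * j))" by auto
        then show ?thesis using 2(2) by (intro exI[of _ g]) auto
      qed
    qed
  qed
qed

end

section \<open>Classification\<close>

lemma H3_graph_props: "pair_graph H3_graph" "v \<in> pverts H3_graph \<Longrightarrow> \<exists>w. (v, w) \<in> parcs H3_graph"
proof -
  show "pair_graph H3_graph" unfolding H3_graph_def by (rule pair_graph_symcl) auto
  assume "v \<in> pverts H3_graph"
  then have "v \<in> {0, 1, 2, 3, 4, 5, 6, 7}" unfolding H3_graph_def by auto
  then show "\<exists>w. (v, w) \<in> parcs H3_graph" unfolding H3_graph_def by (auto simp: symcl_def)
qed

lemma H3_free_iff: "pair_graph G \<Longrightarrow> subgraph_free H3_graph G \<longleftrightarrow> \<not> embeds H3_graph (arc_rel G)"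
  using contains_subgraph_iff[OF pair_graph_wf pair_graph_wf[OF H3_graph_props(1)]] H3_graph_props(2) by metis

lemma critical_iso_edge_critical:
  assumes "pair_graph G" "C5_critical G" "edge_critical H" "embeds H (arc_rel G)"
  shows "G \<cong>\<^sub>g H"
proof -
  have "pair_graph H" "\<not> C5_colourable H" "\<And>v. v \<in> pverts H \<Longrightarrow> \<exists>w. (v, w) \<in> parcs H"
    using assms(3) unfolding edge_critical_def by blast+
  from critical_embeds_iso[OF assms(1,2) this assms(4)] show ?thesis .
qed

lemma iso_edge_critical:
  assumes "pair_graph G" "edge_critical H" "\<not> embeds H3_graph (arc_rel H)" "G \<cong>\<^sub>g H"
  shows "subgraph_free H3_graph G" "C5_critical G"
proof -
  have H: "pair_graph H" "\<And>v. v \<in> pverts H \<Longrightarrow> \<exists>w. (v, w) \<in> parcs H" "\<not> C5_colourable H"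
    "\<And>x y. arc_rel H x y \<Longrightarrow> \<exists>f. \<forall>a b. arc_rel H a b \<longrightarrow> {a, b} \<noteq> {x, y} \<longrightarrow> adj (f a) (f b)"
    using assms(2) unfolding edge_critical_def by blast+
  show "C5_critical G" using iso_critical[OF assms(1) H(1) assms(4) H(3,2,4)] .
  show "subgraph_free H3_graph G"
    using iso_embeds[OF assms(1) H(1) assms(4) pair_graph_wf[OF H3_graph_props(1)] H3_graph_props(2)] assms(3)
      H3_free_iff[OF assms(1)] by blast
qed

lemma critical_C3:
  assumes G: "pair_graph G" "C5_critical G" and t: "has_C3 (arc_rel G)"
  shows "K\<^bsub>3\<^esub> (with_proj G)"
proof -
  obtain a b c where abc: "(a, b) \<in> parcs G" "(b, c) \<in> parcs G" "(c, a) \<in> parcs G"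
    using t unfolding has_C3_def arc_rel_def by blast
  have d: "a \<noteq> b" "b \<noteq> c" "c \<noteq> a" using abc pair_graph_irrefl[OF G(1)] by metis+
  let ?T = "\<lparr>pverts = {a, b, c}, parcs = {(a, b), (b, c), (c, a)}\<^sup>s\<rparr>"
  have T: "pair_graph ?T" by (rule pair_graph_symcl) (use d in auto)
  have "subgraph (with_proj ?T) (with_proj G)"
    unfolding subgraph_pair_iff using pair_graph_wf[OF T] pair_graph_wf[OF G(1)] abc
      pair_wf_digraph.in_arcsD1[OF pair_graph_wf[OF G(1)]] pair_graph_symD[OF G(1)]
    by (auto simp: symcl_def)
  moreover have "\<not> C5_colourable ?T"
  proof
    assume "C5_colourable ?T"
    then obtain f where f: "\<forall>x y. arc_rel ?T x y \<longrightarrow> adj (f x) (f y)" using C5_colourable_iff[OF pair_graph_wf[OF T]] by blast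
    have "arc_rel ?T a b" "arc_rel ?T b c" "arc_rel ?T c a" unfolding arc_rel_def by (auto simp: symcl_def)
    then have "adj (f a) (f b)" "adj (f b) (f c)" "adj (f c) (f a)" using f by blast+
    moreover have "\<forall>p q r. \<not> (adj p q \<and> adj q r \<and> adj r p)" unfolding all_col by simp
    ultimately show False by blast
  qed
  ultimately have "G = ?T" using G(2) T unfolding C5_critical_def by blast
  then show ?thesis
    unfolding complete_digraph_pair_def using d by (auto simp: symcl_def)
qed

lemma critical_is_triangle_free_critical:
  assumes G: "pair_graph G" "C5_critical G" "subgraph_free H3_graph G" and nC3: "\<not> has_C3 (arc_rel G)"
  shows "triangle_free_critical (pverts G) (arc_rel G)"
proof
  note s = arc_rel_sym[OF G(1)]
  show "finite (pverts G)" using pair_graph_fin[OF G(1)] by blast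
  show "arc_rel G x y \<Longrightarrow> arc_rel G y x" for x y using s .
  show "\<not> arc_rel G x x" for x unfolding arc_rel_def using pair_graph_irrefl[OF G(1)] .
  show "arc_rel G x y \<Longrightarrow> x \<in> pverts G" for x y
    unfolding arc_rel_def by (rule pair_wf_digraph.in_arcsD1[OF pair_graph_wf[OF G(1)]])
  show "\<not> (\<forall>x y. arc_rel G x y \<longrightarrow> adj (f x) (f y))" for f
    using G(2) C5_colourable_iff[OF pair_graph_wf[OF G(1)]] unfolding C5_critical_def by blast
  show "\<exists>f. \<forall>x\<in>W. \<forall>y\<in>W. arc_rel G x y \<longrightarrow> adj (f x) (f y)" if "W \<subset> pverts G" for W
    using critical_colour_induced[OF G(1,2) that] .
  show "arc_rel G a b \<Longrightarrow> arc_rel G b c \<Longrightarrow> arc_rel G c a \<Longrightarrow> False" for a b c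
    using nC3 unfolding has_C3_def by blast
  show False if "arc_rel G u v" "arc_rel G v w" "arc_rel G w x" "arc_rel G u a" "arc_rel G u b" "arc_rel G x c" "arc_rel G x d"
      "distinct [u, v, w, x, a, b, c, d]" for u v w x a b c d
    using embeds_H3I[of "arc_rel G", OF s that] G(3) H3_free_iff[OF G(1)] by blast
qed

lemma critical_C4:
  assumes G: "pair_graph G" "C5_critical G" "subgraph_free H3_graph G" and "\<not> has_C3 (arc_rel G)" "has_C4 (arc_rel G)"
  shows "G \<cong>\<^sub>g E3_graph"
proof (rule ccontr)
  assume n: "\<not> ?thesis"
  interpret triangle_free_critical "pverts G" "arc_rel G" by (rule critical_is_triangle_free_critical) fact+
  interpret E3_free_counterexample "pverts G" "arc_rel G"
    by unfold_locales (use n critical_iso_edge_critical[OF G(1,2) E3_edge_critical] in blast)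
  show False using no_sq assms(5) unfolding has_C4_def sq_def by blast
qed

lemma critical_no_C4:
  assumes G: "pair_graph G" "C5_critical G" "subgraph_free H3_graph G"
    and "\<not> has_C3 (arc_rel G)" "\<not> has_C4 (arc_rel G)"
  shows "G \<cong>\<^sub>g E1_graph \<or> G \<cong>\<^sub>g E2_graph \<or> (\<exists>n\<ge>3. odd n \<and> G \<cong>\<^sub>g flower n)"
proof (rule ccontr)
  assume n: "\<not> ?thesis"
  interpret triangle_free_critical "pverts G" "arc_rel G" by (rule critical_is_triangle_free_critical) fact+
  interpret C4_free_counterexample "pverts G" "arc_rel G"
  proof
    show "arc_rel G a b \<Longrightarrow> arc_rel G b c \<Longrightarrow> arc_rel G c d \<Longrightarrow> arc_rel G d a \<Longrightarrow> a \<noteq> c \<Longrightarrow> b \<noteq> d \<Longrightarrow> False" for a b c d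
      using assms(5) unfolding has_C4_def by blast
    show "\<not> embeds E1_graph (arc_rel G)" "\<not> embeds E2_graph (arc_rel G)"
      using n critical_iso_edge_critical[OF G(1,2) E1_edge_critical] critical_iso_edge_critical[OF G(1,2) E2_edge_critical] by blast+
    show "\<not> embeds (flower k) (arc_rel G)" if "3 \<le> k" "odd k" for k
      using n that critical_iso_edge_critical[OF G(1,2) flower_edge_critical[OF that]] by blast
  qed
  show False by (rule no_counterexample)
qed

lemma iso_girth5:
  assumes G: "pair_graph G" and H: "edge_critical H" "\<not> has_C3 (arc_rel H)" "\<not> has_C4 (arc_rel H)" "has_C5 (arc_rel H)"
    and iso: "G \<cong>\<^sub>g H"
  shows "girth G = 5" "has_C5 (arc_rel G)"
proof -
  have Hg: "pair_graph H" using H(1) unfolding edge_critical_def by blast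
  have si: "H \<cong>\<^sub>g G" using graph_iso_sym[OF pair_graph_wf[OF G] pair_graph_wf[OF Hg] iso] .
  show c: "has_C5 (arc_rel G)" using iso_girth(3)[OF Hg G si H(4)] .
  have n: "\<not> has_C3 (arc_rel G)" "\<not> has_C4 (arc_rel G)" using iso_girth(1,2)[OF G Hg iso] H by blast+
  show "girth G = 5" by (rule order_antisym[OF girth_C5[OF G c] girth_ge5[OF G n]])
qed

lemma iso_E3_girth4:
  assumes G: "pair_graph G" and iso: "G \<cong>\<^sub>g E3_graph"
  shows "girth G = 4" "has_C4 (arc_rel G)"
proof -
  have Hg: "pair_graph E3_graph" using E3_edge_critical unfolding edge_critical_def by blast
  have si: "E3_graph \<cong>\<^sub>g G" using graph_iso_sym[OF pair_graph_wf[OF G] pair_graph_wf[OF Hg] iso] .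
  show c: "has_C4 (arc_rel G)" using iso_girth(2)[OF Hg G si E3_girth(2)] .
  have n: "\<not> has_C3 (arc_rel G)" using iso_girth(1)[OF G Hg iso] E3_girth by blast
  show "girth G = 4" by (rule order_antisym[OF girth_C4[OF G c] girth_ge4[OF G n]])
qed

lemma has_cycle_mono:
  assumes "\<And>x y. E x y \<Longrightarrow> F x y"
  shows "has_C3 E \<Longrightarrow> has_C3 F" "has_C4 E \<Longrightarrow> has_C4 F" "has_C5 E \<Longrightarrow> has_C5 F"
proof -
  show "has_C3 E \<Longrightarrow> has_C3 F" "has_C4 E \<Longrightarrow> has_C4 F" unfolding has_C3_def has_C4_def using assms by meson+
  assume "has_C5 E"
  then obtain a b c d e where e: "E a b" "E b c" "E c d" "E d e" "E e a" "distinct [a, b, c, d, e]"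
    unfolding has_C5_def by blast
  show "has_C5 F" unfolding has_C5_def
    by (rule exI[of _ a], rule exI[of _ b], rule exI[of _ c], rule exI[of _ d], rule exI[of _ e])
      (use e assms in blast)
qed

text \<open>A non-colourable subgraph minimising vertices plus arcs. It inherits the absence of
  \<open>H3\<close> and of short cycles, so the classification applies to it.\<close>

lemma obtain_critical_subgraph:
  assumes G: "pair_graph G" "\<not> C5_colourable G"
  obtains S where "pair_graph S" "subgraph (with_proj S) (with_proj G)" "C5_critical S"
proof -
  let ?P = "\<lambda>S :: 'a pair_pre_digraph. pair_graph S \<and> subgraph (with_proj S) (with_proj G) \<and> \<not> C5_colourable S"
  let ?m = "\<lambda>S :: 'a pair_pre_digraph. card (pverts S) + card (parcs S)"
  have "?P G" using G pair_graph_wf[OF G(1)] unfolding subgraph_pair_iff by blast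
  then obtain S where S: "?P S" and mn: "\<And>T. ?P T \<Longrightarrow> ?m S \<le> ?m T"
    using ex_has_least_nat[of ?P G ?m] by blast
  have fin: "finite (pverts S)" "finite (parcs S)" using pair_graph_fin S by blast+
  have "C5_critical S"
    unfolding C5_critical_def
  proof (intro conjI allI impI)
    show "\<not> C5_colourable S" using S by blast
    fix T assume T: "pair_graph T \<and> subgraph (with_proj T) (with_proj S) \<and> T \<noteq> S"
    then have sub: "pverts T \<subseteq> pverts S" "parcs T \<subseteq> parcs S" "subgraph (with_proj T) (with_proj G)"
      using S unfolding subgraph_pair_iff by auto
    show "C5_colourable T"
    proof (rule ccontr)
      assume "\<not> C5_colourable T"
      then have "?m S \<le> ?m T" using mn T sub by blast
      moreover have "card (pverts T) \<le> card (pverts S)" "card (parcs T) \<le> card (parcs S)"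
        using sub fin card_mono by blast+
      ultimately have "card (pverts S) \<le> card (pverts T)" "card (parcs S) \<le> card (parcs T)" by auto
      then have "pverts T = pverts S" "parcs T = parcs S" using card_seteq fin sub by blast+
      then show False using T by simp
    qed
  qed
  then show thesis using that S by blast
qed

theorem theorem22:
  fixes G :: "'a pair_pre_digraph"
  assumes "pair_graph G"
  shows "(subgraph_free H3_graph G \<and> C5_critical G \<longrightarrow>
            K\<^bsub>3\<^esub> (with_proj G) \<or> (\<exists>n\<ge>3. odd n \<and> G \<cong>\<^sub>g flower n) \<or>
            G \<cong>\<^sub>g E1_graph \<or> G \<cong>\<^sub>g E2_graph \<or> G \<cong>\<^sub>g E3_graph) \<and>
         (subgraph_free H3_graph G \<and> 6 \<le> girth G \<longrightarrow> C5_colourable G) \<and>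
         (subgraph_free H3_graph G \<and> C5_critical G \<and> girth G = 5 \<longleftrightarrow>
            G \<cong>\<^sub>g E1_graph \<or> G \<cong>\<^sub>g E2_graph \<or> (\<exists>n\<ge>3. odd n \<and> G \<cong>\<^sub>g flower n)) \<and>
         (subgraph_free H3_graph G \<and> C5_critical G \<and> girth G = 4 \<longleftrightarrow> G \<cong>\<^sub>g E3_graph)"
proof (intro conjI impI iffI)
  note G = assms
  have C3: "girth G \<le> 3" if "has_C3 (arc_rel G)" using girth_C3[OF G that] .
  have C4: "girth G \<le> 4" if "has_C4 (arc_rel G)" using girth_C4[OF G that] .
  show "K\<^bsub>3\<^esub> (with_proj G) \<or> (\<exists>n\<ge>3. odd n \<and> G \<cong>\<^sub>g flower n) \<or> G \<cong>\<^sub>g E1_graph \<or> G \<cong>\<^sub>g E2_graph \<or> G \<cong>\<^sub>g E3_graph"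
    if "subgraph_free H3_graph G \<and> C5_critical G"
    using critical_C3[OF G] critical_C4[OF G] critical_no_C4[OF G] that by blast
  show "C5_colourable G" if g6: "subgraph_free H3_graph G \<and> 6 \<le> girth G"
  proof (rule ccontr)
    assume "\<not> C5_colourable G"
    then obtain S where S: "pair_graph S" "subgraph (with_proj S) (with_proj G)" "C5_critical S"
      using obtain_critical_subgraph[OF G] by blast
    have rel: "arc_rel S x y \<Longrightarrow> arc_rel G x y" for x y
      using S(2) unfolding subgraph_pair_iff arc_rel_def by blast
    have "\<not> embeds H3_graph (arc_rel S)"
      using g6 rel unfolding H3_free_iff[OF G] embeds_def by fast
    then have f: "subgraph_free H3_graph S" using H3_free_iff[OF S(1)] by blast
    have no: "\<not> girth G \<le> 3" "\<not> girth G \<le> 4" "\<not> girth G \<le> 5"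
      using g6 by (auto dest!: order_trans[of 6 "girth G"])
    have nc: "\<not> has_C3 (arc_rel G)" "\<not> has_C4 (arc_rel G)" "\<not> has_C5 (arc_rel G)" using C3 C4 girth_C5[OF G] no by blast+
    have "\<not> has_C3 (arc_rel S)" "\<not> has_C4 (arc_rel S)" "\<not> has_C5 (arc_rel S)"
      using nc has_cycle_mono[of "arc_rel S" "arc_rel G", OF rel] by blast+
    \<comment> \<open>Every graph that remains for \<open>S\<close> contains a 5-cycle.\<close>
    then show False using critical_no_C4[OF S(1,3) f] iso_girth5(2)[OF S(1)]
      E1_edge_critical E1_girth E2_edge_critical E2_girth flower_edge_critical flower_girth by metis
  qed
  show "G \<cong>\<^sub>g E1_graph \<or> G \<cong>\<^sub>g E2_graph \<or> (\<exists>n\<ge>3. odd n \<and> G \<cong>\<^sub>g flower n)"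
    if g5: "subgraph_free H3_graph G \<and> C5_critical G \<and> girth G = 5"
  proof -
    have "\<not> girth G \<le> 3" "\<not> girth G \<le> 4" using g5 by auto
    then show ?thesis using critical_no_C4[OF G] g5 C3 C4 by blast
  qed
  show "G \<cong>\<^sub>g E3_graph" if g4: "subgraph_free H3_graph G \<and> C5_critical G \<and> girth G = 4"
  proof -
    have "\<not> girth G \<le> 3" "\<not> 5 \<le> girth G" using g4 by auto
    then show ?thesis using critical_C4[OF G] g4 C3 girth_ge5[OF G] by blast
  qed
  assume iso: "G \<cong>\<^sub>g E1_graph \<or> G \<cong>\<^sub>g E2_graph \<or> (\<exists>n\<ge>3. odd n \<and> G \<cong>\<^sub>g flower n)"
  have "subgraph_free H3_graph G \<and> C5_critical G \<and> girth G = 5"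
    using iso
  proof (elim disjE exE conjE)
    assume i: "G \<cong>\<^sub>g E1_graph"
    show ?thesis using iso_edge_critical[OF G E1_edge_critical E1_H3_free i] iso_girth5[OF G E1_edge_critical E1_girth i] by blast
  next
    assume i: "G \<cong>\<^sub>g E2_graph"
    show ?thesis using iso_edge_critical[OF G E2_edge_critical E2_H3_free i] iso_girth5[OF G E2_edge_critical E2_girth i] by blast
  next
    fix n assume n: "n \<ge> 3" "odd n" and i: "G \<cong>\<^sub>g flower n"
    note ec = flower_edge_critical[OF n]
    show ?thesis using iso_edge_critical[OF G ec flower_H3_free[OF n(1)] i] iso_girth5[OF G ec flower_girth[OF n(1)] i] by blast
  qed
  then show "subgraph_free H3_graph G" "C5_critical G" "girth G = 5" by blast+
next
  assume i: "G \<cong>\<^sub>g E3_graph"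
  show "subgraph_free H3_graph G" "C5_critical G" "girth G = 4"
    using iso_edge_critical[OF assms E3_edge_critical E3_H3_free i] iso_E3_girth4[OF assms i] by blast+
qed

end
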